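(* There exist aspherical closed $5$-manifolds whose fundamental group is perfect. *)

theory Defs
  imports "HOL-Analysis.Analysis" "HOL-Algebra.Generated_Groups"
begin

definition topological_manifold :: "nat \<Rightarrow> 'a topology \<Rightarrow> bool" where
  "topological_manifold n X \<longleftrightarrow>
     Hausdorff_space X \<and> second_countable X \<and>
     (\<forall>x \<in> topspace X. \<exists>U V. openin X U \<and> x \<in> U \<and> openin (Euclidean_space n) V \<and>
        subtopology X U homeomorphic_space subtopology (Euclidean_space n) V)"

definition closed_manifold :: "nat \<Rightarrow> 'a topology \<Rightarrow> bool" where
  "closed_manifold n X \<longleftrightarrow> topological_manifold n X \<and> compact_space X"

definition loops :: "'a topology \<Rightarrow> 'a \<Rightarrow> (real \<Rightarrow> 'a) set" where
  "loops X x = {p. pathin X p \<and> p 0 = x \<and> p 1 = x}"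

definition loop_rel :: "'a topology \<Rightarrow> 'a \<Rightarrow> ((real \<Rightarrow> 'a) \<times> (real \<Rightarrow> 'a)) set" where
  "loop_rel X x = {(p, q). p \<in> loops X x \<and> q \<in> loops X x \<and>
     homotopic_with (\<lambda>h. h 0 = x \<and> h 1 = x) (subtopology euclideanreal {0..1}) X p q}"

definition loop_join :: "(real \<Rightarrow> 'a) \<Rightarrow> (real \<Rightarrow> 'a) \<Rightarrow> real \<Rightarrow> 'a" where
  "loop_join p q = (\<lambda>t. if t \<le> 1/2 then p (2 * t) else q (2 * t - 1))"

definition fundamental_group :: "'a topology \<Rightarrow> 'a \<Rightarrow> (real \<Rightarrow> 'a) set monoid" where
  "fundamental_group X x =
     \<lparr> carrier = loops X x // loop_rel X x,
       mult = (\<lambda>A B. \<Union>p\<in>A. \<Union>q\<in>B. loop_rel X x `` {loop_join p q}),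
       one = loop_rel X x `` {\<lambda>t. x} \<rparr>"

definition perfect_group :: "('a, 'b) monoid_scheme \<Rightarrow> bool" where
  "perfect_group G \<longleftrightarrow> derived G (carrier G) = carrier G"

text \<open>Aspherical: path-connected and pi_n = 0 for all n >= 2, i.e. every map
  from the n-sphere is (freely) nullhomotopic.\<close>
definition aspherical :: "'a topology \<Rightarrow> bool" where
  "aspherical X \<longleftrightarrow> path_connected_space X \<and>
     (\<forall>n\<ge>2. \<forall>f. continuous_map (nsphere n) X f \<longrightarrow>
        (\<exists>c. homotopic_with (\<lambda>_. True) (nsphere n) X f (\<lambda>_. c)))"

end

theory Submission
  imports Defs "HOL-Algebra.Multiplicative_Group"
begin

text \<open>The manifold is a quotient of \<open>D \<times> \<real> \<times> D\<close>, where \<open>D\<close> is the hyperbolic disc. Let \<open>L\<close> be the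
  preimage of the \<open>(2,3,7)\<close> triangle group in the universal cover of \<open>SU(1,1)\<close>. It acts freely and
  cocompactly on \<open>D \<times> \<real>\<close>, because torsion elements of the triangle group acquire infinite order in the
  universal cover, and it is generated by \<open>x, w\<close> with \<open>x\<^sup>2 = w\<^sup>7\<close>, \<open>(xw)\<^sup>3 = x\<^sup>4\<close>, hence perfect. For a
  congruence subgroup \<open>K\<close> that contains no rotation, the fibre square \<open>{(a, b) \<in> L \<times> L. a\<inverse>b \<in> K}\<close> acts on
  \<open>(D \<times> \<real>) \<times> D\<close>, and its stabilizers act trivially. Its derived subgroup is perfect, as the diagonal is
  perfect, and it still acts cocompactly by Schur's theorem on groups with centre of finite index.
  The quotient is covered by the contractible space \<open>D \<times> \<real> \<times> D\<close>, so it is aspherical, and its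
  fundamental group is a homomorphic image of a perfect group. Discreteness of \<open>L\<close> comes from the
  arithmetic of \<open>\<int>[2 cos (\<pi>/7)]\<close>; cocompactness from the fact that outside a compact part of \<open>D\<close> some
  \<open>x w\<^sup>n\<close> moves a point towards the centre by a definite amount.\<close>

section \<open>Perfect groups\<close>

text \<open>Disc times line modulo \<open>L\<close> is already a closed aspherical 3-manifold with
  perfect group; the difficulty is to gain two dimensions. A product with a closed hyperbolic
  surface fails, since a surface group has infinite abelianization, while the triangle group is
  perfect but has torsion and does not act freely on the second disc. The fibre square resolves the
  conflict: if (a, b) fixes a point, freeness on disc times line makes a act trivially, so b acts on
  the second disc as an element of K. The group that acts in the end has an infinite kernel, since
  it contains nontrivial pairs (1, k) with k central. This is why freeness and properness are stated
  for the induced maps, and why the fundamental group is obtained as an image, which is enough for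
  perfectness. All three Galois conjugates of a matrix are carried along: two of them lie in a
  compact group, so a bound at the remaining place bounds integer coefficients, and bounded integers
  are finite in number.\<close>

context group
begin

definition commutator :: "'a \<Rightarrow> 'a \<Rightarrow> 'a"
  where "commutator a b = a \<otimes> b \<otimes> inv a \<otimes> inv b"

lemma inv_cancel_left:
  assumes "x \<in> carrier G" "y \<in> carrier G"
  shows "inv x \<otimes> (x \<otimes> y) = y" "x \<otimes> (inv x \<otimes> y) = y"
  using assms by (simp_all flip: m_assoc)

lemmas group_normalize = m_assoc inv_mult_group inv_cancel_left

lemma commutator_closed [simp]:
  "a \<in> carrier G \<Longrightarrow> b \<in> carrier G \<Longrightarrow> commutator a b \<in> carrier G"
  by (simp add: commutator_def)

lemma inv_commutator:
  "a \<in> carrier G \<Longrightarrow> b \<in> carrier G \<Longrightarrow> inv (commutator a b) = commutator b a"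
  by (simp add: commutator_def group_normalize)

lemma conj_commutator:
  "a \<in> carrier G \<Longrightarrow> b \<in> carrier G \<Longrightarrow> g \<in> carrier G \<Longrightarrow>
   g \<otimes> commutator a b \<otimes> inv g = commutator (g \<otimes> a \<otimes> inv g) (g \<otimes> b \<otimes> inv g)"
  by (simp add: commutator_def group_normalize)

text \<open>Merging two conjugate commutators into a single one is the step that saves a factor in
  Schur's argument.\<close>

lemma commutator_mult_conj:
  assumes "a \<in> carrier G" "b \<in> carrier G"
  shows "commutator a b \<otimes> (b \<otimes> commutator a b \<otimes> inv b) = commutator a (b \<otimes> b)"
  using assms by (simp add: commutator_def group_normalize)

lemma commutator_in_derived:
  "a \<in> H \<Longrightarrow> b \<in> H \<Longrightarrow> commutator a b \<in> derived G H"
  unfolding derived_def commutator_def by (rule generate.incl) blast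

lemma conj_nat_pow:
  assumes "b \<in> carrier G" "c \<in> carrier G"
  shows "b \<otimes> c [^] (k::nat) \<otimes> inv b = (b \<otimes> c \<otimes> inv b) [^] k"
proof (induction k)
  case (Suc k)
  have "b \<otimes> c [^] Suc k \<otimes> inv b = (b \<otimes> c [^] k \<otimes> inv b) \<otimes> (b \<otimes> c \<otimes> inv b)"
    using assms by (simp add: group_normalize)
  then show ?case using Suc.IH by simp
qed (use assms in simp)

section \<open>Products of lists of group elements\<close>

definition word :: "'a list \<Rightarrow> 'a" where "word xs = foldr (\<otimes>) xs \<one>"

lemma word_simps [simp]: "word [] = \<one>" "word (x # xs) = x \<otimes> word xs"
  by (simp_all add: word_def)

lemma word_closed [simp]: "set xs \<subseteq> carrier G \<Longrightarrow> word xs \<in> carrier G"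
  by (induction xs) auto

lemma word_append:
  "set xs \<subseteq> carrier G \<Longrightarrow> set ys \<subseteq> carrier G \<Longrightarrow> word (xs @ ys) = word xs \<otimes> word ys"
  by (induction xs) (auto simp: m_assoc)

lemma word_replicate: "c \<in> carrier G \<Longrightarrow> word (replicate k c) = c [^] k"
  by (induction k) (simp_all, metis nat_pow_Suc nat_pow_Suc2)

text \<open>Moving an occurrence of \<open>c\<close> to the front conjugates the factors that it
  passes, and \<open>S\<close> is closed under conjugation. The total number of factors is
  unchanged.\<close>

lemma word_collect_power:
  assumes S: "S \<subseteq> carrier G" "\<And>g s. g \<in> carrier G \<Longrightarrow> s \<in> S \<Longrightarrow> g \<otimes> s \<otimes> inv g \<in> S"
    and c: "c \<in> carrier G"
  shows "set xs \<subseteq> S \<Longrightarrow> k \<le> count_list xs c \<Longrightarrow>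
    \<exists>ys. set ys \<subseteq> S \<and> length ys + k = length xs \<and> word xs = c [^] k \<otimes> word ys"
proof (induction xs arbitrary: k)
  case Nil
  then show ?case by (intro exI[of _ "[]"]) simp
next
  case (Cons x xs)
  have sub: "set xs \<subseteq> S" "x \<in> S" "x \<in> carrier G" using Cons.prems S by auto
  show ?case
  proof (cases k)
    case 0
    then show ?thesis using Cons.prems sub S(1)
      by (intro exI[of _ "x # xs"]) (auto intro!: l_one[symmetric] word_closed)
  next
    case (Suc j)
    show ?thesis
    proof (cases "x = c")
      case True
      then have "j \<le> count_list xs c" using Cons.prems Suc by simp
      from Cons.IH[OF sub(1) this] obtain ys
        where ys: "set ys \<subseteq> S" "length ys + j = length xs" "word xs = c [^] j \<otimes> word ys" by blast
      have "word ys \<in> carrier G" using ys S(1) by (meson subset_trans word_closed)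
      then have "word (x # xs) = c [^] k \<otimes> word ys"
        using ys(3) True c Suc nat_pow_Suc2[OF c, of j] by (simp flip: m_assoc)
      then show ?thesis using ys Suc by (intro exI[of _ ys]) simp
    next
      case False
      then have "k \<le> count_list xs c" using Cons.prems by simp
      from Cons.IH[OF sub(1) this] obtain ys
        where ys: "set ys \<subseteq> S" "length ys + k = length xs" "word xs = c [^] k \<otimes> word ys" by blast
      have yc: "word ys \<in> carrier G" using ys S(1) by (meson subset_trans word_closed)
      let ?x = "inv (c [^] k) \<otimes> x \<otimes> inv (inv (c [^] k))"
      have "word (x # xs) = c [^] k \<otimes> word (?x # ys)"
        using yc ys(3) sub c by (simp add: group_normalize)
      moreover have "?x \<in> S" using S(2)[of "inv (c [^] k)" x] sub c by simp
      ultimately show ?thesis using ys by (intro exI[of _ "?x # ys"]) simp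
    qed
  qed
qed

text \<open>Since c^n is central, where c is the commutator, it equals its conjugate by
  \<open>b\<close>. Hence c^(n+1) is c times n copies of b c b^-1, and the first two of these n + 1
  factors merge by \<open>commutator_mult_conj\<close>.\<close>

lemma commutator_power_word:
  assumes ab: "a \<in> carrier G" "b \<in> carrier G" and n: "n > 0"
    and central: "\<And>g. g \<in> carrier G \<Longrightarrow> g \<otimes> commutator a b [^] n = commutator a b [^] n \<otimes> g"
  shows "commutator a b [^] Suc n
    = word (commutator a (b \<otimes> b) # replicate (n - 1) (b \<otimes> commutator a b \<otimes> inv b))"
proof -
  let ?c = "commutator a b" and ?d = "b \<otimes> commutator a b \<otimes> inv b"
  have cc: "?c \<in> carrier G" "?d \<in> carrier G" using ab by auto
  obtain m where m: "n = Suc m" using n by (cases n) auto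
  have "?c [^] n = b \<otimes> ?c [^] n \<otimes> inv b"
    using central[OF ab(2)] ab cc by (simp add: group_normalize del: nat_pow_Suc)
  also have "\<dots> = ?d [^] n" using ab cc by (simp add: conj_nat_pow del: nat_pow_Suc)
  finally have "?c [^] Suc n = ?c \<otimes> (?d \<otimes> ?d [^] m)"
    using cc m nat_pow_Suc2[of ?c n] nat_pow_Suc2[of ?d m] by simp
  also have "\<dots> = commutator a (b \<otimes> b) \<otimes> ?d [^] m"
    using commutator_mult_conj[OF ab] cc by (simp flip: m_assoc)
  finally show ?thesis using m cc by (simp add: word_replicate)
qed

text \<open>Schur's argument: with \<open>n\<close> the index of \<open>Z\<close>, the power \<open>c\<^bsup>n+1\<^esup>\<close> of a commutator \<open>c\<close> is a product of
  \<open>n\<close> commutators, so by the pigeonhole principle long products of commutators can be shortened.\<close>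

theorem finite_if_central_perfect:
  assumes Z: "subgroup Z G" "\<And>z g. z \<in> Z \<Longrightarrow> g \<in> carrier G \<Longrightarrow> g \<otimes> z = z \<otimes> g"
    and fin: "finite (rcosets Z)" and perfect: "derived G (carrier G) = carrier G"
  shows "finite (carrier G)"
proof -
  interpret Z: subgroup Z G by fact
  interpret ZN: normal Z G
  proof (rule normalI[OF Z(1)], intro ballI)
    fix x assume "x \<in> carrier G"
    then show "Z #> x = x <# Z" using Z(2) by (auto simp: r_coset_def l_coset_def)
  qed
  define n where "n = card (rcosets Z)"
  have n0: "n > 0" unfolding n_def using fin Z.subgroup_in_rcosets is_group
    by (metis card_gt_0_iff empty_iff)
  have powZ: "g [^] n \<in> Z" if g: "g \<in> carrier G" for g
  proof -
    interpret Q: group "G Mod Z" by (rule ZN.factorgroup_is_group)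
    have "order (G Mod Z) = n" by (simp add: order_def FactGroup_def n_def)
    moreover have "Z #> g \<in> carrier (G Mod Z)" using g by (simp add: carrier_FactGroup)
    ultimately have "(Z #> g) [^]\<^bsub>G Mod Z\<^esub> n = Z"
      using Q.pow_order_eq_1 by fastforce
    then have "Z #> g [^] n = Z" using ZN.FactGroup_pow[OF g] by simp
    then show ?thesis using g by (metis nat_pow_closed rcos_self Z(1))
  qed
  define S where "S = {commutator a b | a b. a \<in> carrier G \<and> b \<in> carrier G}"
  have SG: "S \<subseteq> carrier G" by (auto simp: S_def)
  have Sconj: "g \<otimes> s \<otimes> inv g \<in> S" if "g \<in> carrier G" "s \<in> S" for g s
    using that unfolding S_def by (clarsimp simp: conj_commutator) (metis m_closed inv_closed)
  have "finite S"
  proof -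
    \<comment> \<open>A transversal of \<open>Z\<close>. Central factors cancel in a commutator, so
      \<open>S\<close> is already covered by the commutators of pairs from \<open>T\<close>.\<close>
    define T where "T = (\<lambda>C. SOME x. x \<in> C) ` (rcosets Z)"
    have rep: "\<exists>z\<in>Z. \<exists>t\<in>T. t \<in> carrier G \<and> g = z \<otimes> t" if g: "g \<in> carrier G" for g
    proof -
      let ?t = "SOME x. x \<in> Z #> g"
      have t: "?t \<in> Z #> g" using rcos_self[OF g Z(1)] by (rule someI)
      then obtain z where z: "z \<in> Z" "?t = z \<otimes> g" by (auto simp: r_coset_def)
      then have "inv z \<in> Z" "?t \<in> carrier G" "g = inv z \<otimes> ?t" using g by (auto simp: inv_cancel_left)
      moreover have "?t \<in> T" unfolding T_def using g rcosetsI[OF Z.subset g] by blast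
      ultimately show ?thesis by blast
    qed
    have "S \<subseteq> (\<lambda>(a, b). commutator a b) ` (T \<times> T)"
    proof
      fix s assume "s \<in> S"
      then obtain a b where s: "s = commutator a b" "a \<in> carrier G" "b \<in> carrier G"
        by (auto simp: S_def)
      obtain z t where a: "z \<in> Z" "t \<in> T" "t \<in> carrier G" "a = z \<otimes> t" using rep s by blast
      obtain y u where b: "y \<in> Z" "u \<in> T" "u \<in> carrier G" "b = y \<otimes> u" using rep s by blast
      have zy: "z \<in> carrier G" "y \<in> carrier G" using a b Z.mem_carrier by auto
      have iz: "inv z \<in> Z" "inv y \<in> Z" using a b by auto
      have "s = z \<otimes> (t \<otimes> (y \<otimes> (u \<otimes> (inv t \<otimes> inv z)))) \<otimes> (inv u \<otimes> inv y)"
        unfolding s a b commutator_def using a b zy by (simp add: group_normalize)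
      also have "\<dots> = z \<otimes> (t \<otimes> (y \<otimes> (u \<otimes> (inv z \<otimes> inv t)))) \<otimes> (inv y \<otimes> inv u)"
        using a b zy Z(2)[OF iz(1), of "inv t"] Z(2)[OF iz(2), of "inv u"] by simp
      also have "t \<otimes> (y \<otimes> (u \<otimes> (inv z \<otimes> inv t))) = inv z \<otimes> (t \<otimes> (y \<otimes> (u \<otimes> inv t)))"
        using a b zy Z(2)[OF iz(1), of "t \<otimes> (y \<otimes> u)"] by (simp flip: m_assoc)
      also have "z \<otimes> (inv z \<otimes> (t \<otimes> (y \<otimes> (u \<otimes> inv t)))) = y \<otimes> (t \<otimes> (u \<otimes> inv t))"
        using a b zy Z(2)[OF b(1), of t] by (simp add: inv_cancel_left flip: m_assoc)
      also have "y \<otimes> (t \<otimes> (u \<otimes> inv t)) \<otimes> (inv y \<otimes> inv u) = t \<otimes> (u \<otimes> inv t) \<otimes> inv u"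
      proof -
        have "y \<otimes> w \<otimes> (inv y \<otimes> inv u) = w \<otimes> inv u" if w: "w \<in> carrier G" for w
          using w zy b Z(2)[OF b(1) w, symmetric] by (simp add: m_assoc inv_cancel_left)
        from this[of "t \<otimes> (u \<otimes> inv t)"] show ?thesis using a b by simp
      qed
      finally have "s = commutator t u" using a b by (simp add: commutator_def m_assoc)
      then show "s \<in> (\<lambda>(a, b). commutator a b) ` (T \<times> T)" using a b by auto
    qed
    moreover have "finite (T \<times> T)" using fin by (simp add: T_def)
    ultimately show ?thesis by (meson finite_imageI finite_subset)
  qed
  define P where "P m = word ` {xs. set xs \<subseteq> S \<and> length xs = m}" for m
  have finP: "finite (P m)" for m
    unfolding P_def using finite_lists_length_eq[OF \<open>finite S\<close>, of m] by simp
  have PI: "set xs \<subseteq> S \<Longrightarrow> word xs \<in> P (length xs)" for xs unfolding P_def by blast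
  have P1: "s \<in> P 1" if "s \<in> S" for s
  proof -
    have "s \<in> carrier G" using that SG by blast
    then show ?thesis using PI[of "[s]"] that by simp
  qed
  \<comment> \<open>\<open>\<one>\<close> is itself a commutator, so words can be padded and the
    sets \<open>P m\<close> increase with \<open>m\<close>.\<close>
  have oneS: "\<one> \<in> S" unfolding S_def by (auto intro!: exI[of _ \<one>] simp: commutator_def)
  have Pmult: "p \<otimes> q \<in> P (i + j)" if pq: "p \<in> P i" "q \<in> P j" for p q i j
  proof -
    obtain xs ys where "set xs \<subseteq> S" "length xs = i" "p = word xs"
      "set ys \<subseteq> S" "length ys = j" "q = word ys" using pq unfolding P_def by auto
    then show ?thesis using PI[of "xs @ ys"] SG by (simp add: word_append subset_trans)
  qed
  have PG: "P m \<subseteq> carrier G" for m using SG unfolding P_def by (auto intro!: word_closed)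
  have Pmono: "P i \<subseteq> P (i + j)" for i j
  proof
    fix p assume p: "p \<in> P i"
    have "word (replicate j \<one>) \<in> P j" using PI[of "replicate j \<one>"] oneS by (simp add: set_replicate_conv_if)
    then have "p \<otimes> \<one> \<in> P (i + j)" using Pmult[OF p] by (simp add: word_replicate)
    moreover have "p \<in> carrier G" using p PG[of i] by blast
    ultimately show "p \<in> P (i + j)" by simp
  qed
  have pow: "c [^] Suc n \<in> P n" if cS: "c \<in> S" for c
  proof -
    obtain a b where c: "c = commutator a b" "a \<in> carrier G" "b \<in> carrier G"
      using cS by (auto simp: S_def)
    have "c [^] n \<in> Z" using powZ c by simp
    then have "c [^] Suc n = word (commutator a (b \<otimes> b) # replicate (n - 1) (b \<otimes> c \<otimes> inv b))"
      using commutator_power_word[OF c(2,3) n0] Z(2) c(1) by blast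
    moreover have "set (commutator a (b \<otimes> b) # replicate (n - 1) (b \<otimes> c \<otimes> inv b)) \<subseteq> S"
      using Sconj[OF c(3) cS] c by (auto simp: S_def set_replicate_conv_if)
    ultimately show ?thesis using PI n0 by (metis (no_types, lifting) Suc_diff_1 length_Cons length_replicate)
  qed
  \<comment> \<open>Pigeonhole threshold: among \<open>M + 1\<close> factors from \<open>S\<close>
    one value occurs at least \<open>n + 1\<close> times.\<close>
  define M where "M = n * card S"
  have shorten: "P (Suc M) \<subseteq> P M"
  proof
    fix p assume "p \<in> P (Suc M)"
    then obtain xs where xs: "set xs \<subseteq> S" "length xs = Suc M" "p = word xs" unfolding P_def by blast
    have "\<exists>c\<in>S. Suc n \<le> count_list xs c"
    proof (rule ccontr)
      assume "\<not> ?thesis"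
      then have "(\<Sum>c\<in>S. count_list xs c) \<le> (\<Sum>c\<in>S. n)" by (intro sum_mono) (auto simp: not_le)
      moreover have "(\<Sum>c\<in>S. count_list xs c) = length xs"
        using sum_count_set[OF xs(1) \<open>finite S\<close>] .
      ultimately show False using xs by (simp add: M_def mult.commute)
    qed
    then obtain c where c: "c \<in> S" "Suc n \<le> count_list xs c" by blast
    obtain ys where ys: "set ys \<subseteq> S" "length ys + Suc n = length xs" "word xs = c [^] Suc n \<otimes> word ys"
      using word_collect_power[OF SG Sconj _ xs(1) c(2)] c SG by blast
    have "word xs \<in> P (n + length ys)" using Pmult[OF pow[OF c(1)] PI[OF ys(1)]] ys(3) by simp
    then show "p \<in> P M" using xs ys by (simp add: add.commute)
  qed
  have all: "P m \<subseteq> P M" for m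
  proof (induction m)
    case 0
    then show ?case using Pmono[of 0 M] by simp
  next
    case (Suc m)
    have "P (Suc m) \<subseteq> P (Suc M)"
    proof
      fix p assume "p \<in> P (Suc m)"
      then obtain x xs where "set (x # xs) \<subseteq> S" "length xs = m" "p = word (x # xs)"
        unfolding P_def by (auto simp: length_Suc_conv)
      moreover from this have "word [x] \<in> P 1" "word xs \<in> P M" using PI[of "[x]"] PI[of xs] Suc by auto
      ultimately show "p \<in> P (Suc M)" using Pmult[of "word [x]" 1 "word xs" M] SG by auto
    qed
    then show ?case using shorten by blast
  qed
  have "derived G (carrier G) \<subseteq> P M"
  proof
    fix g assume "g \<in> derived G (carrier G)"
    then have "g \<in> generate G S"
      unfolding derived_def S_def commutator_def by (rule rev_subsetD) (rule mono_generate, blast)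
    then show "g \<in> P M"
    proof (induction rule: generate.induct)
      case one
      then show ?case using PI[of "[]"] all by auto
    next
      case (incl h)
      then show ?case using P1 all by blast
    next
      case (inv h)
      then have "inv h \<in> S" unfolding S_def by (clarsimp simp: inv_commutator) blast
      then show ?case using P1 all by blast
    next
      case (eng h1 h2)
      then show ?case using Pmult all by blast
    qed
  qed
  then show ?thesis using perfect finP finite_subset by metis
qed

text \<open>Modulo \<open>N\<close> the image of \<open>K\<close> becomes central, because
  commutators with \<open>K\<close> lie in \<open>N\<close>, and it still has finite index. A
  perfect group with a central subgroup of finite index is finite.\<close>

lemma perfect_quotient_finite:
  assumes perfect: "derived G (carrier G) = carrier G"
    and N: "N \<lhd> G" and K: "K \<lhd> G" "finite (rcosets K)"
    and comm: "\<And>k l. k \<in> K \<Longrightarrow> l \<in> carrier G \<Longrightarrow> commutator k l \<in> N"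
  shows "finite (rcosets N)"
proof -
  interpret N: normal N G by fact
  interpret K: normal K G by fact
  interpret Q: group "G Mod N" by (rule N.factorgroup_is_group)
  let ?h = "\<lambda>a. N #> a"
  have hom: "?h \<in> hom G (G Mod N)" by (rule N.r_coset_hom_Mod)
  interpret h: group_hom G "G Mod N" ?h using hom by unfold_locales
  have onto: "?h ` carrier G = carrier (G Mod N)" by (simp add: carrier_FactGroup)
  have "derived (G Mod N) (carrier (G Mod N)) = carrier (G Mod N)"
    using h.derived_img[of "carrier G"] perfect onto by simp
  moreover have Z: "subgroup (?h ` K) (G Mod N)"
    using h.subgroup_img_is_subgroup[OF K.subgroup_axioms] .
  moreover have "g \<otimes>\<^bsub>G Mod N\<^esub> z = z \<otimes>\<^bsub>G Mod N\<^esub> g"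
    if zK: "z \<in> ?h ` K" and gQ: "g \<in> carrier (G Mod N)" for z g
  proof -
    obtain k l where k: "k \<in> K" "z = ?h k" and l: "l \<in> carrier G" "g = ?h l"
      using zK gQ onto by (metis imageE)
    have kc: "k \<in> carrier G" using k K.mem_carrier by simp
    have "k \<otimes> l = commutator k l \<otimes> (l \<otimes> k)"
      using kc l by (simp add: commutator_def group_normalize)
    then have "?h (k \<otimes> l) = ?h (commutator k l) \<otimes>\<^bsub>G Mod N\<^esub> ?h (l \<otimes> k)"
      using kc l by (simp del: mult_FactGroup)
    also have "?h (commutator k l) = \<one>\<^bsub>G Mod N\<^esub>"
      using comm[OF k(1) l(1)] N.rcos_const[OF is_group] by simp
    finally have "?h (k \<otimes> l) = ?h (l \<otimes> k)"
      using kc l by (simp del: mult_FactGroup one_FactGroup)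
    then show ?thesis using h.hom_mult kc k l by (simp del: mult_FactGroup)
  qed
  moreover have "finite (rcosets\<^bsub>G Mod N\<^esub> (?h ` K))"
  proof -
    let ?r = "\<lambda>C. (?h ` K) #>\<^bsub>G Mod N\<^esub> ?h (SOME x. x \<in> C)"
    have "rcosets\<^bsub>G Mod N\<^esub> (?h ` K) \<subseteq> ?r ` (rcosets K)"
    proof
      fix D assume "D \<in> rcosets\<^bsub>G Mod N\<^esub> (?h ` K)"
      then obtain q where "q \<in> carrier (G Mod N)" "D = (?h ` K) #>\<^bsub>G Mod N\<^esub> q"
        by (auto simp: RCOSETS_def)
      then obtain g where g: "g \<in> carrier G" "D = (?h ` K) #>\<^bsub>G Mod N\<^esub> ?h g"
        using onto by (metis imageE)
      let ?t = "SOME x. x \<in> K #> g"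
      have "?t \<in> K #> g" using rcos_self[OF g(1) K.subgroup_axioms] by (rule someI)
      then obtain k where k: "k \<in> K" "?t = k \<otimes> g" by (auto simp: r_coset_def)
      have kc: "k \<in> carrier G" using k K.mem_carrier by simp
      have "?h ?t = ?h k \<otimes>\<^bsub>G Mod N\<^esub> ?h g" using k(2) kc g by (simp del: mult_FactGroup)
      then have "?h ?t \<in> (?h ` K) #>\<^bsub>G Mod N\<^esub> ?h g" using k(1) by (auto simp: r_coset_def)
      then have "(?h ` K) #>\<^bsub>G Mod N\<^esub> ?h ?t = D"
        using Q.repr_independence[OF _ _ Z] g onto by (metis imageI)
      then show "D \<in> ?r ` (rcosets K)" using rcosetsI[OF K.subset g(1)] by blast
    qed
    then show ?thesis using K(2) finite_surj by blast
  qed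
  ultimately have "finite (carrier (G Mod N))" 
    using Q.finite_if_central_perfect[of "?h ` K"] by blast
  then show ?thesis by (simp add: FactGroup_def)
qed

text \<open>Let \<open>P\<close> be the fibre square \<open>{(a, b). a\<inverse>b \<in> K}\<close>. Modulo any normal subgroup containing the
  diagonal, \<open>P\<close> becomes abelian: every element is congruent to some \<open>(1, k)\<close> and also to some \<open>(k, 1)\<close>.
  As the diagonal is perfect, it survives in every derived subgroup, so the first derived subgroup
  of \<open>P\<close> is already perfect.\<close>

theorem perfect_in_fibre_square:
  assumes perfect: "derived G (carrier G) = carrier G"
    and K: "K \<lhd> G" "finite (rcosets K)"
  obtains H where "subgroup H (G \<times>\<times> G)" "derived (G \<times>\<times> G) H = H"
    "\<And>a b. (a, b) \<in> H \<Longrightarrow> inv a \<otimes> b \<in> K"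
    "\<And>a. a \<in> carrier G \<Longrightarrow> (a, a) \<in> H"
    "finite (rcosets {k \<in> carrier G. (k, \<one>) \<in> H})" "{k \<in> carrier G. (k, \<one>) \<in> H} \<lhd> G"
proof -
  interpret K: normal K G by fact
  interpret S: group "G \<times>\<times> G" by (rule DirProd_group[OF is_group is_group])
  define P where "P = {(a, b). a \<in> carrier G \<and> b \<in> carrier G \<and> inv a \<otimes> b \<in> K}"
  have inv_S: "inv\<^bsub>G \<times>\<times> G\<^esub> (a, b) = (inv a, inv b)" if "a \<in> carrier G" "b \<in> carrier G" for a b
    using that inv_DirProd[OF is_group is_group] by simp
  have sub_P: "subgroup P (G \<times>\<times> G)"
  proof (rule S.subgroupI)
    show "P \<subseteq> carrier (G \<times>\<times> G)" "P \<noteq> {}" by (auto simp: P_def intro!: exI[of _ \<one>])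
    show "inv\<^bsub>G \<times>\<times> G\<^esub> x \<in> P" if x: "x \<in> P" for x
    proof -
      obtain a b where ab: "x = (a, b)" "a \<in> carrier G" "b \<in> carrier G" "inv a \<otimes> b \<in> K"
        using x by (auto simp: P_def)
      have "a \<otimes> inv (inv a \<otimes> b) \<otimes> inv a \<in> K"
        using ab K.inv_op_closed2[of a "inv (inv a \<otimes> b)"] by simp
      then show ?thesis using ab by (simp add: inv_S P_def group_normalize)
    qed
    show "x \<otimes>\<^bsub>G \<times>\<times> G\<^esub> y \<in> P" if xy: "x \<in> P" "y \<in> P" for x y
    proof -
      obtain a b where ab: "x = (a, b)" "a \<in> carrier G" "b \<in> carrier G" "inv a \<otimes> b \<in> K"
        using xy by (auto simp: P_def)
      obtain c d where cd: "y = (c, d)" "c \<in> carrier G" "d \<in> carrier G" "inv c \<otimes> d \<in> K"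
        using xy by (auto simp: P_def)
      have "inv c \<otimes> (inv a \<otimes> b) \<otimes> c \<in> K" using K.inv_op_closed1 cd ab by simp
      then have "(inv c \<otimes> (inv a \<otimes> b) \<otimes> c) \<otimes> (inv c \<otimes> d) \<in> K" using cd by simp
      then show ?thesis using ab cd by (simp add: P_def group_normalize)
    qed
  qed
  interpret P: subgroup P "G \<times>\<times> G" by fact
  define GP where "GP = (G \<times>\<times> G)\<lparr>carrier := P\<rparr>"
  interpret GP: group GP unfolding GP_def by (rule S.subgroup_imp_group[OF sub_P])
  have GP: "carrier GP = P" "mult GP = mult (G \<times>\<times> G)" "one GP = (\<one>, \<one>)"
    by (auto simp: GP_def)
  have inv_GP: "inv\<^bsub>GP\<^esub> x = inv\<^bsub>G \<times>\<times> G\<^esub> x" if "x \<in> P" for x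
    unfolding GP_def using S.m_inv_consistent[OF sub_P that] by simp
  define diag where "diag = (\<lambda>a. (a, a)) ` carrier G"
  have diag_P: "diag \<subseteq> P" by (auto simp: diag_def P_def)
  have diag_perfect: "derived (G \<times>\<times> G) diag = diag"
  proof -
    interpret d: group_hom G "G \<times>\<times> G" "\<lambda>a. (a, a)"
      by unfold_locales (auto simp: hom_def)
    show ?thesis using d.derived_img[of "carrier G"] perfect by (simp add: diag_def)
  qed
  define H where "H = derived GP P"
  have H_eq: "H = derived (G \<times>\<times> G) P"
    unfolding H_def GP_def by (rule S.derived_consistent[OF _ sub_P]) simp
  have sub_H: "subgroup H (G \<times>\<times> G)"
    unfolding H_eq by (rule S.derived_is_subgroup) (use P.subset in simp)
  have HP: "H \<subseteq> P" unfolding H_def using GP.derived_in_carrier[of P] GP by simp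
  have normal_H: "H \<lhd> GP" unfolding H_def using GP.derived_is_normal[OF GP.normal_self] GP by simp
  have diag_H: "diag \<subseteq> H"
    using S.mono_derived[OF diag_P] P.subset diag_perfect unfolding H_eq by simp
  define D where "D = derived GP H"
  have D_eq: "D = derived (G \<times>\<times> G) H"
    unfolding D_def GP_def by (rule S.derived_consistent[OF HP sub_P])
  have normal_D: "D \<lhd> GP" unfolding D_def by (rule GP.derived_is_normal[OF normal_H])
  interpret D: normal D GP by fact
  have diag_D: "diag \<subseteq> D"
    using S.mono_derived[OF diag_H] P.subset HP diag_perfect unfolding D_eq by auto
  have factor: "\<exists>k\<in>K. D #>\<^bsub>GP\<^esub> x = D #>\<^bsub>GP\<^esub> (\<one>, k)" if x: "x \<in> P" for x
  proof -
    obtain a b where ab: "x = (a, b)" "a \<in> carrier G" "b \<in> carrier G" "inv a \<otimes> b \<in> K"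
      using x by (auto simp: P_def)
    have aa: "(a, a) \<in> D" using diag_D ab by (auto simp: diag_def)
    have "(\<one>, inv a \<otimes> b) \<in> P" using ab by (simp add: P_def)
    moreover have "x = (a, a) \<otimes>\<^bsub>GP\<^esub> (\<one>, inv a \<otimes> b)" using ab by (simp add: GP inv_cancel_left)
    ultimately have "x \<in> D #>\<^bsub>GP\<^esub> (\<one>, inv a \<otimes> b)" using aa by (auto simp: r_coset_def)
    then have "D #>\<^bsub>GP\<^esub> (\<one>, inv a \<otimes> b) = D #>\<^bsub>GP\<^esub> x"
      using GP.repr_independence[OF _ _ D.subgroup_axioms] \<open>(\<one>, inv a \<otimes> b) \<in> P\<close> GP by metis
    then show ?thesis using ab by metis
  qed
  have flip: "D #>\<^bsub>GP\<^esub> (\<one>, k) = D #>\<^bsub>GP\<^esub> (inv k, \<one>)" if k: "k \<in> K" for k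
  proof -
    have kc: "k \<in> carrier G" using k by simp
    have "(inv k, \<one>) \<in> P" using kc k by (simp add: P_def)
    moreover have "(\<one>, k) = (k, k) \<otimes>\<^bsub>GP\<^esub> (inv k, \<one>)" using kc by (simp add: GP)
    moreover have "(k, k) \<in> D" using diag_D kc by (auto simp: diag_def)
    ultimately have "(\<one>, k) \<in> D #>\<^bsub>GP\<^esub> (inv k, \<one>)" by (auto simp: r_coset_def)
    then show ?thesis
      using GP.repr_independence[OF _ _ D.subgroup_axioms] \<open>(inv k, \<one>) \<in> P\<close> GP by metis
  qed
  have comm_D: "comm_group (GP Mod D)"
  proof (rule group.group_comm_groupI[OF D.factorgroup_is_group])
    fix X Y assume "X \<in> carrier (GP Mod D)" "Y \<in> carrier (GP Mod D)"
    then obtain x y where xy: "x \<in> P" "y \<in> P" "X = D #>\<^bsub>GP\<^esub> x" "Y = D #>\<^bsub>GP\<^esub> y"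
      by (auto simp: carrier_FactGroup GP)
    obtain k where k: "k \<in> K" "X = D #>\<^bsub>GP\<^esub> (\<one>, k)" using factor xy by blast
    obtain l where l: "l \<in> K" "Y = D #>\<^bsub>GP\<^esub> (inv l, \<one>)" using factor flip xy by metis
    have kl: "k \<in> carrier G" "l \<in> carrier G" using k l by auto
    have "(\<one>, k) \<in> carrier GP" "(inv l, \<one>) \<in> carrier GP" using kl k l by (simp_all add: GP P_def)
    then show "X \<otimes>\<^bsub>GP Mod D\<^esub> Y = Y \<otimes>\<^bsub>GP Mod D\<^esub> X"
      using k l kl D.rcos_sum by (simp add: GP(2))
  qed
  have "H \<subseteq> D" unfolding H_def using GP.derived_minimal[OF normal_D comm_D] GP by simp
  moreover have "D \<subseteq> H" unfolding D_eq by (rule S.derived_incl[OF _ sub_H]) simp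
  ultimately have perfect_H: "derived (G \<times>\<times> G) H = H" using D_eq by simp
  interpret H: subgroup H "G \<times>\<times> G" by fact
  let ?N = "{k \<in> carrier G. (k, \<one>) \<in> H}"
  have normal_N: "?N \<lhd> G"
    unfolding normal_inv_iff
  proof (intro conjI ballI)
    show "subgroup ?N G"
    proof (rule subgroupI)
      show "?N \<subseteq> carrier G" "?N \<noteq> {}" using H.one_closed by auto
      show "inv k \<in> ?N" if "k \<in> ?N" for k
        using that H.m_inv_closed[of "(k, \<one>)"] by (simp add: inv_S)
      show "k \<otimes> l \<in> ?N" if "k \<in> ?N" "l \<in> ?N" for k l
        using that H.m_closed[of "(k, \<one>)" "(l, \<one>)"] by simp
    qed
    fix x h assume x: "x \<in> carrier G" and h: "h \<in> ?N"
    have xx: "(x, x) \<in> H" using diag_H x by (auto simp: diag_def)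
    have "(x, x) \<otimes>\<^bsub>G \<times>\<times> G\<^esub> (h, \<one>) \<otimes>\<^bsub>G \<times>\<times> G\<^esub> inv\<^bsub>G \<times>\<times> G\<^esub> (x, x) \<in> H"
      by (intro H.m_closed H.m_inv_closed xx) (use h in simp)
    then show "x \<otimes> h \<otimes> inv x \<in> ?N" using x h by (simp add: inv_S)
  qed
  have "finite (rcosets ?N)"
  proof (rule perfect_quotient_finite[OF perfect normal_N K])
    fix k l assume k: "k \<in> K" and l: "l \<in> carrier G"
    have kc: "k \<in> carrier G" using k by simp
    have "(k, \<one>) \<in> P" "(l, l) \<in> P" using k kc l by (simp_all add: P_def)
    \<comment> \<open>Componentwise this commutator is \<open>(commutator k l, \<one>)\<close>:
      pairing an element of \<open>K\<close> with the diagonal puts [K, G] into the first factor of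
      \<open>H\<close>.\<close>
    then have "S.commutator (k, \<one>) (l, l) \<in> H" unfolding H_eq by (rule S.commutator_in_derived)
    then show "commutator k l \<in> ?N"
      using kc l by (simp add: S.commutator_def commutator_def inv_S)
  qed
  moreover have "inv a \<otimes> b \<in> K" if "(a, b) \<in> H" for a b using that HP by (auto simp: P_def)
  moreover have "(a, a) \<in> H" if "a \<in> carrier G" for a using that diag_H by (auto simp: diag_def)
  ultimately show thesis using that sub_H perfect_H normal_N by blast
qed

text \<open>In the abelianization, \<open>(xw)\<^sup>3 = x\<^sup>4\<close> gives \<open>x = w\<^sup>3\<close>, and then \<open>w\<^sup>6 = x\<^sup>2 = w\<^sup>7\<close>.\<close>

lemma perfect_if_generated_2_3_7:
  assumes gen: "carrier G = generate G {x, w}" and xw: "x \<in> carrier G" "w \<in> carrier G"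
    and rel: "x [^] (2::nat) = w [^] (7::nat)" "(x \<otimes> w) [^] (3::nat) = x [^] (4::nat)"
  shows "derived G (carrier G) = carrier G"
proof -
  let ?D = "derived G (carrier G)"
  interpret D: normal ?D G by (rule derived_is_normal[OF normal_self])
  interpret Q: comm_group "G Mod ?D" by (rule derived_quot_is_comm_group)
  let ?h = "\<lambda>a. ?D #> a"
  have hom: "?h \<in> hom G (G Mod ?D)" by (rule D.r_coset_hom_Mod)
  interpret h: group_hom G "G Mod ?D" ?h using hom by unfold_locales
  have XW: "?h x \<in> carrier (G Mod ?D)" "?h w \<in> carrier (G Mod ?D)" using xw by auto
  have r1: "?h x [^]\<^bsub>G Mod ?D\<^esub> (2::nat) = ?h w [^]\<^bsub>G Mod ?D\<^esub> (7::nat)"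
    using h.hom_nat_pow[OF xw(1), of 2] h.hom_nat_pow[OF xw(2), of 7] rel(1) by simp
  have "(?h x \<otimes>\<^bsub>G Mod ?D\<^esub> ?h w) [^]\<^bsub>G Mod ?D\<^esub> (3::nat) = ?h x [^]\<^bsub>G Mod ?D\<^esub> (4::nat)"
    using h.hom_nat_pow[of "x \<otimes> w" 3] h.hom_nat_pow[OF xw(1), of 4] rel(2) h.hom_mult[OF xw] xw by simp
  then have "?h x [^]\<^bsub>G Mod ?D\<^esub> (3::nat) \<otimes>\<^bsub>G Mod ?D\<^esub> ?h w [^]\<^bsub>G Mod ?D\<^esub> (3::nat)
    = ?h x [^]\<^bsub>G Mod ?D\<^esub> (3::nat) \<otimes>\<^bsub>G Mod ?D\<^esub> ?h x"
    using Q.nat_pow_mult[OF XW(1), of 3 1] Q.nat_pow_distrib[OF XW, of 3] Q.nat_pow_eone[OF XW(1)]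
    by (simp del: mult_FactGroup one_FactGroup)
  then have r2: "?h x = ?h w [^]\<^bsub>G Mod ?D\<^esub> (3::nat)"
    using XW Q.Units_l_cancel[of "?h x [^]\<^bsub>G Mod ?D\<^esub> (3::nat)"] by (simp del: mult_FactGroup)
  have "?h w [^]\<^bsub>G Mod ?D\<^esub> (6::nat) = ?h w [^]\<^bsub>G Mod ?D\<^esub> (6::nat) \<otimes>\<^bsub>G Mod ?D\<^esub> ?h w [^]\<^bsub>G Mod ?D\<^esub> (1::nat)"
    using r1 r2 Q.nat_pow_pow[OF XW(2), of 3 2] Q.nat_pow_mult[OF XW(2), of 6 1] by simp
  then have W1: "?h w = \<one>\<^bsub>G Mod ?D\<^esub>"
    using XW by (simp del: mult_FactGroup one_FactGroup)
  moreover have "?h x = \<one>\<^bsub>G Mod ?D\<^esub>" using r2 unfolding W1 by (simp del: one_FactGroup)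
  ultimately have "x \<in> ?D" "w \<in> ?D"
    using xw rcos_self[OF _ D.subgroup_axioms] by (metis one_FactGroup)+
  then have "carrier G \<subseteq> ?D" unfolding gen
    using generate_subgroup_incl[OF _ D.subgroup_axioms, of "{x, w}"] gen by simp
  then show ?thesis using D.subset by blast
qed

end

section \<open>Quotients by free cocompact actions\<close>

text \<open>The Lebesgue number lemma measures sets by diameter; it is applied to the two endpoints
  of one time step.\<close>

lemma diameter_doubleton: "diameter {x, y} = dist x (y :: 'a::metric_space)"
proof (rule antisym)
  show "diameter {x, y} \<le> dist x y"
  proof -
    have "(SUP (u, v)\<in>{x, y} \<times> {x, y}. dist u v) \<le> dist x y"
      by (rule cSUP_least) (auto simp: dist_commute)
    then show ?thesis unfolding diameter_def by simp
  qed
  show "dist x y \<le> diameter {x, y}"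
    by (rule diameter_bounded_bound) (auto intro: finite_imp_bounded)
qed

text \<open>\<open>Euclidean_space n\<close> consists of sequences that vanish from index
  \<open>n\<close> on, whereas the charts arise in a Euclidean type; an enumeration of
  \<open>Basis\<close> translates between the two. The case \<open>U = UNIV\<close> later supplies
  names of type \<open>nat \<Rightarrow> real\<close> for the points of the quotient.\<close>

lemma open_homeomorphic_Euclidean_space:
  fixes U :: "'a::euclidean_space set"
  assumes "open U"
  shows "\<exists>V. openin (Euclidean_space DIM('a)) V \<and>
    top_of_set U homeomorphic_space subtopology (Euclidean_space DIM('a)) V"
proof -
  obtain b where b: "bij_betw b {..<DIM('a)} (Basis :: 'a set)"
    using ex_bij_betw_nat_finite[OF finite_Basis] by (auto simp: atLeast0LessThan)
  define e :: "'a \<Rightarrow> nat \<Rightarrow> real" where "e y = (\<lambda>i. if i < DIM('a) then y \<bullet> b i else 0)" for y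
  define d :: "(nat \<Rightarrow> real) \<Rightarrow> 'a" where "d v = (\<Sum>i<DIM('a). v i *\<^sub>R b i)" for v
  have e_cont: "continuous_on S e" for S
    unfolding e_def
  proof (rule continuous_on_coordinatewise_then_product)
    fix i show "continuous_on S (\<lambda>y. if i < DIM('a) then y \<bullet> b i else 0)"
      by (cases "i < DIM('a)") (auto intro!: continuous_intros)
  qed
  have d_cont: "continuous_on S d" for S
    unfolding d_def
    by (intro continuous_intros continuous_on_subset[OF continuous_on_product_coordinates]) simp
  define T where "T = topspace (Euclidean_space DIM('a))"
  have de: "d (e y) = y" for y
  proof -
    have "d (e y) = (\<Sum>i<DIM('a). (y \<bullet> b i) *\<^sub>R b i)" by (simp add: d_def e_def)
    also have "\<dots> = (\<Sum>c\<in>Basis. (y \<bullet> c) *\<^sub>R c)" by (rule sum.reindex_bij_betw[OF b])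
    finally show ?thesis by (simp add: euclidean_representation)
  qed
  have ed: "e (d v) = v" if "v \<in> T" for v
  proof
    fix i
    show "e (d v) i = v i"
    proof (cases "i < DIM('a)")
      case True
      have "b i \<in> Basis" using b True by (auto simp: bij_betw_def)
      have "d v \<bullet> b i = (\<Sum>j<DIM('a). v j * (b j \<bullet> b i))" by (simp add: d_def inner_sum_left)
      also have "\<dots> = (\<Sum>j<DIM('a). if j = i then v j else 0)"
      proof (rule sum.cong)
        fix j assume j: "j \<in> {..<DIM('a)}"
        have "b j \<bullet> b i = (if b j = b i then 1 else 0)"
          using bij_betwE[OF b] j True by (simp add: inner_Basis)
        then show "v j * (b j \<bullet> b i) = (if j = i then v j else 0)"
          using b j True by (auto simp: bij_betw_def inj_on_def)
      qed simp
      finally show ?thesis using True by (simp add: e_def)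
    next
      case False
      then show ?thesis using that by (simp add: e_def T_def topspace_Euclidean_space)
    qed
  qed
  have e_top: "e y \<in> T" for y
    by (simp add: e_def T_def topspace_Euclidean_space)
  have EU: "Euclidean_space DIM('a) = top_of_set T"
    unfolding T_def Euclidean_space_def euclidean_product_topology by simp
  let ?V = "T \<inter> d -` U"
  have VU: "subtopology (Euclidean_space DIM('a)) ?V = top_of_set ?V"
    unfolding EU subtopology_subtopology by (simp add: Int_absorb1)
  have "homeomorphic_maps (top_of_set U) (top_of_set ?V) e d"
    unfolding homeomorphic_maps_def using e_cont d_cont de ed e_top
    by (auto simp: continuous_map_in_subtopology)
  then have 2: "top_of_set U homeomorphic_space subtopology (Euclidean_space DIM('a)) ?V"
    unfolding VU homeomorphic_space_def by blast
  have "openin (Euclidean_space DIM('a)) ?V"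
    unfolding EU by (rule continuous_openin_preimage_gen[OF d_cont assms])
  then show ?thesis using 2 by blast
qed

lemma second_countable_euclidean: "second_countable (euclidean :: 'a::second_countable_topology topology)"
proof -
  obtain B :: "'a set set" where B: "countable B" "\<And>C. C \<in> B \<Longrightarrow> open C"
    "\<And>S. open S \<Longrightarrow> \<exists>U. U \<subseteq> B \<and> S = \<Union>U"
    using univ_second_countable by blast
  have "\<exists>V\<in>B. x \<in> V \<and> V \<subseteq> U" if "open U" "x \<in> U" for U x
    using B(3)[OF that(1)] that(2) by blast
  then show ?thesis unfolding second_countable_def
    using B(1,2) by (intro exI[of _ B]) simp
qed

text \<open>Convexity of \<open>Y\<close> stands in for simple connectedness and contractibility:
  homotopies upstairs are straight lines.\<close>

locale continuous_action = group G for G :: "('g, 'h) monoid_scheme" (structure) +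
  fixes act :: "'g \<Rightarrow> 'a::euclidean_space \<Rightarrow> 'a" and Y :: "'a set"
  assumes act_closed: "g \<in> carrier G \<Longrightarrow> y \<in> Y \<Longrightarrow> act g y \<in> Y"
    and act_mult: "g \<in> carrier G \<Longrightarrow> h \<in> carrier G \<Longrightarrow> y \<in> Y \<Longrightarrow> act (g \<otimes> h) y = act g (act h y)"
    and act_one: "y \<in> Y \<Longrightarrow> act \<one> y = y"
    and act_cont: "g \<in> carrier G \<Longrightarrow> continuous_on Y (act g)"
    and open_Y: "open Y" and convex_Y: "convex Y" and Y_nonempty: "Y \<noteq> {}"
begin

lemma act_inv: "g \<in> carrier G \<Longrightarrow> y \<in> Y \<Longrightarrow> act (inv g) (act g y) = y"
  using act_mult[of "inv g" g y] act_one by simp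

end

text \<open>\<open>p\<close> is the quotient map. The neighbourhood \<open>N\<close> of the diagonal plays the role of evenly covered
  neighbourhoods: over every point near \<open>p y\<close> it selects the one preimage that is close to \<open>y\<close>.\<close>

locale quotient_action = continuous_action G act Y
  for G :: "('g, 'h) monoid_scheme" (structure) and act :: "'g \<Rightarrow> 'a::euclidean_space \<Rightarrow> 'a" and Y +
  fixes p :: "'a \<Rightarrow> 'b" and N :: "('a \<times> 'a) set"
  assumes p_eq: "y \<in> Y \<Longrightarrow> y' \<in> Y \<Longrightarrow> p y = p y' \<longleftrightarrow> (\<exists>g\<in>carrier G. y' = act g y)"
    and N_open: "open N" and N_sub: "N \<subseteq> Y \<times> Y"
    and N_refl: "y \<in> Y \<Longrightarrow> (y, y) \<in> N"
    and N_inv: "(y, y') \<in> N \<Longrightarrow> g \<in> carrier G \<Longrightarrow> (act g y, act g y') \<in> N"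
    and N_sep: "(y, y') \<in> N \<Longrightarrow> g \<in> carrier G \<Longrightarrow> (y, act g y') \<in> N \<Longrightarrow> act g y' = y'"
    and orbits_separated: "y \<in> Y \<Longrightarrow> y' \<in> Y \<Longrightarrow> p y \<noteq> p y' \<Longrightarrow>
      \<exists>U V. open U \<and> open V \<and> y \<in> U \<and> y' \<in> V \<and> p ` (U \<inter> Y) \<inter> p ` (V \<inter> Y) = {}"
    and cocompact: "\<exists>C. compact C \<and> C \<subseteq> Y \<and> p ` C = p ` Y"
begin

section \<open>The quotient topology and its charts\<close>

definition X :: "'b topology" where
  "X = topology (\<lambda>U. U \<subseteq> p ` Y \<and> open (Y \<inter> p -` U))"

lemma openin_X: "openin X U \<longleftrightarrow> U \<subseteq> p ` Y \<and> open (Y \<inter> p -` U)"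
proof -
  have "istopology (\<lambda>U. U \<subseteq> p ` Y \<and> open (Y \<inter> p -` U))"
    unfolding istopology_def
  proof (intro conjI allI impI)
    fix S T assume "S \<subseteq> p ` Y \<and> open (Y \<inter> p -` S)" "T \<subseteq> p ` Y \<and> open (Y \<inter> p -` T)"
    moreover have "Y \<inter> p -` (S \<inter> T) = (Y \<inter> p -` S) \<inter> (Y \<inter> p -` T)" by auto
    ultimately show "S \<inter> T \<subseteq> p ` Y" "open (Y \<inter> p -` (S \<inter> T))" by (auto intro: open_Int)
  next
    fix \<K> assume K: "\<forall>K\<in>\<K>. K \<subseteq> p ` Y \<and> open (Y \<inter> p -` K)"
    moreover have "Y \<inter> p -` (\<Union>\<K>) = (\<Union>K\<in>\<K>. Y \<inter> p -` K)" by auto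
    moreover have "open (\<Union>K\<in>\<K>. Y \<inter> p -` K)" using K by (intro open_UN) auto
    ultimately show "\<Union>\<K> \<subseteq> p ` Y" "open (Y \<inter> p -` (\<Union>\<K>))" using K by (blast, simp only:)
  qed
  then show ?thesis by (simp add: X_def)
qed

lemma topspace_X: "topspace X = p ` Y"
proof -
  have "Y \<inter> p -` (p ` Y) = Y" by auto
  then have "openin X (p ` Y)" using open_Y by (simp add: openin_X)
  then show ?thesis unfolding topspace_def using openin_X by auto
qed

lemma open_act_image:
  assumes g: "g \<in> carrier G" and U: "open U" "U \<subseteq> Y"
  shows "open (act g ` U)"
proof -
  have "act g ` U = Y \<inter> act (inv g) -` U"
  proof (intro equalityI subsetI)
    fix y assume "y \<in> act g ` U"
    then obtain u where u: "u \<in> U" "y = act g u" "u \<in> Y" using U by auto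
    then show "y \<in> Y \<inter> act (inv g) -` U" using g act_closed act_inv by simp
  next
    fix y assume "y \<in> Y \<inter> act (inv g) -` U"
    then have y: "y \<in> Y" "act (inv g) y \<in> U" by auto
    have "act g (act (inv g) y) = y" using act_mult[of g "inv g" y] g y act_one by simp
    then show "y \<in> act g ` U" using y by (metis imageI)
  qed
  moreover have "open (Y \<inter> act (inv g) -` U)"
    by (rule continuous_open_preimage) (use g act_cont open_Y U in auto)
  ultimately show ?thesis by simp
qed

lemma continuous_map_p: "continuous_map (top_of_set Y) X p"
  unfolding continuous_map_def
  by (auto simp: topspace_X openin_X openin_open_eq[OF open_Y] Int_def vimage_def)

lemma p_act: "g \<in> carrier G \<Longrightarrow> y \<in> Y \<Longrightarrow> p (act g y) = p y"
  using p_eq[of y "act g y"] act_closed by metis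

text \<open>The full preimage of the image is the union of all translates of \<open>U\<close>, each
  of which is open because inverse elements act continuously.\<close>

lemma openin_X_image:
  assumes "open U" "U \<subseteq> Y" shows "openin X (p ` U)"
proof -
  have "Y \<inter> p -` (p ` U) = (\<Union>g\<in>carrier G. act g ` U)"
  proof (intro equalityI subsetI)
    fix y assume "y \<in> Y \<inter> p -` (p ` U)"
    then obtain u where u: "y \<in> Y" "p y = p u" "u \<in> U" by auto
    then obtain g where "g \<in> carrier G" "y = act g u" using p_eq[of u y] assms by auto
    then show "y \<in> (\<Union>g\<in>carrier G. act g ` U)" using u by blast
  next
    fix y assume "y \<in> (\<Union>g\<in>carrier G. act g ` U)"
    then obtain g u where "g \<in> carrier G" "u \<in> U" "y = act g u" by blast
    then show "y \<in> Y \<inter> p -` (p ` U)"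
      using act_closed p_act[of g u] assms by auto
  qed
  then show ?thesis using assms open_act_image by (auto simp: openin_X)
qed

lemma open_map_p: "open_map (top_of_set Y) X p"
  unfolding open_map_def using openin_X_image by (auto simp: openin_open_eq[OF open_Y])

lemma N_unique: "(y, y') \<in> N \<Longrightarrow> (y, y'') \<in> N \<Longrightarrow> p y' = p y'' \<Longrightarrow> y' = y''"
  using p_eq[of y' y''] N_sep N_sub by fastforce

lemma Hausdorff_X: "Hausdorff_space X"
  unfolding Hausdorff_space_def
proof (intro allI impI)
  fix x x' assume "x \<in> topspace X \<and> x' \<in> topspace X \<and> x \<noteq> x'"
  then obtain y y' where y: "y \<in> Y" "y' \<in> Y" "x = p y" "x' = p y'" "p y \<noteq> p y'"
    by (auto simp: topspace_X)
  from orbits_separated[OF y(1,2,5)] obtain U V where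
    UV: "open U" "open V" "y \<in> U" "y' \<in> V" "p ` (U \<inter> Y) \<inter> p ` (V \<inter> Y) = {}" by blast
  then show "\<exists>U V. openin X U \<and> openin X V \<and> x \<in> U \<and> x' \<in> V \<and> disjnt U V"
    using y openin_X_image[of "U \<inter> Y"] openin_X_image[of "V \<inter> Y"] open_Y
    by (intro exI[of _ "p ` (U \<inter> Y)"] exI[of _ "p ` (V \<inter> Y)"]) (auto simp: disjnt_def)
qed

lemma second_countable_X: "second_countable X"
  by (rule second_countable_open_map_image[OF continuous_map_p open_map_p])
     (simp_all add: topspace_X second_countable_subtopology second_countable_euclidean)

lemma compact_X: "compact_space X"
proof -
  obtain C where C: "compact C" "C \<subseteq> Y" "p ` C = p ` Y" using cocompact by blast
  have "compactin (top_of_set Y) C" using C by (simp add: compactin_subtopology)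
  then show ?thesis using image_compactin[OF _ continuous_map_p] C
    by (metis compact_space_def topspace_X)
qed

lemma contractible_Y: "contractible_space (top_of_set Y)"
  using convex_imp_contractible[OF convex_Y] by simp

lemma path_connected_X: "path_connected_space X"
proof -
  have "path_connectedin (top_of_set Y) Y"
    using contractible_imp_path_connected_space[OF contractible_Y]
    by (metis path_connectedin_topspace topspace_subtopology_subset subset_UNIV topspace_euclidean)
  then have "path_connectedin X (p ` Y)"
    by (rule path_connectedin_continuous_map_image[OF continuous_map_p])
  then show ?thesis by (metis path_connectedin_topspace topspace_X)
qed

text \<open>A neighbourhood \<open>U\<close> with \<open>U \<times> U \<subseteq> N\<close> meets
  each orbit at most once, so \<open>p\<close> maps it homeomorphically onto an open set.\<close>

lemma topological_manifold_X: "topological_manifold DIM('a) X"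
  unfolding topological_manifold_def
proof (intro conjI ballI Hausdorff_X second_countable_X)
  fix x assume "x \<in> topspace X"
  then obtain y where y: "y \<in> Y" "x = p y" by (auto simp: topspace_X)
  have "\<exists>U. open U \<and> y \<in> U \<and> U \<times> U \<subseteq> N"
  proof -
    obtain A B where "open A" "open B" "(y, y) \<in> A \<times> B" "A \<times> B \<subseteq> N"
      using N_open N_refl[OF y(1)] by (rule open_prod_elim)
    then show ?thesis by (intro exI[of _ "A \<inter> B"]) auto
  qed
  then obtain U where U: "open U" "y \<in> U" "U \<times> U \<subseteq> N" by blast
  have UY: "U \<subseteq> Y" using U N_sub by auto
  have inj: "inj_on p U"
  proof (rule inj_onI)
    fix u u' assume "u \<in> U" "u' \<in> U" "p u = p u'"
    then show "u = u'" using N_unique[of u u u'] U(3) by blast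
  qed
  have "homeomorphic_map (top_of_set U) (subtopology X (p ` U)) p"
  proof (rule bijective_open_imp_homeomorphic_map)
    show "continuous_map (top_of_set U) (subtopology X (p ` U)) p"
      using continuous_map_from_subtopology_mono[OF continuous_map_p UY]
      by (simp add: continuous_map_in_subtopology)
    show "open_map (top_of_set U) (subtopology X (p ` U)) p"
      unfolding open_map_def
    proof (intro allI impI)
      fix W assume "openin (top_of_set U) W"
      then have W: "open W" "W \<subseteq> U" using U by (auto simp: openin_open_eq)
      then have "openin X (p ` W)" using openin_X_image UY by auto
      then show "openin (subtopology X (p ` U)) (p ` W)" using W
        by (metis image_mono inf.absorb1 openin_subtopology)
    qed
    show "p ` topspace (top_of_set U) = topspace (subtopology X (p ` U))"
      using UY by (auto simp: topspace_X)
    show "inj_on p (topspace (top_of_set U))" using inj by simp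
  qed
  then have 1: "subtopology X (p ` U) homeomorphic_space top_of_set U"
    using homeomorphic_map_imp_homeomorphic_space homeomorphic_space_sym by blast
  obtain V where V: "openin (Euclidean_space DIM('a)) V"
    "top_of_set U homeomorphic_space subtopology (Euclidean_space DIM('a)) V"
    using open_homeomorphic_Euclidean_space[OF U(1)] by blast
  show "\<exists>U V. openin X U \<and> x \<in> U \<and> openin (Euclidean_space DIM('a)) V \<and>
      subtopology X U homeomorphic_space subtopology (Euclidean_space DIM('a)) V"
    using homeomorphic_space_trans[OF 1 V(2)] V(1) openin_X_image[OF U(1) UY] y U(2) by blast
qed

text \<open>\<open>\<sigma>\<close> is a continuous choice of preimages; a homotopy is lifted by applying it finitely many times.\<close>

definition \<sigma> :: "'a \<Rightarrow> 'b \<Rightarrow> 'a" where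
  "\<sigma> y x = (THE y'. (y, y') \<in> N \<and> p y' = x)"

lemma \<sigma>_eq: "(y, y') \<in> N \<Longrightarrow> \<sigma> y (p y') = y'"
proof -
  assume y: "(y, y') \<in> N"
  show ?thesis unfolding \<sigma>_def
  proof (rule the_equality)
    fix z assume "(y, z) \<in> N \<and> p z = p y'"
    then show "z = y'" using N_unique[of y z y'] y by simp
  qed (use y in simp)
qed

text \<open>Take a product neighbourhood \<open>A \<times> B\<close> of
  \<open>(f z, \<sigma> (f z) (h z))\<close> inside \<open>N\<close>, with \<open>B\<close> inside
  \<open>V\<close>. As long as \<open>f w\<close> stays in \<open>A\<close> and \<open>h w\<close>
  in the open image of \<open>B\<close>, uniqueness forces the selected preimage to lie in
  \<open>B\<close>.\<close>

lemma \<sigma>_continuous: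
  assumes f: "continuous_map Z (top_of_set Y) f" and h: "continuous_map Z X h"
    and fh: "\<And>z. z \<in> topspace Z \<Longrightarrow> \<exists>y'. (f z, y') \<in> N \<and> p y' = h z"
  shows "continuous_map Z (top_of_set Y) (\<lambda>z. \<sigma> (f z) (h z))"
    and "\<And>z. z \<in> topspace Z \<Longrightarrow> p (\<sigma> (f z) (h z)) = h z"
proof -
  show p\<sigma>: "p (\<sigma> (f z) (h z)) = h z" if "z \<in> topspace Z" for z
    using fh[OF that] \<sigma>_eq by metis
  have N\<sigma>: "(f z, \<sigma> (f z) (h z)) \<in> N" if "z \<in> topspace Z" for z
    using fh[OF that] \<sigma>_eq by metis
  show "continuous_map Z (top_of_set Y) (\<lambda>z. \<sigma> (f z) (h z))"
    unfolding continuous_map_def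
  proof (intro conjI allI impI)
    show "(\<lambda>z. \<sigma> (f z) (h z)) \<in> topspace Z \<rightarrow> topspace (top_of_set Y)"
    proof
      fix z assume "z \<in> topspace Z"
      from N\<sigma>[OF this] N_sub show "\<sigma> (f z) (h z) \<in> topspace (top_of_set Y)" by auto
    qed
    fix V assume "openin (top_of_set Y) V"
    then have V: "open V" "V \<subseteq> Y" by (auto simp: openin_open_eq[OF open_Y])
    show "openin Z {z \<in> topspace Z. \<sigma> (f z) (h z) \<in> V}"
    proof (subst openin_subopen, clarify)
      fix z assume z: "z \<in> topspace Z" "\<sigma> (f z) (h z) \<in> V"
      have "open (N \<inter> (UNIV \<times> V))" using N_open V by (auto intro!: open_Int open_Times)
      moreover have "(f z, \<sigma> (f z) (h z)) \<in> N \<inter> (UNIV \<times> V)" using N\<sigma> z by auto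
      ultimately obtain A B where AB: "open A" "open B"
        "(f z, \<sigma> (f z) (h z)) \<in> A \<times> B" "A \<times> B \<subseteq> N \<inter> (UNIV \<times> V)"
        by (rule open_prod_elim)
      have AY: "A \<subseteq> Y" "B \<subseteq> Y" using AB N_sub by auto
      let ?W = "{w \<in> topspace Z. f w \<in> A} \<inter> {w \<in> topspace Z. h w \<in> p ` B}"
      have "openin Z ?W"
        by (intro openin_Int openin_continuous_map_preimage[OF f]
            openin_continuous_map_preimage[OF h] openin_X_image AB AY)
           (use AB AY in \<open>simp add: openin_open_eq[OF open_Y]\<close>)
      moreover have "z \<in> ?W" using z AB p\<sigma>[OF z(1)] by (auto intro!: image_eqI[of _ p])
      moreover have "?W \<subseteq> {z \<in> topspace Z. \<sigma> (f z) (h z) \<in> V}"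
      proof
        fix w assume "w \<in> ?W"
        then obtain u where u: "w \<in> topspace Z" "f w \<in> A" "u \<in> B" "h w = p u" by auto
        then have "(f w, u) \<in> N" "u \<in> V" using AB(4) by auto
        then show "w \<in> {z \<in> topspace Z. \<sigma> (f z) (h z) \<in> V}" using \<sigma>_eq[of "f w" u] u by simp
      qed
      ultimately show "\<exists>T. openin Z T \<and> z \<in> T \<and> T \<subseteq> {z \<in> topspace Z. \<sigma> (f z) (h z) \<in> V}"
        by blast
    qed
  qed
qed

text \<open>Paths and spheres are both presented as the time-1 stage of a contraction to a point, so
  lifting the end of a homotopy covers both. A Lebesgue number makes the time steps so short that
  each stage is reached from the preceding one by \<open>\<sigma>\<close>.\<close>

lemma lift_homotopy_end:
  fixes Z :: "'z::metric_space set" and H :: "real \<times> 'z \<Rightarrow> 'b"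
  assumes Z: "compact Z" and H: "continuous_map (top_of_set ({0..1} \<times> Z)) X H"
    and f: "continuous_map (top_of_set Z) (top_of_set Y) f" "\<And>z. z \<in> Z \<Longrightarrow> p (f z) = H (0, z)"
  shows "\<exists>f'. continuous_map (top_of_set Z) (top_of_set Y) f' \<and> (\<forall>z\<in>Z. p (f' z) = H (1, z))"
proof -
  define \<C> where "\<C> = {B. open B \<and> (\<exists>U. U \<times> U \<subseteq> N \<and> H ` (B \<inter> {0..1::real} \<times> Z) \<subseteq> p ` U)}"
  have cover: "{0..1::real} \<times> Z \<subseteq> \<Union>\<C>"
  proof
    fix w :: "real \<times> 'z" assume w: "w \<in> {0..1} \<times> Z"
    then have "H w \<in> topspace X" using H by (auto simp: continuous_map_def)
    then obtain y where y: "y \<in> Y" "H w = p y" by (auto simp: topspace_X)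
    obtain A B where "open A" "open B" "(y, y) \<in> A \<times> B" "A \<times> B \<subseteq> N"
      using N_open N_refl[OF y(1)] by (rule open_prod_elim)
    then have U: "open (A \<inter> B)" "y \<in> A \<inter> B" "(A \<inter> B) \<times> (A \<inter> B) \<subseteq> N" by auto
    then have "openin X (p ` (A \<inter> B))" using openin_X_image N_sub by blast
    then have "openin (top_of_set ({0..1} \<times> Z)) {w \<in> {0..1} \<times> Z. H w \<in> p ` (A \<inter> B)}"
      using openin_continuous_map_preimage[OF H] by fastforce
    then obtain T where T: "open T" "{w \<in> {0..1} \<times> Z. H w \<in> p ` (A \<inter> B)} = {0..1} \<times> Z \<inter> T"
      by (auto simp: openin_open)
    then have "T \<in> \<C>" using U unfolding \<C>_def by blast
    moreover have "w \<in> {w \<in> {0..1} \<times> Z. H w \<in> p ` (A \<inter> B)}" using w y U by auto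
    then have "w \<in> T" using T by blast
    ultimately show "w \<in> \<Union>\<C>" by blast
  qed
  have "{} \<in> \<C>" unfolding \<C>_def by (intro CollectI conjI exI[of _ "{}"]) auto
  then have "\<C> \<noteq> {}" by blast
  have "compact ({0..1::real} \<times> Z)" using Z by (intro compact_Times) auto
  moreover have "open B" if "B \<in> \<C>" for B using that unfolding \<C>_def by blast
  ultimately obtain \<delta> where \<delta>: "\<delta> > 0"
    "\<And>T. T \<subseteq> {0..1} \<times> Z \<Longrightarrow> diameter T < \<delta> \<Longrightarrow> \<exists>B\<in>\<C>. T \<subseteq> B"
    using Lebesgue_number_lemma[OF _ \<open>\<C> \<noteq> {}\<close> cover] by metis
  obtain n :: nat where n: "n > 0" "1 / real n < \<delta>"
    using \<delta>(1) by (metis nat_approx_posE of_nat_0_less_iff zero_less_Suc)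
  have "\<exists>f'. continuous_map (top_of_set Z) (top_of_set Y) f' \<and> (\<forall>z\<in>Z. p (f' z) = H (real k / n, z))"
    if "k \<le> n" for k
    using that
  proof (induction k)
    case 0
    then show ?case using f by auto
  next
    case (Suc k)
    then obtain f' where f': "continuous_map (top_of_set Z) (top_of_set Y) f'"
      "\<And>z. z \<in> Z \<Longrightarrow> p (f' z) = H (real k / n, z)" by auto
    let ?h = "\<lambda>z. H (real (Suc k) / n, z)"
    have unit: "real k / n \<in> {0..1}" "real (Suc k) / n \<in> {0..1}" using Suc.prems n by auto
    have h: "continuous_map (top_of_set Z) X ?h"
    proof -
      have "continuous_on Z (Pair (real (Suc k) / n))" by (intro continuous_intros)
      then have "continuous_map (top_of_set Z) (top_of_set ({0..1} \<times> Z)) (Pair (real (Suc k) / n))"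
        using unit by (simp add: continuous_map_in_subtopology image_subset_iff)
      from continuous_map_compose[OF this H] show ?thesis by (simp only: o_def)
    qed
    have "\<exists>y'. (f' z, y') \<in> N \<and> p y' = ?h z" if z: "z \<in> Z" for z
    proof -
      let ?T = "{(real k / n, z), (real (Suc k) / n, z)}"
      have "dist (real k / n, z) (real (Suc k) / n, z) = 1 / n"
        using n by (simp add: dist_Pair_Pair dist_real_def flip: diff_divide_distrib)
      then have "diameter ?T < \<delta>"
        using n(2) by (simp add: diameter_doubleton)
      then obtain B where "B \<in> \<C>" "?T \<subseteq> B" using \<delta>(2)[of ?T] z unit by auto
      then obtain U where U: "U \<times> U \<subseteq> N" "H ` (B \<inter> {0..1} \<times> Z) \<subseteq> p ` U" unfolding \<C>_def by blast
      have "H (real k / n, z) \<in> p ` U" "?h z \<in> p ` U"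
        using U(2) \<open>?T \<subseteq> B\<close> z unit by blast+
      then obtain u u' where u: "u \<in> U" "u' \<in> U" "H (real k / n, z) = p u" "?h z = p u'" by auto
      have "f' z \<in> Y" using f'(1) z by (auto simp: continuous_map_def)
      moreover have "u \<in> Y" using u U N_sub by blast
      moreover have "p u = p (f' z)" using f'(2)[OF z] u by simp
      \<comment> \<open>\<open>U\<close> lies over the right place of \<open>X\<close>, but perhaps
        not at \<open>f' z\<close>; translation by \<open>g\<close> brings \<open>u\<close> to
        \<open>f' z\<close>, and invariance of \<open>N\<close> brings \<open>u'\<close>
        along.\<close>
      ultimately obtain g where g: "g \<in> carrier G" "f' z = act g u" using p_eq[of u "f' z"] by auto
      have "(u, u') \<in> N" using U u by blast
      then have "(f' z, act g u') \<in> N" using N_inv g by simp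
      moreover have "p (act g u') = ?h z" using p_act[OF g(1), of u'] u U N_sub by auto
      ultimately show ?thesis by blast
    qed
    then show ?case using \<sigma>_continuous[OF f'(1) h] by auto
  qed
  from this[of n] show ?thesis using n by simp
qed

lemma lift_path:
  assumes q: "pathin X q" and y: "y \<in> Y" "q 0 = p y"
  obtains h where "continuous_on {0..1} h" "h ` {0..1} \<subseteq> Y" "h 0 = y" "\<And>t. t \<in> {0..1} \<Longrightarrow> p (h t) = q t"
proof -
  \<comment> \<open>The homotopy \<open>q (s * t)\<close> contracts the path to its starting point,
    where the constant map at \<open>y\<close> is a lift.\<close>
  have "continuous_map (top_of_set ({0..1} \<times> {0..1})) (top_of_set {0..1}) (\<lambda>(s, t). s * t :: real)"
    by (auto simp: continuous_map_in_subtopology case_prod_unfold mult_le_one intro!: continuous_intros)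
  from continuous_map_compose[OF this q[unfolded pathin_def]]
  have H: "continuous_map (top_of_set ({0..1} \<times> {0..1})) X (\<lambda>(s, t). q (s * t))"
    by (simp add: o_def case_prod_unfold)
  have "continuous_map (top_of_set {0..1::real}) (top_of_set Y) (\<lambda>_. y)" using y by simp
  from lift_homotopy_end[OF _ H this] obtain f where
    f: "continuous_map (top_of_set {0..1}) (top_of_set Y) f" "\<And>t. t \<in> {0..1} \<Longrightarrow> p (f t) = q t"
    using y by auto
  have fY: "f t \<in> Y" if "t \<in> {0..1}" for t using f(1) that by (auto simp: continuous_map_def)
  have "p (f 0) = p y" using f(2)[of 0] y by simp
  \<comment> \<open>The lift found may start elsewhere in the orbit of \<open>y\<close>; a
    translation corrects this.\<close>
  then obtain g where g: "g \<in> carrier G" "y = act g (f 0)" using p_eq[of "f 0" y] fY y by auto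
  show thesis
  proof (rule that[of "\<lambda>t. act g (f t)"])
    show "continuous_on {0..1} (\<lambda>t. act g (f t))"
      by (rule continuous_on_compose2[OF act_cont[OF g(1)]]) (use f(1) fY in auto)
  qed (use g f fY act_closed p_act in auto)
qed

text \<open>Nearby values lie in one orbit and form a pair in \<open>N\<close>, hence are equal; a
  locally constant map on a connected set is constant.\<close>

lemma constant_on_fibre:
  fixes S :: "'z::topological_space set"
  assumes S: "connected S" and h: "continuous_on S h" "h ` S \<subseteq> Y"
    and const: "\<And>s s'. s \<in> S \<Longrightarrow> s' \<in> S \<Longrightarrow> p (h s) = p (h s')" and "a \<in> S" "b \<in> S"
  shows "h a = h b"
proof (rule connected_local_const[OF S \<open>a \<in> S\<close> \<open>b \<in> S\<close>], intro ballI)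
  fix a assume a: "a \<in> S"
  have "open ((\<lambda>u. (h a, u)) -` N)"
    by (intro open_vimage N_open continuous_intros)
  moreover have "h a \<in> (\<lambda>u. (h a, u)) -` N" using N_refl h a by auto
  ultimately have "\<forall>\<^sub>F b in at a within S. h b \<in> (\<lambda>u. (h a, u)) -` N"
    using h(1) a unfolding continuous_on_def by (intro topological_tendstoD) auto
  moreover have "\<forall>\<^sub>F b in at a within S. b \<in> S"
    by (simp add: eventually_at_filter)
  ultimately show "\<forall>\<^sub>F b in at a within S. h a = h b"
  proof eventually_elim
    case (elim b)
    then show ?case using N_unique[of "h a" "h a" "h b"] N_refl const[of a b] a h by auto
  qed
qed

subsection \<open>The fundamental group\<close>

text \<open>The straight-line homotopy between \<open>h\<close> and the segment stays in the convex
  set \<open>Y\<close> and fixes both ends. Hence the class of a loop depends only on where its lift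
  ends.\<close>

lemma loop_of_path:
  assumes h: "continuous_on {0..1} h" "h ` {0..1} \<subseteq> Y" and y: "h 0 = y" "h 1 = y'"
    and px: "p y = x" "p y' = x"
    and q: "\<And>t. t \<in> {0..1} \<Longrightarrow> q t = p (h t)"
  shows "(p \<circ> linepath y y', q) \<in> loop_rel X x"
proof -
  have yY: "y \<in> Y" "y' \<in> Y" using h y by force+
  have lY: "linepath y y' t \<in> Y" if "t \<in> {0..1}" for t
    using convexD[OF convex_Y yY, of "1 - t" t] that by (simp add: linepath_def)
  let ?H = "\<lambda>(s, t). (1 - s) *\<^sub>R linepath y y' t + s *\<^sub>R h t"
  have "continuous_on ({0..1} \<times> {0..1}) ?H"
    unfolding case_prod_unfold
    by (intro continuous_intros continuous_on_compose2[OF h(1)] continuous_on_compose2[OF continuous_on_linepath]) auto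
  moreover have "?H w \<in> Y" if "w \<in> {0..1} \<times> {0..1}" for w
    using convexD[OF convex_Y lY, of "snd w" "h (snd w)" "1 - fst w" "fst w"] h(2) that by auto
  ultimately have "continuous_map (top_of_set ({0..1} \<times> {0..1})) (top_of_set Y) ?H"
    by (simp add: continuous_map_in_subtopology image_subset_iff)
  from continuous_map_compose[OF this continuous_map_p]
  have H: "continuous_map (prod_topology (top_of_set {0..1}) (top_of_set {0..1})) X (p \<circ> ?H)"
    by simp
  have "homotopic_with (\<lambda>h. h 0 = x \<and> h 1 = x) (top_of_set {0..1}) X (p \<circ> linepath y y') q"
  proof (subst homotopic_with)
    show "(f 0 = x \<and> f 1 = x) = (g 0 = x \<and> g 1 = x)"
      if "\<And>t. t \<in> topspace (top_of_set {0..1}) \<Longrightarrow> f t = g t" for f g :: "real \<Rightarrow> 'b"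
      using that[of 0] that[of 1] by simp
    have "(p \<circ> ?H) (s, 0) = x \<and> (p \<circ> ?H) (s, 1) = x" for s
      using y px by (simp add: linepath_def flip: scaleR_left_distrib)
    then show "\<exists>k. continuous_map (prod_topology (top_of_set {0..1::real}) (top_of_set {0..1})) X k \<and>
      (\<forall>t\<in>topspace (top_of_set {0..1}). k (0, t) = (p \<circ> linepath y y') t) \<and>
      (\<forall>t\<in>topspace (top_of_set {0..1}). k (1, t) = q t) \<and>
      (\<forall>s\<in>{0..1::real}. k (s, 0) = x \<and> k (s, 1) = x)"
      using H q by - (rule exI[of _ "p \<circ> ?H"], simp)
  qed
  moreover from homotopic_with_imp_continuous_maps[OF this]
  have "pathin X (p \<circ> linepath y y')" "pathin X q" by (auto simp: pathin_def)
  ultimately show ?thesis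
    using px q[of 0] q[of 1] y by (simp add: loop_rel_def loops_def linepath_def)
qed

end

section \<open>Homotopy classes of loops and their products\<close>

lemma equiv_loop_rel: "equiv (loops X x) (loop_rel X x)"
proof (rule equivI)
  show "loop_rel X x \<subseteq> loops X x \<times> loops X x" by (auto simp: loop_rel_def)
  show "refl_on (loops X x) (loop_rel X x)"
    by (auto simp: refl_on_def loop_rel_def loops_def pathin_def)
  show "sym (loop_rel X x)"
    by (auto simp: sym_def loop_rel_def homotopic_with_sym)
  show "trans (loop_rel X x)"
    unfolding trans_def loop_rel_def using homotopic_with_trans by blast
qed

lemma loop_rel_join:
  assumes "(f, f') \<in> loop_rel X x" "(g, g') \<in> loop_rel X x"
  shows "(loop_join f g, loop_join f' g') \<in> loop_rel X x"
proof -
  let ?I = "top_of_set {0..1::real}"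
  obtain F where F: "continuous_map (prod_topology ?I ?I) X F"
    "\<And>t. F (0, t) = f t" "\<And>t. F (1, t) = f' t" "\<And>s. s \<in> {0..1} \<Longrightarrow> F (s, 0) = x \<and> F (s, 1) = x"
    using assms(1) by (auto simp: loop_rel_def homotopic_with_def)
  obtain K where K: "continuous_map (prod_topology ?I ?I) X K"
    "\<And>t. K (0, t) = g t" "\<And>t. K (1, t) = g' t" "\<And>s. s \<in> {0..1} \<Longrightarrow> K (s, 0) = x \<and> K (s, 1) = x"
    using assms(2) by (auto simp: loop_rel_def homotopic_with_def)
  let ?J = "\<lambda>w. if snd w \<le> 1/2 then F (fst w, 2 * snd w) else K (fst w, 2 * snd w - 1)"
  let ?P = "prod_topology ?I ?I"
  have J: "continuous_map ?P X ?J"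
  proof (rule continuous_map_cases_le)
    show "continuous_map ?P euclideanreal snd" "continuous_map ?P euclideanreal (\<lambda>_. 1 / 2)"
      by (auto intro!: continuous_intros)
    have "continuous_map (subtopology ?P {w \<in> topspace ?P. snd w \<le> 1/2}) ?P (\<lambda>w. (fst w, 2 * snd w))"
      by (auto simp: continuous_map_in_subtopology subtopology_subtopology intro!: continuous_intros)
    from continuous_map_compose[OF this F(1)]
    show "continuous_map (subtopology ?P {w \<in> topspace ?P. snd w \<le> 1/2}) X (\<lambda>w. F (fst w, 2 * snd w))"
      by (simp add: o_def)
    have "continuous_map (subtopology ?P {w \<in> topspace ?P. 1/2 \<le> snd w}) ?P (\<lambda>w. (fst w, 2 * snd w - 1))"
      by (auto simp: continuous_map_in_subtopology subtopology_subtopology intro!: continuous_intros)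
    from continuous_map_compose[OF this K(1)]
    show "continuous_map (subtopology ?P {w \<in> topspace ?P. 1/2 \<le> snd w}) X (\<lambda>w. K (fst w, 2 * snd w - 1))"
      by (simp add: o_def)
    show "F (fst w, 2 * snd w) = K (fst w, 2 * snd w - 1)" if "w \<in> topspace ?P" "snd w = 1/2" for w
    proof -
      have "fst w \<in> {0..1}" using that(1) by auto
      then show ?thesis using F(4)[of "fst w"] K(4)[of "fst w"] unfolding that(2) by simp
    qed
  qed
  have "homotopic_with (\<lambda>h. h 0 = x \<and> h 1 = x) ?I X (loop_join f g) (loop_join f' g')"
    unfolding homotopic_with_def
    using F K by (intro exI[of _ ?J] conjI J) (auto simp: loop_join_def)
  moreover from homotopic_with_imp_continuous_maps[OF this] homotopic_with_imp_property[OF this]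
  have "loop_join f g \<in> loops X x" "loop_join f' g' \<in> loops X x" by (auto simp: loops_def pathin_def)
  ultimately show ?thesis by (simp add: loop_rel_def)
qed

text \<open>The product in \<open>fundamental_group\<close> is a union over all representatives; by
  \<open>loop_rel_join\<close> each of them contributes the same class.\<close>

lemma mult_fundamental_group:
  assumes "f \<in> loops X x" "g \<in> loops X x"
  shows "loop_rel X x `` {f} \<otimes>\<^bsub>fundamental_group X x\<^esub> loop_rel X x `` {g}
    = loop_rel X x `` {loop_join f g}"
proof -
  let ?r = "loop_rel X x"
  have const: "?r `` {loop_join f' g'} = ?r `` {loop_join f g}"
    if "(f, f') \<in> loop_rel X x" "(g, g') \<in> loop_rel X x" for f' g'
    using equiv_class_eq[OF equiv_loop_rel loop_rel_join[OF that]] by simp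
  have refl: "(f, f) \<in> ?r" "(g, g) \<in> ?r"
    using equiv_loop_rel[of X x] assms by (auto simp: equiv_def refl_on_def)
  have "(\<Union>a\<in>?r `` {f}. \<Union>b\<in>?r `` {g}. ?r `` {loop_join a b})
    = (\<Union>a\<in>?r `` {f}. \<Union>b\<in>?r `` {g}. ?r `` {loop_join f g})"
    by (intro SUP_cong refl const) auto
  also have "\<dots> = ?r `` {loop_join f g}" using refl by blast
  finally show ?thesis by (simp add: fundamental_group_def)
qed

context quotient_action
begin

text \<open>\<open>\<Phi>\<close> sends \<open>g\<close> to the class of the projected segment from
  \<open>y\<close> to \<open>act g y\<close>. It is multiplicative by the straight-line homotopy and
  onto because loops lift. The group axioms for loop classes are inherited from \<open>G\<close>
  along \<open>\<Phi>\<close>, and perfectness passes to images, so a kernel of the action does no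
  harm.\<close>

lemma perfect_fundamental_group:
  assumes perfect: "derived G (carrier G) = carrier G" and x: "x \<in> topspace X"
  shows "perfect_group (fundamental_group X x)"
proof -
  obtain y where y: "y \<in> Y" "p y = x" using x by (auto simp: topspace_X)
  let ?F = "fundamental_group X x"
  let ?l = "\<lambda>g. p \<circ> linepath y (act g y)"
  let ?cl = "\<lambda>q. loop_rel X x `` {q}"
  define \<Phi> where "\<Phi> g = ?cl (?l g)" for g
  have gy: "act g y \<in> Y" "p (act g y) = x" if "g \<in> carrier G" for g
    using that y act_closed p_act by auto
  have lY: "linepath y (act g y) t \<in> Y" if "g \<in> carrier G" "t \<in> {0..1}" for g t
    using convexD[OF convex_Y y(1) gy(1)[OF that(1)], of "1 - t" t] that by (simp add: linepath_def)
  have l: "(?l g, q) \<in> loop_rel X x"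
    if "g \<in> carrier G" "continuous_on {0..1} h" "h ` {0..1} \<subseteq> Y" "h 0 = y" "h 1 = act g y"
      "\<And>t. t \<in> {0..1} \<Longrightarrow> q t = p (h t)" for g h q
    using loop_of_path[OF that(2-5) y(2) gy(2)[OF that(1)] that(6)] .
  have loops: "?l g \<in> loops X x" if g: "g \<in> carrier G" for g
  proof -
    have "linepath y (act g y) ` {0..1} \<subseteq> Y" using lY[OF g] by blast
    then show ?thesis using l[OF g, of "linepath y (act g y)" "?l g"]
      by (auto simp: loop_rel_def linepath_0' linepath_1')
  qed
  have hom: "\<Phi> (g \<otimes> h) = \<Phi> g \<otimes>\<^bsub>?F\<^esub> \<Phi> h" if gh: "g \<in> carrier G" "h \<in> carrier G" for g h
  proof -
    \<comment> \<open>From \<open>y\<close> to \<open>act g y\<close>, then along the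
      \<open>g\<close>-translate of the segment to \<open>act h y\<close>: this path ends at
      \<open>act (g \<otimes> h) y\<close> and projects to the join of both loops.\<close>
    let ?j = "linepath y (act g y) +++ (act g \<circ> linepath y (act h y))"
    have "path (act g \<circ> linepath y (act h y))"
      using lY[OF gh(2)] by (intro path_continuous_image continuous_on_subset[OF act_cont[OF gh(1)]])
        (auto simp: path_image_def)
    then have "path ?j"
      using y by (intro path_join_imp) (auto simp: pathstart_def linepath_0')
    then have c: "continuous_on {0..1} ?j" by (simp add: path_def)
    have "?j ` {0..1} \<subseteq> Y"
      using lY gh act_closed by (auto simp: joinpaths_def)
    moreover have "?j 0 = y" by (simp add: joinpaths_def linepath_0')
    moreover have "?j 1 = act (g \<otimes> h) y" using y gh act_mult by (simp add: joinpaths_def linepath_1')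
    moreover have "loop_join (?l g) (?l h) t = p (?j t)" if "t \<in> {0..1}" for t
      using lY[OF gh(2), of "2 * t - 1"] p_act[OF gh(1)] that by (auto simp: loop_join_def joinpaths_def)
    ultimately have "(?l (g \<otimes> h), loop_join (?l g) (?l h)) \<in> loop_rel X x"
      using l[OF _ c] gh by simp
    then have "\<Phi> (g \<otimes> h) = ?cl (loop_join (?l g) (?l h))"
      unfolding \<Phi>_def by (rule equiv_class_eq[OF equiv_loop_rel])
    then show ?thesis unfolding \<Phi>_def using mult_fundamental_group[OF loops loops] gh by simp
  qed
  have carrier_F: "carrier ?F = loops X x // loop_rel X x" by (simp add: fundamental_group_def)
  have \<Phi>_in: "\<Phi> g \<in> carrier ?F" if "g \<in> carrier G" for g
    unfolding \<Phi>_def carrier_F using loops[OF that] by (rule quotientI)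
  have one: "\<Phi> \<one> = \<one>\<^bsub>?F\<^esub>"
    using y act_one by (simp add: \<Phi>_def fundamental_group_def o_def)
  have onto: "carrier ?F \<subseteq> \<Phi> ` carrier G"
  proof
    fix A assume "A \<in> carrier ?F"
    then obtain q where q: "q \<in> loops X x" "A = ?cl q" unfolding carrier_F by (auto elim: quotientE)
    then have q': "pathin X q" "q 0 = p y" "q 1 = x" using y by (auto simp: loops_def)
    obtain h where h: "continuous_on {0..1} h" "h ` {0..1} \<subseteq> Y" "h 0 = y"
      "\<And>t. t \<in> {0..1} \<Longrightarrow> p (h t) = q t"
      using lift_path[OF q'(1) y(1) q'(2)] by blast
    have "h 1 \<in> Y" "p y = p (h 1)" using h(2) h(4)[of 1] q' y by auto
    then obtain g where g: "g \<in> carrier G" "h 1 = act g y" using p_eq y by blast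
    then have "(?l g, q) \<in> loop_rel X x" using l[OF g(1) h(1-3) g(2)] h(4) by simp
    then have "\<Phi> g = A" unfolding \<Phi>_def q(2) by (rule equiv_class_eq[OF equiv_loop_rel])
    then show "A \<in> \<Phi> ` carrier G" using g by blast
  qed
  have image: "\<Phi> ` carrier G = carrier ?F" using onto \<Phi>_in by blast
  have \<Phi>: "\<Phi> \<in> hom G ?F" using hom \<Phi>_in by (simp add: hom_def)
  from hom_imp_img_group[OF this] have "group ?F" by (simp add: image one)
  then interpret \<Phi>: group_hom G ?F \<Phi> using \<Phi> by (simp add: group_hom_def group_hom_axioms_def)
  show ?thesis
    unfolding perfect_group_def using \<Phi>.derived_img[of "carrier G"] perfect image by simp
qed

end

section \<open>Lifting spheres\<close>

definition unit_sphere :: "nat \<Rightarrow> (nat \<Rightarrow> real) set" where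
  "unit_sphere m = {x. (\<Sum>i\<le>m. (x i)\<^sup>2) = 1 \<and> (\<forall>i>m. x i = 0)}"

lemma nsphere_eq_unit_sphere: "nsphere m = top_of_set (unit_sphere m)"
  by (simp add: nsphere unit_sphere_def euclidean_product_topology)

lemma continuous_on_coordinate: "continuous_on S (\<lambda>x :: nat \<Rightarrow> real. x i)"
  by (rule continuous_on_subset[OF continuous_on_product_coordinates]) simp

lemma compact_unit_sphere: "compact (unit_sphere m)"
proof -
  have "unit_sphere m \<subseteq> PiE UNIV (\<lambda>_. {-1..1})"
  proof
    fix x assume x: "x \<in> unit_sphere m"
    have "\<bar>x i\<bar> \<le> 1" for i
    proof (cases "i \<le> m")
      case True
      then have "(x i)\<^sup>2 \<le> (\<Sum>i\<le>m. (x i)\<^sup>2)" by (intro member_le_sum) auto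
      then show ?thesis using x by (simp add: unit_sphere_def abs_square_le_1)
    qed (use x in \<open>simp add: unit_sphere_def\<close>)
    then show "x \<in> PiE UNIV (\<lambda>_. {-1..1})" by (auto simp: abs_le_iff)
  qed
  moreover have "compact (PiE UNIV (\<lambda>_ :: nat. {-1..1::real}))"
    using compactin_PiE[of "\<lambda>_ :: nat. euclideanreal" UNIV "\<lambda>_. {-1..1}"]
    by (simp add: euclidean_product_topology)
  moreover have "closed (unit_sphere m)"
    unfolding unit_sphere_def
    by (intro closed_Collect_conj closed_Collect_all closed_Collect_imp closed_Collect_eq
        continuous_on_sum continuous_on_power continuous_on_coordinate continuous_on_const) auto
  ultimately show ?thesis by (metis compact_Int_closed inf.absorb2)
qed

text \<open>Polar coordinates that exhibit the next sphere as a cylinder over the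
  \<open>m\<close>-sphere with each end collapsed to a pole; \<open>pi * fst w\<close> is the angle
  from the pole.\<close>

definition suspend :: "nat \<Rightarrow> real \<times> (nat \<Rightarrow> real) \<Rightarrow> nat \<Rightarrow> real" where
  "suspend m w = (\<lambda>i. if i = Suc m then cos (pi * fst w) else sin (pi * fst w) * snd w i)"

lemma continuous_on_suspend: "continuous_on S (suspend m)"
  unfolding suspend_def
proof (rule continuous_on_coordinatewise_then_product)
  fix i
  have "continuous_on S (\<lambda>w :: real \<times> (nat \<Rightarrow> real). snd w i)"
    by (rule continuous_on_compose2[OF continuous_on_coordinate[of UNIV]]) (auto intro: continuous_intros)
  then show "continuous_on S (\<lambda>w. if i = Suc m then cos (pi * fst w) else sin (pi * fst w) * snd w i)"
    by (cases "i = Suc m") (auto intro!: continuous_intros)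
qed

lemma suspend_in:
  assumes "v \<in> unit_sphere m" shows "suspend m (t, v) \<in> unit_sphere (Suc m)"
proof -
  have "(\<Sum>i\<le>m. (suspend m (t, v) i)\<^sup>2) = (sin (pi * t))\<^sup>2 * (\<Sum>i\<le>m. (v i)\<^sup>2)"
    by (simp add: suspend_def power_mult_distrib sum_distrib_left)
  then show ?thesis using assms by (simp add: unit_sphere_def) (simp add: suspend_def)
qed

lemma unit_sphere_nonempty: "(\<lambda>i. if i = 0 then 1 else 0) \<in> unit_sphere m"
  by (simp add: unit_sphere_def if_distrib[of "\<lambda>x. x\<^sup>2"] sum.delta cong: if_cong)

lemma suspend_onto:
  assumes x: "x \<in> unit_sphere (Suc m)"
  obtains t v where "t \<in> {0..1}" "v \<in> unit_sphere m" "x = suspend m (t, v)"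
proof -
  define c where "c = x (Suc m)"
  have sq: "(\<Sum>i\<le>m. (x i)\<^sup>2) + c\<^sup>2 = 1" using x by (simp add: unit_sphere_def c_def)
  moreover have "(\<Sum>i\<le>m. (x i)\<^sup>2) \<ge> 0" by (intro sum_nonneg) auto
  ultimately have "c\<^sup>2 \<le> 1" by linarith
  then have c: "-1 \<le> c" "c \<le> 1" by (simp_all add: abs_square_le_1 abs_le_iff)
  define t where "t = arccos c / pi"
  have t: "t \<in> {0..1}" using arccos_bounded[OF c] by (simp add: t_def)
  have cos: "cos (pi * t) = c" using c by (simp add: t_def)
  have sin: "(sin (pi * t))\<^sup>2 = (\<Sum>i\<le>m. (x i)\<^sup>2)" using sq cos sin_cos_squared_add[of "pi * t"] by simp
  show thesis
  proof (cases "sin (pi * t) = 0")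
    case True
    then have "\<forall>i\<le>m. x i = 0" using sin by (simp add: sum_nonneg_eq_0_iff)
    moreover have "\<forall>i>Suc m. x i = 0" using x by (simp add: unit_sphere_def)
    ultimately have "x i = suspend m (t, \<lambda>i. if i = 0 then 1 else 0) i" for i
      using cos True by (cases i "Suc m" rule: linorder_cases) (auto simp: suspend_def c_def)
    then have "x = suspend m (t, \<lambda>i. if i = 0 then 1 else 0)" by blast
    then show ?thesis using that[OF t unit_sphere_nonempty] by blast
  next
    case False
    define v where "v i = (if i = Suc m then 0 else x i / sin (pi * t))" for i
    have "(\<Sum>i\<le>m. (v i)\<^sup>2) = (\<Sum>i\<le>m. (x i)\<^sup>2) / (sin (pi * t))\<^sup>2"
      by (simp add: v_def power_divide sum_divide_distrib)
    moreover have "(\<Sum>i\<le>m. (x i)\<^sup>2) \<noteq> 0" using sin False by (metis zero_eq_power2)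
    ultimately have "(\<Sum>i\<le>m. (v i)\<^sup>2) = 1" using sin by simp
    then have "v \<in> unit_sphere m" using x by (auto simp: unit_sphere_def v_def)
    moreover have "x = suspend m (t, v)"
      using cos False by (intro ext) (simp add: suspend_def v_def c_def)
    ultimately show ?thesis using that[OF t] by blast
  qed
qed

lemma suspend_image: "suspend m ` ({0..1} \<times> unit_sphere m) = unit_sphere (Suc m)"
  using suspend_in by (auto elim!: suspend_onto)

lemma suspend_eq:
  assumes "suspend m (t, v) = suspend m (t', v')" "t \<in> {0..1}" "t' \<in> {0..1}"
    "v \<in> unit_sphere m" "v' \<in> unit_sphere m"
  shows "t = t' \<and> (t = 0 \<or> t = 1 \<or> v = v')"
proof -
  have "cos (pi * t) = cos (pi * t')" using fun_cong[OF assms(1), of "Suc m"] by (simp add: suspend_def)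
  then have t: "t = t'" using cos_inj_pi[of "pi * t" "pi * t'"] assms by simp
  have "v = v'" if "t \<noteq> 0" "t \<noteq> 1"
  proof
    fix i
    have "sin (pi * t) > 0" using that assms(2) by (intro sin_gt_zero) auto
    then show "v i = v' i" using fun_cong[OF assms(1), of i] assms(4,5) t
      by (cases "i = Suc m") (auto simp: suspend_def unit_sphere_def)
  qed
  then show ?thesis using t by blast
qed

text \<open>The meridians are arcs that all pass through the pole at \<open>t = 0\<close>.\<close>

lemma connected_unit_sphere: "connected (unit_sphere (Suc m))"
proof -
  let ?A = "\<lambda>v. suspend m ` ({0..1} \<times> {v})"
  have "connected (\<Union>v\<in>unit_sphere m. ?A v)"
  proof (rule connected_Union)
    show "connected A" if "A \<in> ?A ` unit_sphere m" for A
      using that by (auto intro!: connected_continuous_image continuous_on_suspend connected_Times)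
    have "(\<lambda>i. if i = Suc m then 1 else 0) \<in> ?A v" for v
      by (auto intro!: image_eqI[of _ _ "(0, v)"] simp: suspend_def)
    then show "\<Inter> (?A ` unit_sphere m) \<noteq> {}" by blast
  qed
  moreover have "(\<Union>v\<in>unit_sphere m. ?A v) = unit_sphere (Suc m)"
    using suspend_image[of m] by blast
  ultimately show ?thesis by simp
qed

context quotient_action
begin

text \<open>Pulled back to the cylinder, \<open>f\<close> contracts to the end \<open>t = 0\<close>,
  where it is constant, so it lifts. On each end of the cylinder the lift stays in one fibre and is
  constant because the sphere of dimension \<open>n - 1\<close> is connected; this is where
  \<open>n \<ge> 2\<close> enters. So the lift descends to the sphere, and it takes its values in a
  contractible space.\<close>

lemma nullhomotopic_sphere:
  assumes n: "n \<ge> 2" and f: "continuous_map (nsphere n) X f"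
  shows "\<exists>c. homotopic_with (\<lambda>_. True) (nsphere n) X f (\<lambda>_. c)"
proof -
  obtain k where k: "n = Suc (Suc k)" using n by (metis add_2_eq_Suc le_Suc_ex)
  define m where "m = Suc k"
  have nm: "n = Suc m" by (simp add: k m_def)
  let ?Z = "{0..1::real} \<times> unit_sphere m"
  have conn: "connected (unit_sphere m)" unfolding m_def by (rule connected_unit_sphere)
  have cZ: "compact ?Z" by (intro compact_Times compact_unit_sphere) simp
  have cs: "continuous_map (top_of_set ?Z) (nsphere n) (suspend m)"
    using suspend_in
    by (auto simp: nm nsphere_eq_unit_sphere continuous_map_in_subtopology continuous_on_suspend)
  define v0 :: "nat \<Rightarrow> real" where "v0 = (\<lambda>i. if i = 0 then 1 else 0)"
  have v0: "v0 \<in> unit_sphere m" unfolding v0_def by (rule unit_sphere_nonempty)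
  have ends: "suspend m (t, v) = suspend m (t, v')" if "t = 0 \<or> t = 1" for t v v'
    using that by (auto simp: suspend_def)
  have "continuous_map (top_of_set ({0..1} \<times> ?Z)) (top_of_set ?Z) (\<lambda>w. (fst w * fst (snd w), snd (snd w)))"
  proof -
    have "continuous_on S (\<lambda>w :: real \<times> real \<times> (nat \<Rightarrow> real). (fst w * fst (snd w), snd (snd w)))" for S
      by (intro continuous_on_Pair continuous_on_mult continuous_on_fst continuous_on_snd continuous_on_id)
    then show ?thesis by (auto simp: continuous_map_in_subtopology mult_le_one)
  qed
  from continuous_map_compose[OF continuous_map_compose[OF this cs] f]
  have H: "continuous_map (top_of_set ({0..1} \<times> ?Z)) X (\<lambda>w. f (suspend m (fst w * fst (snd w), snd (snd w))))"
    by (simp only: o_def)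
  have "f (suspend m (0, v0)) \<in> topspace X"
    using f cs v0 by (auto simp: continuous_map_def)
  then obtain y where y: "y \<in> Y" "f (suspend m (0, v0)) = p y" by (auto simp: topspace_X)
  obtain F where F: "continuous_map (top_of_set ?Z) (top_of_set Y) F"
    "\<And>z. z \<in> ?Z \<Longrightarrow> p (F z) = f (suspend m z)"
  proof -
    have "continuous_map (top_of_set ?Z) (top_of_set Y) (\<lambda>_. y)" using y by simp
    moreover have "p y = f (suspend m (0 * fst z, snd z))" for z :: "real \<times> (nat \<Rightarrow> real)"
      using y(2) ends[of 0 v0 "snd z"] by simp
    ultimately show thesis using lift_homotopy_end[OF cZ H, of "\<lambda>_. y"] that by auto
  qed
  have F_ends: "F (t, v) = F (t, v')"
    if t: "t = 0 \<or> t = 1" and v: "v \<in> unit_sphere m" "v' \<in> unit_sphere m" for t v v'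
  proof (rule constant_on_fibre[OF conn _ _ _ v])
    have sub: "Pair t ` unit_sphere m \<subseteq> ?Z" using t by auto
    show "continuous_on (unit_sphere m) (\<lambda>v. F (t, v))"
      by (rule continuous_on_compose2[of ?Z F]) (use F(1) sub in \<open>auto intro!: continuous_intros\<close>)
    show "(\<lambda>v. F (t, v)) ` unit_sphere m \<subseteq> Y" using F(1) sub by (auto simp: continuous_map_def)
    show "p (F (t, s)) = p (F (t, s'))" if "s \<in> unit_sphere m" "s' \<in> unit_sphere m" for s s'
      using F(2)[of "(t, s)"] F(2)[of "(t, s')"] ends[OF t, of s s'] t that by auto
  qed
  have q: "quotient_map (top_of_set ?Z) (nsphere n) (suspend m)"
  proof (rule continuous_imp_quotient_map[OF cs])
    show "compact_space (top_of_set ?Z)" using cZ by (simp add: compact_space_subtopology)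
    show "Hausdorff_space (nsphere n)"
      unfolding nsphere_eq_unit_sphere by (intro Hausdorff_space_subtopology Hausdorff_space_euclidean)
    show "suspend m ` topspace (top_of_set ?Z) = topspace (nsphere n)"
      using suspend_image[of m] by (simp add: nm nsphere_eq_unit_sphere)
  qed
  have Finj: "F z = F z'" if "z \<in> ?Z" "z' \<in> ?Z" "suspend m z = suspend m z'" for z z'
  proof -
    obtain t v t' v' where z: "z = (t, v)" "z' = (t', v')" by (metis surj_pair)
    then show ?thesis using suspend_eq[of m t v t' v'] F_ends that by auto
  qed
  obtain g where g: "continuous_map (nsphere n) (top_of_set Y) g"
    "\<And>z. z \<in> ?Z \<Longrightarrow> g (suspend m z) = F z"
  proof (rule quotient_map_lift_exists[OF q F(1)])
    show "F x = F y" if "x \<in> topspace (top_of_set ?Z)" "y \<in> topspace (top_of_set ?Z)"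
      "suspend m x = suspend m y" for x y
      using that by (intro Finj) simp_all
  next
    fix g assume "continuous_map (nsphere n) (top_of_set Y) g"
      "\<And>x. x \<in> topspace (top_of_set ?Z) \<Longrightarrow> g (suspend m x) = F x"
    then show thesis by (intro that) simp_all
  qed
  have pg: "p (g x) = f x" if "x \<in> topspace (nsphere n)" for x
  proof -
    have "x \<in> unit_sphere (Suc m)" using that by (simp add: nsphere_eq_unit_sphere nm)
    then obtain z where "z \<in> ?Z" "x = suspend m z" using suspend_image[of m] by blast
    then show ?thesis using g(2) F(2) by simp
  qed
  obtain c where "homotopic_with (\<lambda>h. True) (nsphere n) X (p \<circ> g) (\<lambda>x. c)"
    by (rule nullhomotopic_through_contractible_space[OF g(1) continuous_map_p contractible_Y])
  then have "homotopic_with (\<lambda>_. True) (nsphere n) X f (\<lambda>_. c)"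
    by (rule homotopic_with_eq) (use pg in auto)
  then show ?thesis by blast
qed

lemma aspherical_X: "aspherical X"
  unfolding aspherical_def using path_connected_X nullhomotopic_sphere by blast

lemma closed_manifold_X: "closed_manifold DIM('a) X"
  unfolding closed_manifold_def using topological_manifold_X compact_X by blast

end

section \<open>Proper actions with an invariant distance function\<close>

text \<open>\<open>\<rho>\<close> is an invariant gauge of closeness that vanishes exactly on the
  diagonal. \<open>free\<close> and \<open>proper\<close> refer to the maps induced by group
  elements, which allows the group to act with an infinite kernel.\<close>

locale proper_action = continuous_action G act Y
  for G :: "('g, 'h) monoid_scheme" (structure) and act :: "'g \<Rightarrow> 'a::euclidean_space \<Rightarrow> 'a" and Y +
  fixes \<rho> :: "'a \<Rightarrow> 'a \<Rightarrow> real"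
  assumes \<rho>_cont: "continuous_on (Y \<times> Y) (\<lambda>(y, y'). \<rho> y y')"
    and \<rho>_inv: "g \<in> carrier G \<Longrightarrow> y \<in> Y \<Longrightarrow> y' \<in> Y \<Longrightarrow> \<rho> (act g y) (act g y') = \<rho> y y'"
    and \<rho>_nonneg: "y \<in> Y \<Longrightarrow> y' \<in> Y \<Longrightarrow> \<rho> y y' \<ge> 0"
    and \<rho>_eq_0: "y \<in> Y \<Longrightarrow> y' \<in> Y \<Longrightarrow> \<rho> y y' = 0 \<longleftrightarrow> y = y'"
    and \<rho>_bounded: "compact C \<Longrightarrow> C \<subseteq> Y \<Longrightarrow>
      \<exists>C'. compact C' \<and> C' \<subseteq> Y \<and> (\<forall>y\<in>C. \<forall>y'\<in>Y. \<rho> y y' < 1 \<longrightarrow> y' \<in> C')"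
    and cocompact: "\<exists>C. compact C \<and> C \<subseteq> Y \<and> (\<forall>y\<in>Y. \<exists>g\<in>carrier G. act g y \<in> C)"
    and free: "g \<in> carrier G \<Longrightarrow> y \<in> Y \<Longrightarrow> act g y = y \<Longrightarrow> y' \<in> Y \<Longrightarrow> act g y' = y'"
    and proper: "compact C \<Longrightarrow> C \<subseteq> Y \<Longrightarrow>
      finite ((\<lambda>g. restrict (act g) Y) ` {g \<in> carrier G. act g ` C \<inter> C \<noteq> {}})"
begin

definition maps_meeting :: "'a set \<Rightarrow> ('a \<Rightarrow> 'a) set" where
  "maps_meeting C = (\<lambda>g. restrict (act g) Y) ` {g \<in> carrier G. act g ` C \<inter> C \<noteq> {}}"

lemma maps_meetingI:
  "g \<in> carrier G \<Longrightarrow> u \<in> C \<Longrightarrow> act g u \<in> C \<Longrightarrow> restrict (act g) Y \<in> maps_meeting C"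
  unfolding maps_meeting_def by blast

lemma maps_meetingE:
  assumes "f \<in> maps_meeting C"
  obtains g where "g \<in> carrier G" "\<And>y. y \<in> Y \<Longrightarrow> f y = act g y"
proof -
  obtain g where "g \<in> carrier G" "f = restrict (act g) Y"
    using assms unfolding maps_meeting_def by blast
  then show thesis by (intro that) simp_all
qed

lemma maps_meeting_continuous: "f \<in> maps_meeting C \<Longrightarrow> continuous_on Y f"
  by (erule maps_meetingE) (metis act_cont continuous_on_cong)

text \<open>By invariance \<open>y\<close> may be moved into the compact set \<open>C\<close>, and
  then \<open>y'\<close> and its image lie in a compact \<open>C'\<close>. Only finitely many
  nontrivial maps take some point of \<open>C'\<close> into \<open>C'\<close>. For each of them the
  sum of the two distances is continuous on \<open>C \<times> C'\<close>, and a zero would give a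
  fixed point, so it has a positive minimum.\<close>

lemma separation_radius:
  "\<exists>\<epsilon>>0. \<forall>y\<in>Y. \<forall>y'\<in>Y. \<forall>g\<in>carrier G. \<rho> y y' < \<epsilon> \<longrightarrow> \<rho> y (act g y') < \<epsilon> \<longrightarrow> act g y' = y'"
proof -
  obtain C where C: "compact C" "C \<subseteq> Y" "\<And>y. y \<in> Y \<Longrightarrow> \<exists>g\<in>carrier G. act g y \<in> C"
    using cocompact by blast
  obtain C' where C': "compact C'" "C' \<subseteq> Y"
    "\<And>y y'. y \<in> C \<Longrightarrow> y' \<in> Y \<Longrightarrow> \<rho> y y' < 1 \<Longrightarrow> y' \<in> C'"
    using \<rho>_bounded[OF C(1,2)] by blast
  define F where "F = {f \<in> maps_meeting C'. \<exists>y\<in>Y. f y \<noteq> y}"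
  have finF: "finite F" using proper[OF C'(1,2)] unfolding F_def maps_meeting_def by simp
  have "\<exists>m>0. \<forall>y\<in>C. \<forall>y'\<in>C'. m \<le> \<rho> y y' + \<rho> y (f y')" if f: "f \<in> F" for f
  proof (cases "C \<times> C' = {}")
    case True
    then show ?thesis by (intro exI[of _ 1]) auto
  next
    case False
    have fm: "f \<in> maps_meeting C'" using f by (simp add: F_def)
    obtain g where g: "g \<in> carrier G" "\<And>y. y \<in> Y \<Longrightarrow> f y = act g y" using maps_meetingE[OF fm] by metis
    have fY: "f y \<in> Y" if "y \<in> Y" for y using g act_closed that by simp
    let ?\<phi> = "\<lambda>w. (case w of (y, y') \<Rightarrow> \<rho> y y') + (case (fst w, f (snd w)) of (y, y') \<Rightarrow> \<rho> y y')"
    have sub: "C \<times> C' \<subseteq> Y \<times> Y" using C C' by auto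
    have cf: "continuous_on (C \<times> C') (\<lambda>w. f (snd w))"
      by (rule continuous_on_compose2[OF maps_meeting_continuous[OF fm]])
        (use C' in \<open>auto intro: continuous_on_snd\<close>)
    have "continuous_on (C \<times> C') (\<lambda>w. case (fst w, f (snd w)) of (y, y') \<Rightarrow> \<rho> y y')"
      by (rule continuous_on_compose2[OF \<rho>_cont]) (use cf sub fY in \<open>auto intro!: continuous_intros\<close>)
    then have "continuous_on (C \<times> C') ?\<phi>"
      by (intro continuous_on_add continuous_on_subset[OF \<rho>_cont sub])
    then obtain w where w: "w \<in> C \<times> C'" "\<And>v. v \<in> C \<times> C' \<Longrightarrow> ?\<phi> w \<le> ?\<phi> v"
      using continuous_attains_inf[OF compact_Times[OF C(1) C'(1)] False] by blast
    obtain y y' where yy: "w = (y, y')" "y \<in> Y" "y' \<in> Y" using w sub by auto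
    have "?\<phi> w > 0"
    proof (rule ccontr)
      assume "\<not> ?\<phi> w > 0"
      then have "\<rho> y y' = 0" "\<rho> y (f y') = 0"
        using \<rho>_nonneg[OF yy(2,3)] \<rho>_nonneg[OF yy(2) fY[OF yy(3)]] yy by auto
      then have "act g y' = y'" using \<rho>_eq_0 yy fY g(2) by metis
      then have "\<forall>u\<in>Y. f u = u" using free[OF g(1) yy(3)] g(2) by simp
      then show False using f by (simp add: F_def)
    qed
    then show ?thesis using w(2) by (intro exI[of _ "?\<phi> w"]) auto
  qed
  then obtain m where m: "\<And>f. f \<in> F \<Longrightarrow> m f > 0"
    "\<And>f y y'. f \<in> F \<Longrightarrow> y \<in> C \<Longrightarrow> y' \<in> C' \<Longrightarrow> m f \<le> \<rho> y y' + \<rho> y (f y')" by metis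
  \<comment> \<open>The bound 1 makes \<open>\<rho>_bounded\<close> applicable, and the halves make
    two distances below \<open>\<epsilon>\<close> add up to less than each minimum.\<close>
  define \<epsilon> where "\<epsilon> = Min (insert 1 ((\<lambda>f. m f / 2) ` F))"
  have \<epsilon>: "\<epsilon> > 0" "\<epsilon> \<le> 1" "\<And>f. f \<in> F \<Longrightarrow> \<epsilon> \<le> m f / 2"
  proof -
    have fin: "finite (insert 1 ((\<lambda>f. m f / 2) ` F))" using finF by simp
    show "\<epsilon> > 0" "\<epsilon> \<le> 1" unfolding \<epsilon>_def using fin m(1) by auto
    show "\<epsilon> \<le> m f / 2" if "f \<in> F" for f unfolding \<epsilon>_def using fin that by (intro Min_le) auto
  qed
  have "act g y' = y'" if y: "y \<in> Y" "y' \<in> Y" and g: "g \<in> carrier G"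
    and close: "\<rho> y y' < \<epsilon>" "\<rho> y (act g y') < \<epsilon>" for y y' g
  proof -
    obtain h where h: "h \<in> carrier G" "act h y \<in> C" using C(3) y by blast
    \<comment> \<open>Conjugation by \<open>h\<close> transports the situation from \<open>y\<close>
      to the point \<open>act h y\<close> of \<open>C\<close>.\<close>
    let ?g = "h \<otimes> g \<otimes> inv h"
    have gy: "act g y' \<in> Y" using act_closed g y by simp
    have hy: "act h y' \<in> Y" using act_closed h y by simp
    have eq: "act ?g (act h y') = act h (act g y')"
      using h g y gy hy act_mult act_inv act_closed by (simp add: m_assoc)
    have c: "\<rho> (act h y) (act h y') < \<epsilon>" "\<rho> (act h y) (act h (act g y')) < \<epsilon>"
      using close \<rho>_inv h y gy by simp_all
    then have C'h: "act h y' \<in> C'" "act h (act g y') \<in> C'"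
      using C'(3)[OF h(2)] hy \<epsilon>(2) act_closed h gy by force+
    then have f: "restrict (act ?g) Y \<in> maps_meeting C'"
      using h g eq by (intro maps_meetingI[of _ "act h y'"]) auto
    have "restrict (act ?g) Y \<notin> F"
    proof
      assume F: "restrict (act ?g) Y \<in> F"
      show False using m(2)[OF F h(2) C'h(1)] \<epsilon>(3)[OF F] c eq hy by simp
    qed
    then have "act h (act g y') = act h y'" using f hy eq unfolding F_def by auto
    then show ?thesis using act_inv h gy y by metis
  qed
  then show ?thesis using \<epsilon>(1) by blast
qed

text \<open>Only finitely many maps carry a point of two compact balls into their union. Each such
  map \<open>f\<close> is handled by separating \<open>f y\<close> from \<open>y'\<close>, and
  finitely many neighbourhoods may be intersected.\<close>

lemma orbits_separated:
  assumes y: "y \<in> Y" "y' \<in> Y" and ne: "\<And>g. g \<in> carrier G \<Longrightarrow> act g y \<noteq> y'"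
  shows "\<exists>U V. open U \<and> open V \<and> y \<in> U \<and> y' \<in> V \<and> (\<forall>u\<in>U \<inter> Y. \<forall>g\<in>carrier G. act g u \<notin> V)"
proof -
  obtain r where r: "r > 0" "cball y r \<subseteq> Y" using open_Y y(1) open_contains_cball by blast
  obtain r' where r': "r' > 0" "cball y' r' \<subseteq> Y" using open_Y y(2) open_contains_cball by blast
  define C where "C = cball y r \<union> cball y' r'"
  have C: "compact C" "C \<subseteq> Y" using r r' by (auto simp: C_def)
  have "\<exists>U V. open U \<and> open V \<and> y \<in> U \<and> y' \<in> V \<and> (\<forall>u\<in>U \<inter> Y. f u \<notin> V)"
    if f: "f \<in> maps_meeting C" for f
  proof -
    have "f y \<noteq> y'" using f y(1) ne by (metis maps_meetingE)
    then obtain A V where AV: "open A" "open V" "f y \<in> A" "y' \<in> V" "A \<inter> V = {}"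
      using hausdorff by metis
    have "open (Y \<inter> f -` A)"
      by (rule continuous_open_preimage[OF maps_meeting_continuous[OF f] open_Y AV(1)])
    then show ?thesis using AV y by (intro exI[of _ "Y \<inter> f -` A"] exI[of _ V]) auto
  qed
  then obtain U V where UV: "\<And>f. f \<in> maps_meeting C \<Longrightarrow>
      open (U f) \<and> open (V f) \<and> y \<in> U f \<and> y' \<in> V f \<and> (\<forall>u\<in>U f \<inter> Y. f u \<notin> V f)" by metis
  have fin: "finite (maps_meeting C)" using proper[OF C] by (simp add: maps_meeting_def)
  let ?U = "ball y r \<inter> (\<Inter>f\<in>maps_meeting C. U f)" and ?V = "ball y' r' \<inter> (\<Inter>f\<in>maps_meeting C. V f)"
  have op: "open ?U" "open ?V" using fin UV by (auto intro!: open_Int open_INT)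
  have mem: "y \<in> ?U" "y' \<in> ?V" using UV r r' by auto
  have disj: "act g u \<notin> ?V" if u: "u \<in> ?U \<inter> Y" and g: "g \<in> carrier G" for u g
  proof
    assume v: "act g u \<in> ?V"
    have "u \<in> C" "act g u \<in> C" using u v unfolding C_def by auto
    then have f: "restrict (act g) Y \<in> maps_meeting C" by (rule maps_meetingI[OF g])
    have "u \<in> U (restrict (act g) Y) \<inter> Y" using u f by blast
    then have "restrict (act g) Y u \<notin> V (restrict (act g) Y)" using UV[OF f] by blast
    then show False using v f u by auto
  qed
  show ?thesis by (intro exI[of _ ?U] exI[of _ ?V] conjI ballI op mem disj)
qed

theorem quotient_manifold:
  assumes perfect: "derived G (carrier G) = carrier G"
  shows "\<exists>X :: (nat \<Rightarrow> real) topology. topspace X \<noteq> {} \<and> closed_manifold DIM('a) X \<and> aspherical X \<and>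
    (\<forall>x \<in> topspace X. perfect_group (fundamental_group X x))"
proof -
  \<comment> \<open>The injective coordinate map \<open>e\<close> turns points of \<open>Y\<close>
    into elements of \<open>nat \<Rightarrow> real\<close>, the point type of the manifold; each
    orbit is named by the image of a chosen representative.\<close>
  obtain V e d where V: "homeomorphic_maps (top_of_set (UNIV :: 'a set))
      (subtopology (Euclidean_space DIM('a)) V) e d"
    using open_homeomorphic_Euclidean_space[of "UNIV :: 'a set"] by (auto simp: homeomorphic_space_def)
  then have de: "d (e y) = y" for y by (simp add: homeomorphic_maps_def)
  define orbit where "orbit y = (\<lambda>g. act g y) ` carrier G" for y
  define p where "p y = e (SOME u. u \<in> orbit y)" for y
  have self: "y \<in> orbit y" if "y \<in> Y" for y
    unfolding orbit_def using that act_one by (intro image_eqI[of _ _ \<one>]) auto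
  have orbit_act: "orbit (act g y) = orbit y" if g: "g \<in> carrier G" and y: "y \<in> Y" for g y
  proof -
    have "act h (act g y) \<in> orbit y" if h: "h \<in> carrier G" for h
      unfolding orbit_def using act_mult[OF h g y] g h by (intro image_eqI[of _ _ "h \<otimes> g"]) auto
    moreover have "act h y \<in> orbit (act g y)" if h: "h \<in> carrier G" for h
      unfolding orbit_def using act_mult[of "h \<otimes> inv g" "g" y] g h y
      by (intro image_eqI[of _ _ "h \<otimes> inv g"]) (auto simp: m_assoc)
    ultimately show ?thesis by (fastforce simp: orbit_def[of y] orbit_def[of "act g y"])
  qed
  have p_eq: "p y = p y' \<longleftrightarrow> (\<exists>g\<in>carrier G. y' = act g y)" if y: "y \<in> Y" "y' \<in> Y" for y y'
  proof
    assume "p y = p y'"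
    then have "(SOME u. u \<in> orbit y) = (SOME u. u \<in> orbit y')" unfolding p_def using de by metis
    moreover have "(SOME u. u \<in> orbit y) \<in> orbit y" "(SOME u. u \<in> orbit y') \<in> orbit y'"
      using someI[of "\<lambda>u. u \<in> orbit y", OF self[OF y(1)]]
        someI[of "\<lambda>u. u \<in> orbit y'", OF self[OF y(2)]] by simp_all
    ultimately obtain u where u: "u \<in> orbit y" "u \<in> orbit y'" by metis
    then obtain g h where "g \<in> carrier G" "u = act g y" "h \<in> carrier G" "u = act h y'"
      unfolding orbit_def by blast
    then have "orbit u = orbit y" "orbit u = orbit y'" using orbit_act y by metis+
    then have "y' \<in> orbit y" using self[OF y(2)] by simp
    then show "\<exists>g\<in>carrier G. y' = act g y" by (auto simp: orbit_def)
  next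
    assume "\<exists>g\<in>carrier G. y' = act g y"
    then show "p y = p y'" using orbit_act y unfolding p_def by auto
  qed
  obtain \<epsilon> where \<epsilon>: "\<epsilon> > 0" "\<And>y y' g. y \<in> Y \<Longrightarrow> y' \<in> Y \<Longrightarrow> g \<in> carrier G \<Longrightarrow>
      \<rho> y y' < \<epsilon> \<Longrightarrow> \<rho> y (act g y') < \<epsilon> \<Longrightarrow> act g y' = y'" using separation_radius by blast
  define N where "N = {w \<in> Y \<times> Y. \<rho> (fst w) (snd w) < \<epsilon>}"
  have "open (Y \<times> Y \<inter> (\<lambda>(y, y'). \<rho> y y') -` {..<\<epsilon>})"
    by (intro continuous_open_preimage \<rho>_cont open_Times open_Y) auto
  then have N_open: "open N" by (simp add: N_def Int_def vimage_def case_prod_unfold)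
  interpret Q: quotient_action G act Y p N
  proof
    show "open N" by (fact N_open)
    show "y \<in> Y \<Longrightarrow> y' \<in> Y \<Longrightarrow> p y = p y' \<longleftrightarrow> (\<exists>g\<in>carrier G. y' = act g y)" for y y' by (rule p_eq)
    show "N \<subseteq> Y \<times> Y" by (auto simp: N_def)
    show "y \<in> Y \<Longrightarrow> (y, y) \<in> N" for y using \<rho>_eq_0[of y y] \<epsilon>(1) by (simp add: N_def)
    show "(y, y') \<in> N \<Longrightarrow> g \<in> carrier G \<Longrightarrow> (act g y, act g y') \<in> N" for y y' g
      using \<rho>_inv act_closed by (simp add: N_def)
    show "(y, y') \<in> N \<Longrightarrow> g \<in> carrier G \<Longrightarrow> (y, act g y') \<in> N \<Longrightarrow> act g y' = y'" for y y' g
      using \<epsilon>(2)[of y y' g] by (simp add: N_def)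
    show "\<exists>U V. open U \<and> open V \<and> y \<in> U \<and> y' \<in> V \<and> p ` (U \<inter> Y) \<inter> p ` (V \<inter> Y) = {}"
      if "y \<in> Y" "y' \<in> Y" "p y \<noteq> p y'" for y y'
    proof -
      have "act g y \<noteq> y'" if "g \<in> carrier G" for g using p_eq \<open>y \<in> Y\<close> \<open>y' \<in> Y\<close> \<open>p y \<noteq> p y'\<close> that by blast
      from orbits_separated[OF \<open>y \<in> Y\<close> \<open>y' \<in> Y\<close> this] obtain U V where
        UV: "open U" "open V" "y \<in> U" "y' \<in> V" "\<And>u g. u \<in> U \<inter> Y \<Longrightarrow> g \<in> carrier G \<Longrightarrow> act g u \<notin> V" by blast
      have "p u \<noteq> p v" if "u \<in> U \<inter> Y" "v \<in> V \<inter> Y" for u v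
        using UV(5)[OF that(1)] p_eq[of u v] that by auto
      then have "p ` (U \<inter> Y) \<inter> p ` (V \<inter> Y) = {}" by blast
      then show ?thesis using UV by (intro exI[of _ U] exI[of _ V]) simp
    qed
    obtain C where C: "compact C" "C \<subseteq> Y" "\<And>y. y \<in> Y \<Longrightarrow> \<exists>g\<in>carrier G. act g y \<in> C"
      using cocompact by blast
    have "p y \<in> p ` C" if y: "y \<in> Y" for y
    proof -
      obtain g where g: "g \<in> carrier G" "act g y \<in> C" using C(3) y by blast
      then have "p y = p (act g y)" using p_eq y act_closed by blast
      then show ?thesis using g by blast
    qed
    then show "\<exists>C. compact C \<and> C \<subseteq> Y \<and> p ` C = p ` Y" using C by blast
  qed
  have "topspace Q.X \<noteq> {}" using Q.topspace_X Y_nonempty by simp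
  then show ?thesis
    using Q.closed_manifold_X Q.aspherical_X Q.perfect_fundamental_group[OF perfect] by blast
qed

end

section \<open>The disc and the universal cover of SU(1,1)\<close>

text \<open>For a sign \<open>s\<close>, the pair \<open>(a, b)\<close> stands for the matrix with rows \<open>(a, b)\<close> and
  \<open>(s b\<^sup>*, a\<^sup>*)\<close>, where \<open>\<^sup>*\<close> is complex conjugation; \<open>s = 1\<close> gives \<open>SU(1,1)\<close> and \<open>s = -1\<close> gives \<open>SU(2)\<close>.\<close>

type_synonym quat = "complex \<times> complex"

definition qmul :: "real \<Rightarrow> quat \<Rightarrow> quat \<Rightarrow> quat" where
  "qmul s q r = (fst q * fst r + of_real s * snd q * cnj (snd r), fst q * snd r + snd q * cnj (fst r))"

definition qconj :: "quat \<Rightarrow> quat" where "qconj q = (cnj (fst q), - snd q)"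

definition qnorm :: "real \<Rightarrow> quat \<Rightarrow> real" where
  "qnorm s q = (cmod (fst q))\<^sup>2 - s * (cmod (snd q))\<^sup>2"

definition qone :: quat where "qone = (1, 0)"

lemma qmul_assoc: "qmul s (qmul s q r) t = qmul s q (qmul s r t)"
  by (simp add: qmul_def algebra_simps)

lemma qmul_one [simp]: "qmul s qone q = q" "qmul s q qone = q"
  by (simp_all add: qmul_def qone_def)

lemma of_real_qnorm:
  "complex_of_real (qnorm s q) = fst q * cnj (fst q) - of_real s * (snd q * cnj (snd q))"
  by (simp add: qnorm_def complex_norm_square flip: of_real_power)

lemma qnorm_mult: "qnorm s (qmul s q r) = qnorm s q * qnorm s r"
proof -
  have "complex_of_real (qnorm s (qmul s q r)) = complex_of_real (qnorm s q * qnorm s r)"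
    unfolding of_real_mult of_real_qnorm by (simp add: qmul_def algebra_simps)
  then show ?thesis using of_real_eq_iff by blast
qed

lemma qnorm_conj [simp]: "qnorm s (qconj q) = qnorm s q" and qnorm_one [simp]: "qnorm s qone = 1"
  by (simp_all add: qnorm_def qconj_def qone_def)

lemma qmul_conj:
  assumes "qnorm s q = 1" shows "qmul s (qconj q) q = qone" "qmul s q (qconj q) = qone"
  using of_real_qnorm[of s q] assms by (simp_all add: qmul_def qconj_def qone_def algebra_simps)

section \<open>Real arguments of complex numbers\<close>

definition polar :: "complex \<Rightarrow> real \<Rightarrow> bool" where
  "polar a \<theta> \<longleftrightarrow> a = of_real (cmod a) * cis \<theta>"

lemma polar_mult: "polar a \<theta> \<Longrightarrow> polar b \<eta> \<Longrightarrow> polar (a * b) (\<theta> + \<eta>)"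
  unfolding polar_def norm_mult of_real_mult cis_mult[symmetric] by (metis mult.commute mult.left_commute)

lemma polar_cnj: "polar a \<theta> \<Longrightarrow> polar (cnj a) (- \<theta>)"
  unfolding polar_def by (metis cis_cnj complex_cnj_complex_of_real complex_cnj_mult complex_mod_cnj)

lemma polar_cis: "polar (cis \<theta>) \<theta>" and polar_one: "polar 1 0"
  by (simp_all add: polar_def)

text \<open>The tool for identities between lifted angles: both sides are arguments of one nonzero
  number, and crude bounds keep them less than \<open>2 * pi\<close> apart.\<close>

lemma polar_unique:
  assumes "polar a \<theta>" "polar a \<eta>" "a \<noteq> 0" "\<bar>\<theta> - \<eta>\<bar> < 2 * pi"
  shows "\<theta> = \<eta>"
proof -
  have "of_real (cmod a) * cis \<theta> = of_real (cmod a) * cis \<eta>"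
    using assms(1,2) unfolding polar_def by metis
  then have "cis \<theta> = cis \<eta>" using assms(3) by simp
  then have "cis (\<theta> - \<eta>) = 1" by (simp flip: cis_divide)
  then have "cos (\<theta> - \<eta>) = 1" by (simp add: complex_eq_iff)
  then obtain n :: int where n: "\<theta> - \<eta> = n * 2 * pi" by (auto simp: cos_one_2pi_int)
  then have "\<bar>real_of_int n\<bar> * (2 * pi) < 1 * (2 * pi)"
    using assms(4) by (simp add: abs_mult)
  then have "\<bar>real_of_int n\<bar> < 1" by (subst (asm) mult_less_cancel_right) simp
  then have "n = 0" by linarith
  then show ?thesis using n by simp
qed

text \<open>A branch of the argument of \<open>1 + u\<close> that is continuous on the unit disc and
  stays below \<open>pi / 2\<close> in absolute value there.\<close>

definition tau :: "complex \<Rightarrow> real" where "tau u = Arg (1 + u)"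

lemma Re_one_plus_pos: "cmod u < 1 \<Longrightarrow> Re (1 + u) > 0"
  using abs_Re_le_cmod[of u] by simp

lemma tau_bound: "cmod u < 1 \<Longrightarrow> \<bar>tau u\<bar> < pi / 2"
  using Re_one_plus_pos[of u] unfolding tau_def Arg_Re_pos by blast

lemma polar_tau: "polar (1 + u) (tau u)"
  unfolding polar_def tau_def using rcis_cmod_Arg[of "1 + u"] by (simp add: rcis_def)

lemma tau_0 [simp]: "tau 0 = 0"
  using Arg_of_real[of 1] by (simp add: tau_def)

lemma tau_of_real: "\<bar>r\<bar> < 1 \<Longrightarrow> tau (of_real r) = 0"
  using Arg_of_real[of "1 + r"] by (simp add: tau_def)

lemma continuous_on_tau [continuous_intros]:
  assumes "continuous_on S f" "\<And>x. x \<in> S \<Longrightarrow> cmod (f x) < 1"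
  shows "continuous_on S (\<lambda>x. tau (f x))"
proof -
  have "1 + f x \<notin> \<real>\<^sub>\<le>\<^sub>0" if "x \<in> S" for x
    using Re_one_plus_pos[OF assms(2)[OF that]] by (auto simp: complex_nonpos_Reals_iff)
  then have "(\<lambda>x. 1 + f x) ` S \<subseteq> - \<real>\<^sub>\<le>\<^sub>0" by blast
  moreover have "continuous_on (- \<real>\<^sub>\<le>\<^sub>0) Arg"
    by (intro continuous_at_imp_continuous_on ballI continuous_at_Arg) simp
  moreover have "continuous_on S (\<lambda>x. 1 + f x)" by (intro continuous_intros assms)
  ultimately show ?thesis unfolding tau_def using continuous_on_compose2 by blast
qed

section \<open>Moebius transformations and automorphy factors\<close>

definition J :: "quat \<Rightarrow> complex \<Rightarrow> complex" where "J q z = fst q + snd q * cnj z"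

definition mob :: "quat \<Rightarrow> complex \<Rightarrow> complex" where "mob q z = (fst q * z + snd q) / cnj (J q z)"

text \<open>For \<open>q\<close> in SU(1,1) with argument \<open>\<theta>\<close>, the continuous
  argument of the automorphy factor \<open>J q z\<close> that equals \<open>\<theta>\<close> at
  \<open>z = 0\<close>: \<open>J q z\<close> is \<open>fst q\<close> times a number in the unit disc
  about 1.\<close>

definition inc :: "real \<Rightarrow> quat \<Rightarrow> complex \<Rightarrow> real" where
  "inc \<theta> q z = \<theta> + tau (snd q / fst q * cnj z)"

abbreviation disc :: "complex set" where "disc \<equiv> ball 0 1"

context
  fixes q :: quat assumes q: "qnorm 1 q = 1"
begin

lemma fst_nz: "fst q \<noteq> 0"
proof
  assume "fst q = 0"
  then have "- (cmod (snd q))\<^sup>2 = 1" using q by (simp add: qnorm_def)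
  then show False using zero_le_power2[of "cmod (snd q)"] by linarith
qed

lemma ratio_less: "cmod (snd q / fst q) < 1"
proof -
  have "(cmod (snd q))\<^sup>2 < (cmod (fst q))\<^sup>2" using q by (simp add: qnorm_def)
  then have "cmod (snd q) < cmod (fst q)" by (rule power2_less_imp_less) simp
  then show ?thesis using fst_nz by (simp add: norm_divide)
qed

lemma ratio_mult_less: "z \<in> disc \<Longrightarrow> cmod (snd q / fst q * cnj z) < 1"
  using mult_strict_mono'[OF ratio_less, of "cmod z" 1] by (simp add: norm_mult norm_divide)

lemma J_eq: "J q z = fst q * (1 + snd q / fst q * cnj z)"
  using fst_nz by (simp add: J_def field_simps)

lemma J_nz: "z \<in> disc \<Longrightarrow> J q z \<noteq> 0"
  using Re_one_plus_pos[OF ratio_mult_less] fst_nz unfolding J_eq by fastforce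

lemma polar_inc: "polar (fst q) \<theta> \<Longrightarrow> polar (J q z) (inc \<theta> q z)"
  unfolding J_eq inc_def by (intro polar_mult polar_tau)

text \<open>Invariance of the hermitian form of SU(1,1), written for two points. The case of equal
  points enters the invariance of \<open>\<kappa>\<close>, and the argument of both sides that of
  the real part of \<open>\<rho>\<close>.\<close>

lemma one_minus_mob:
  assumes "z \<in> disc" "w \<in> disc"
  shows "1 - mob q z * cnj (mob q w) = (1 - z * cnj w) / (cnj (J q z) * J q w)"
proof -
  have "fst q * cnj (fst q) = 1 + snd q * cnj (snd q)" using of_real_qnorm[of 1 q] q by (simp add: algebra_simps)
  then have "(fst q * cnj (fst q)) * (1 - z * cnj w) = (1 + snd q * cnj (snd q)) * (1 - z * cnj w)" by simp
  then have "cnj (J q z) * J q w - (fst q * z + snd q) * cnj (fst q * w + snd q) = 1 - z * cnj w"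
    by (simp add: J_def algebra_simps)
  then show ?thesis using J_nz assms by (simp add: mob_def field_simps)
qed

lemma one_minus_mob_norm:
  assumes "z \<in> disc" shows "1 - (cmod (mob q z))\<^sup>2 = (1 - (cmod z)\<^sup>2) / (cmod (J q z))\<^sup>2"
proof -
  have "complex_of_real (1 - (cmod (mob q z))\<^sup>2) = complex_of_real ((1 - (cmod z)\<^sup>2) / (cmod (J q z))\<^sup>2)"
    using one_minus_mob[OF assms assms] by (simp add: complex_norm_square mult.commute flip: of_real_power)
  then show ?thesis using of_real_eq_iff by blast
qed

lemma mob_closed: assumes "z \<in> disc" shows "mob q z \<in> disc"
proof -
  have "(cmod z)\<^sup>2 < 1" using assms by (simp add: abs_square_less_1)
  then have "1 - (cmod (mob q z))\<^sup>2 > 0"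
    using one_minus_mob_norm[OF assms] J_nz[OF assms] by simp
  then show ?thesis by (simp add: abs_square_less_1)
qed

lemma mob_diff:
  assumes "z \<in> disc" "w \<in> disc"
  shows "mob q z - mob q w = (z - w) / (cnj (J q z) * cnj (J q w))"
proof -
  have "fst q * cnj (fst q) = 1 + snd q * cnj (snd q)" using of_real_qnorm[of 1 q] q by (simp add: algebra_simps)
  then have "(fst q * cnj (fst q)) * (z - w) = (1 + snd q * cnj (snd q)) * (z - w)" by simp
  then have "(fst q * z + snd q) * cnj (J q w) - (fst q * w + snd q) * cnj (J q z) = z - w"
    by (simp add: J_def algebra_simps)
  then show ?thesis using J_nz assms by (simp add: mob_def field_simps)
qed

end

lemma J_mult: "qnorm 1 r = 1 \<Longrightarrow> z \<in> disc \<Longrightarrow> J (qmul 1 q r) z = J q (mob r z) * J r z"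
  using J_nz[of r z] by (simp add: mob_def J_def qmul_def field_simps)

lemma mob_mult:
  assumes "qnorm 1 q = 1" "qnorm 1 r = 1" "z \<in> disc"
  shows "mob (qmul 1 q r) z = mob q (mob r z)"
proof -
  have "mob q (mob r z) = (fst q * mob r z + snd q) * cnj (J r z) / cnj (J (qmul 1 q r) z)"
    using J_nz[OF assms(2,3)] J_mult[OF assms(2,3), of q] by (simp add: mob_def)
  also have "(fst q * mob r z + snd q) * cnj (J r z) = fst (qmul 1 q r) * z + snd (qmul 1 q r)"
    using J_nz[OF assms(2,3)] by (simp add: mob_def field_simps) (simp add: J_def qmul_def algebra_simps)
  finally show ?thesis by (simp add: mob_def)
qed

text \<open>Both sides are arguments of \<open>J (qmul 1 q r) z\<close>, by the chain rule for
  \<open>J\<close>. They differ by a combination of four values of \<open>tau\<close>, each below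
  \<open>pi / 2\<close> in size, so they agree.\<close>

lemma inc_cocycle:
  assumes q: "qnorm 1 q = 1" "polar (fst q) \<theta>" and r: "qnorm 1 r = 1" "polar (fst r) \<eta>"
    and z: "z \<in> disc"
  shows "polar (fst (qmul 1 q r)) (\<eta> + inc \<theta> q (mob r 0))"
    and "inc (\<eta> + inc \<theta> q (mob r 0)) (qmul 1 q r) z = inc \<theta> q (mob r z) + inc \<eta> r z"
proof -
  have qr: "qnorm 1 (qmul 1 q r) = 1" using q r by (simp add: qnorm_mult)
  have 0: "0 \<in> disc" by simp
  have J0: "J p 0 = fst p" for p by (simp add: J_def)
  have "polar (J q (mob r 0) * J r 0) (inc \<theta> q (mob r 0) + \<eta>)"
    using r(2) by (intro polar_mult polar_inc q) (simp add: J0)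
  then show p: "polar (fst (qmul 1 q r)) (\<eta> + inc \<theta> q (mob r 0))"
    using J_mult[OF r(1) 0, of q] by (simp add: J0 add.commute)
  show "inc (\<eta> + inc \<theta> q (mob r 0)) (qmul 1 q r) z = inc \<theta> q (mob r z) + inc \<eta> r z"
  proof (rule polar_unique)
    show "polar (J (qmul 1 q r) z) (inc (\<eta> + inc \<theta> q (mob r 0)) (qmul 1 q r) z)"
      by (rule polar_inc[OF qr p])
    show "polar (J (qmul 1 q r) z) (inc \<theta> q (mob r z) + inc \<eta> r z)"
      unfolding J_mult[OF r(1) z] by (intro polar_mult polar_inc q r)
    show "J (qmul 1 q r) z \<noteq> 0" by (rule J_nz[OF qr z])
    have "\<bar>tau (snd q / fst q * cnj (mob r 0))\<bar> < pi / 2"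
      "\<bar>tau (snd q / fst q * cnj (mob r z))\<bar> < pi / 2"
      "\<bar>tau (snd r / fst r * cnj z)\<bar> < pi / 2"
      "\<bar>tau (snd (qmul 1 q r) / fst (qmul 1 q r) * cnj z)\<bar> < pi / 2"
      using ratio_mult_less mob_closed q r qr z 0 by (intro tau_bound; blast)+
    then show "\<bar>inc (\<eta> + inc \<theta> q (mob r 0)) (qmul 1 q r) z - (inc \<theta> q (mob r z) + inc \<eta> r z)\<bar> < 2 * pi"
      unfolding inc_def by linarith
  qed
qed

text \<open>Elements of the ambient group: a lift \<open>\<theta>\<close> of the argument of \<open>a\<close>, where \<open>Q 1 = (a, b)\<close> lies in
  \<open>SU(1,1)\<close>, together with two components in \<open>SU(2)\<close>.\<close>

definition sig :: "3 \<Rightarrow> real" where "sig k = (if k = 1 then 1 else - 1)"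

definition lifted :: "(real \<times> (3 \<Rightarrow> quat)) monoid" where
  "lifted = \<lparr>carrier = {(\<theta>, Q). (\<forall>k. qnorm (sig k) (Q k) = 1) \<and> polar (fst (Q 1)) \<theta>},
    mult = (\<lambda>(\<theta>, Q) (\<eta>, R). (\<eta> + inc \<theta> (Q 1) (mob (R 1) 0), \<lambda>k. qmul (sig k) (Q k) (R k))),
    one = (0, \<lambda>k. qone)\<rparr>"

lemma lifted_simps:
  "(\<theta>, Q) \<in> carrier lifted \<longleftrightarrow> (\<forall>k. qnorm (sig k) (Q k) = 1) \<and> polar (fst (Q 1)) \<theta>"
  "(\<theta>, Q) \<otimes>\<^bsub>lifted\<^esub> (\<eta>, R) = (\<eta> + inc \<theta> (Q 1) (mob (R 1) 0), \<lambda>k. qmul (sig k) (Q k) (R k))"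
  "\<one>\<^bsub>lifted\<^esub> = (0, \<lambda>k. qone)"
  by (simp_all add: lifted_def)

lemma snd_lifted_mult: "snd (x \<otimes>\<^bsub>lifted\<^esub> y) = (\<lambda>k. qmul (sig k) (snd x k) (snd y k))"
  by (cases x; cases y) (simp add: lifted_simps)

lemma sig_1 [simp]: "sig 1 = 1" by (simp add: sig_def)

lemma lifted_norm: "(\<theta>, Q) \<in> carrier lifted \<Longrightarrow> qnorm 1 (Q 1) = 1"
  unfolding lifted_simps by (metis sig_1)

lemma inc_one [simp]: "inc \<theta> qone z = \<theta>" and mob_one [simp]: "mob qone z = z"
  by (simp_all add: inc_def qone_def mob_def J_def)

text \<open>Associativity of the angles is the cocycle identity for \<open>inc\<close>, taken at the
  image of 0. The inverse negates the angle: the correction term is \<open>tau\<close> of a real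
  number, hence zero.\<close>

lemma group_lifted: "group lifted"
proof (rule groupI)
  show "\<one>\<^bsub>lifted\<^esub> \<in> carrier lifted"
    by (simp add: lifted_simps qone_def[symmetric]) (simp add: qone_def polar_one)
next
  fix x y assume "x \<in> carrier lifted" "y \<in> carrier lifted"
  then show "x \<otimes>\<^bsub>lifted\<^esub> y \<in> carrier lifted"
    using inc_cocycle(1)[of "snd x 1" "fst x" "snd y 1" "fst y" 0] lifted_norm[of "fst x" "snd x"] lifted_norm[of "fst y" "snd y"]
    by (cases x; cases y) (simp add: lifted_simps qnorm_mult)
next
  fix x y z assume xyz: "x \<in> carrier lifted" "y \<in> carrier lifted" "z \<in> carrier lifted"
  obtain \<theta> Q \<eta> R \<zeta> T where e: "x = (\<theta>, Q)" "y = (\<eta>, R)" "z = (\<zeta>, T)" by (metis surj_pair)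
  have n: "qnorm 1 (Q 1) = 1" "qnorm 1 (R 1) = 1" "qnorm 1 (T 1) = 1"
    using xyz lifted_norm e by auto
  have p: "polar (fst (Q 1)) \<theta>" "polar (fst (R 1)) \<eta>" using xyz e by (auto simp: lifted_simps)
  have "mob (T 1) 0 \<in> disc" using n by (intro mob_closed) auto
  from inc_cocycle(2)[OF n(1) p(1) n(2) p(2) this]
  show "x \<otimes>\<^bsub>lifted\<^esub> y \<otimes>\<^bsub>lifted\<^esub> z = x \<otimes>\<^bsub>lifted\<^esub> (y \<otimes>\<^bsub>lifted\<^esub> z)"
    using mob_mult[OF n(2,3), of 0] by (simp add: e lifted_simps qmul_assoc)
next
  fix x assume "x \<in> carrier lifted"
  then show "\<one>\<^bsub>lifted\<^esub> \<otimes>\<^bsub>lifted\<^esub> x = x" by (cases x) (simp add: lifted_simps)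
next
  fix x assume x: "x \<in> carrier lifted"
  obtain \<theta> Q where e: "x = (\<theta>, Q)" by (metis surj_pair)
  have n: "qnorm 1 (Q 1) = 1" using x lifted_norm e by auto
  let ?y = "(- \<theta>, \<lambda>k. qconj (Q k))"
  have "?y \<in> carrier lifted" using x by (auto simp: e lifted_simps qconj_def[of "Q 1"] intro: polar_cnj)
  moreover have "?y \<otimes>\<^bsub>lifted\<^esub> x = \<one>\<^bsub>lifted\<^esub>"
  proof -
    let ?u = "snd (Q 1) / fst (Q 1)"
    have "snd (qconj (Q 1)) / fst (qconj (Q 1)) * cnj (mob (Q 1) 0) = - (cnj ?u * ?u)"
      using fst_nz[OF n] by (simp add: qconj_def mob_def J_def field_simps)
    also have "\<dots> = of_real (- (cmod ?u)\<^sup>2)" by (simp add: complex_norm_square mult.commute flip: of_real_power)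
    finally have "tau (snd (qconj (Q 1)) / fst (qconj (Q 1)) * cnj (mob (Q 1) 0)) = 0"
      using ratio_less[OF n] tau_of_real[of "- (cmod ?u)\<^sup>2"] by (simp add: abs_square_less_1 del: of_real_minus)
    then show ?thesis using x by (simp add: e lifted_simps inc_def qmul_conj)
  qed
  ultimately show "\<exists>y\<in>carrier lifted. y \<otimes>\<^bsub>lifted\<^esub> x = \<one>\<^bsub>lifted\<^esub>" by blast
qed

section \<open>The action on the product of two discs and a line\<close>

text \<open>The square of sinh (d / 2), where d is the hyperbolic distance for curvature -1.\<close>

definition \<kappa> :: "complex \<Rightarrow> complex \<Rightarrow> real" where
  "\<kappa> z w = (cmod (z - w))\<^sup>2 / ((1 - (cmod z)\<^sup>2) * (1 - (cmod w)\<^sup>2))"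

lemma disc_pos: "z \<in> disc \<Longrightarrow> 1 - (cmod z)\<^sup>2 > 0"
  by (simp add: abs_square_less_1)

lemma \<kappa>_nonneg: "z \<in> disc \<Longrightarrow> w \<in> disc \<Longrightarrow> \<kappa> z w \<ge> 0"
  unfolding \<kappa>_def by (intro divide_nonneg_nonneg mult_nonneg_nonneg) (use disc_pos in \<open>auto simp: less_imp_le\<close>)

lemma \<kappa>_eq_0: "z \<in> disc \<Longrightarrow> w \<in> disc \<Longrightarrow> \<kappa> z w = 0 \<longleftrightarrow> z = w"
  using disc_pos[of z] disc_pos[of w] by (simp add: \<kappa>_def)

lemma \<kappa>_mob:
  assumes q: "qnorm 1 q = 1" and z: "z \<in> disc" "w \<in> disc"
  shows "\<kappa> (mob q z) (mob q w) = \<kappa> z w"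
proof -
  have "(cmod (mob q z - mob q w))\<^sup>2 = (cmod (z - w))\<^sup>2 / ((cmod (J q z))\<^sup>2 * (cmod (J q w))\<^sup>2)"
    using mob_diff[OF q z] by (simp add: norm_divide norm_mult power_divide power_mult_distrib)
  then show ?thesis
    using J_nz[OF q] z disc_pos by (simp add: \<kappa>_def one_minus_mob_norm[OF q] field_simps)
qed

text \<open>For \<open>t = cmod w\<close> beyond the bound, the hypothesis gives
  \<open>(t - r)\<^sup>2 < 1 - t\<^sup>2\<close>. The explicit radius is at least the larger root of
  this quadratic and still below 1.\<close>

lemma \<kappa>_bounded:
  assumes z: "cmod z \<le> r" "r < 1" and w: "w \<in> disc" "\<kappa> z w < 1"
  shows "cmod w \<le> 1 - (1 - r)\<^sup>2 / 4"
proof (rule ccontr)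
  define t R where "t = cmod w" and "R = 1 - (1 - r)\<^sup>2 / 4"
  assume "\<not> ?thesis"
  then have tR: "t > R" by (simp add: t_def R_def)
  have r0: "r \<ge> 0" using z norm_ge_zero[of z] by linarith
  have zd: "z \<in> disc" using z by simp
  have "(cmod (z - w))\<^sup>2 < (1 - (cmod z)\<^sup>2) * (1 - t\<^sup>2)"
    using w(2) mult_pos_pos[OF disc_pos[OF zd] disc_pos[OF w(1)]]
    unfolding \<kappa>_def t_def by (simp only: divide_less_eq_1_pos)
  also have "\<dots> \<le> 1 * (1 - t\<^sup>2)"
    using disc_pos[OF w(1)] by (intro mult_right_mono) (auto simp: t_def)
  finally have a: "(cmod (z - w))\<^sup>2 < 1 - t\<^sup>2" by simp
  define e where "e = (1 - r)\<^sup>2"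
  have "(1 - r) * (1 - r) \<le> 1 * (1 - r)" using z r0 by (intro mult_right_mono) auto
  then have "e \<le> 1 - r" by (simp only: e_def power2_eq_square mult_1)
  then have Rr: "R \<ge> r" unfolding R_def e_def[symmetric] using z(2) by linarith
  have "t - r \<le> cmod (z - w)" using norm_triangle_ineq2[of w z] z by (simp add: t_def norm_minus_commute)
  then have "(t - r)\<^sup>2 \<le> (cmod (z - w))\<^sup>2" using tR Rr by (intro power_mono) auto
  then have "(t - r)\<^sup>2 < 1 - t\<^sup>2" using a by linarith
  then have b: "2 * t\<^sup>2 - 2 * r * t + r\<^sup>2 - 1 < 0" by (simp add: power2_eq_square algebra_simps)
  have "(t - R) * (2 * (t + R) - 2 * r) > 0" using tR Rr r0 by (intro mult_pos_pos) auto
  then have "2 * t\<^sup>2 - 2 * r * t > 2 * R\<^sup>2 - 2 * r * R" by (simp add: algebra_simps power2_eq_square)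
  moreover have "2 * R\<^sup>2 - 2 * r * R + r\<^sup>2 - 1 \<ge> 0"
  proof -
    define d where "d = (1 - r)\<^sup>2 / 4"
    have "2 * R\<^sup>2 - 2 * r * R + r\<^sup>2 - 1 = 2 * r * d + 2 * d\<^sup>2"
      by (simp add: R_def d_def[symmetric] power2_eq_square algebra_simps)
        (simp add: d_def power2_eq_square field_simps)
    also have "\<dots> \<ge> 0" using r0 by (simp add: d_def)
    finally show ?thesis .
  qed
  ultimately show False using b by linarith
qed

text \<open>Taking arguments in \<open>one_minus_mob\<close> gives the identity modulo
  \<open>2 * pi\<close>; four terms below \<open>pi / 2\<close> in size leave no room for a nonzero
  multiple.\<close>

lemma tau_mob:
  assumes q: "qnorm 1 q = 1" "polar (fst q) \<theta>" and z: "z \<in> disc" "w \<in> disc"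
  shows "tau (- (mob q z * cnj (mob q w))) = tau (- (z * cnj w)) + inc \<theta> q z - inc \<theta> q w"
proof -
  have less: "cmod (- (u * cnj v)) < 1" if "u \<in> disc" "v \<in> disc" for u v
    using that mult_strict_mono'[of "cmod u" 1 "cmod v" 1] by (simp add: norm_mult)
  have "(1 - mob q z * cnj (mob q w)) * (cnj (J q z) * J q w) = 1 - z * cnj w"
    using one_minus_mob[OF q(1) z] J_nz[OF q(1)] z by simp
  moreover have "polar ((1 + - (mob q z * cnj (mob q w))) * (cnj (J q z) * J q w))
      (tau (- (mob q z * cnj (mob q w))) + (- inc \<theta> q z + inc \<theta> q w))"
    by (intro polar_mult polar_tau polar_cnj polar_inc q)
  ultimately have "polar (1 + - (z * cnj w)) (tau (- (mob q z * cnj (mob q w))) + (- inc \<theta> q z + inc \<theta> q w))"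
    by simp
  have nz: "1 + - (z * cnj w) \<noteq> 0"
    using Re_one_plus_pos[OF less[OF z]] by (metis less_irrefl zero_complex.simps(1))
  from polar_unique[OF \<open>polar (1 + - (z * cnj w)) _\<close> polar_tau]
  have "tau (- (mob q z * cnj (mob q w))) + (- inc \<theta> q z + inc \<theta> q w) = tau (- (z * cnj w))"
    if "\<bar>tau (- (mob q z * cnj (mob q w))) + (- inc \<theta> q z + inc \<theta> q w) - tau (- (z * cnj w))\<bar> < 2 * pi"
    using that nz by simp
  moreover have "\<bar>tau (- (mob q z * cnj (mob q w)))\<bar> < pi / 2" "\<bar>tau (- (z * cnj w))\<bar> < pi / 2"
    using less mob_closed[OF q(1)] z by (intro tau_bound; blast)+
  moreover have "\<bar>inc \<theta> q z - \<theta>\<bar> < pi / 2" "\<bar>inc \<theta> q w - \<theta>\<bar> < pi / 2"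
    using tau_bound[OF ratio_mult_less[OF q(1)]] z by (simp_all add: inc_def)
  ultimately show ?thesis by linarith
qed

definition Y :: "(complex \<times> real \<times> complex) set" where "Y = disc \<times> UNIV \<times> disc"

text \<open>The summand \<open>tau\<close> makes the comparison of the real coordinates invariant, since
  \<open>1 - z w\<^sup>*\<close> is multiplied by the automorphy factors of both points.\<close>

definition \<rho> :: "complex \<times> real \<times> complex \<Rightarrow> complex \<times> real \<times> complex \<Rightarrow> real" where
  "\<rho> y y' = \<kappa> (fst y) (fst y') + \<bar>fst (snd y) - fst (snd y') - tau (- (fst y * cnj (fst y')))\<bar>
    + \<kappa> (snd (snd y)) (snd (snd y'))"

type_synonym lifted_elt = "real \<times> (3 \<Rightarrow> quat)"

text \<open>Sending an element of the universal cover with matrix \<open>q\<close> and angle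
  \<open>\<theta>\<close> to \<open>(mob q 0, \<theta>)\<close> identifies the cover with disc times
  line, and left multiplication becomes the action on the first two coordinates. The second factor
  acts on the last disc through its matrix.\<close>

definition act :: "lifted_elt \<times> lifted_elt \<Rightarrow> complex \<times> real \<times> complex \<Rightarrow> complex \<times> real \<times> complex" where
  "act g y = (mob (snd (fst g) 1) (fst y),
    fst (snd y) + inc (fst (fst g)) (snd (fst g) 1) (fst y), mob (snd (snd g) 1) (snd (snd y)))"

lemma open_Y: "open Y" and convex_Y: "convex Y" and Y_nonempty: "Y \<noteq> {}"
  unfolding Y_def by (auto intro!: open_Times convex_Times)

lemma lifted_elt:
  assumes "g \<in> carrier lifted"
  shows "qnorm 1 (snd g 1) = 1" "polar (fst (snd g 1)) (fst g)"
  using assms lifted_norm[of "fst g" "snd g"] lifted_simps(1)[of "fst g" "snd g"] by auto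

lemma act_closed: "g \<in> carrier (lifted \<times>\<times> lifted) \<Longrightarrow> y \<in> Y \<Longrightarrow> act g y \<in> Y"
  using mob_closed[OF lifted_elt(1)[of "fst g"], of "fst y"]
    mob_closed[OF lifted_elt(1)[of "snd g"], of "snd (snd y)"]
  by (auto simp: act_def Y_def mem_Times_iff)

lemma act_mult:
  assumes "g \<in> carrier (lifted \<times>\<times> lifted)" "h \<in> carrier (lifted \<times>\<times> lifted)" "y \<in> Y"
  shows "act (g \<otimes>\<^bsub>lifted \<times>\<times> lifted\<^esub> h) y = act g (act h y)"
proof -
  obtain \<theta> Q \<theta>' Q' \<eta> R \<eta>' R' z s w where e: "g = ((\<theta>, Q), (\<theta>', Q'))" "h = ((\<eta>, R), (\<eta>', R'))" "y = (z, s, w)"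
    by (metis surj_pair)
  have c: "(\<theta>, Q) \<in> carrier lifted" "(\<theta>', Q') \<in> carrier lifted" "(\<eta>, R) \<in> carrier lifted" "(\<eta>', R') \<in> carrier lifted"
    and zw: "z \<in> disc" "w \<in> disc" using assms by (auto simp: e Y_def)
  note n = lifted_elt[OF c(1)] lifted_elt[OF c(2)] lifted_elt[OF c(3)] lifted_elt[OF c(4)]
  show ?thesis
    using inc_cocycle(2)[of "Q 1" \<theta> "R 1" \<eta> z] mob_mult[of "Q 1" "R 1" z] mob_mult[of "Q' 1" "R' 1" w] n zw
    by (simp add: e act_def lifted_simps)
qed

lemma act_one: "act \<one>\<^bsub>lifted \<times>\<times> lifted\<^esub> y = y"
  by (simp add: act_def lifted_simps)

lemma continuous_on_mob:
  assumes "qnorm 1 q = 1" "continuous_on S f" "f ` S \<subseteq> disc"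
  shows "continuous_on S (\<lambda>x. mob q (f x))"
proof -
  have nz: "cnj (J q (f x)) \<noteq> 0" if "x \<in> S" for x
    using J_nz[OF assms(1), of "f x"] that assms(3) by auto
  have "continuous_on S (\<lambda>x. cnj (J q (f x)))"
    unfolding J_def by (intro continuous_intros assms)
  then show ?thesis unfolding mob_def using nz
    by (intro continuous_on_divide continuous_on_add continuous_on_mult continuous_on_const assms(2)) auto
qed

lemma continuous_on_inc:
  assumes "qnorm 1 q = 1" "continuous_on S f" "f ` S \<subseteq> disc"
  shows "continuous_on S (\<lambda>x. inc \<theta> q (f x))"
  unfolding inc_def using ratio_mult_less[OF assms(1)] assms(2,3)
  by (intro continuous_intros) (auto simp: image_subset_iff)

lemma act_cont: "g \<in> carrier (lifted \<times>\<times> lifted) \<Longrightarrow> continuous_on Y (act g)"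
  unfolding act_def
  by (intro continuous_on_Pair continuous_on_add continuous_on_mob continuous_on_inc
      continuous_on_fst continuous_on_snd continuous_on_id lifted_elt)
    (auto simp: Y_def)

lemma \<rho>_inv:
  assumes "g \<in> carrier (lifted \<times>\<times> lifted)" "y \<in> Y" "y' \<in> Y"
  shows "\<rho> (act g y) (act g y') = \<rho> y y'"
proof -
  have c: "fst g \<in> carrier lifted" "snd g \<in> carrier lifted"
    and d: "fst y \<in> disc" "fst y' \<in> disc" "snd (snd y) \<in> disc" "snd (snd y') \<in> disc"
    using assms by (auto simp: Y_def)
  show ?thesis
    using tau_mob[OF lifted_elt[OF c(1)] d(1,2)] \<kappa>_mob[OF lifted_elt(1)[OF c(1)] d(1,2)]
      \<kappa>_mob[OF lifted_elt(1)[OF c(2)] d(3,4)] by (simp add: \<rho>_def act_def)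
qed

lemma \<rho>_nonneg: "y \<in> Y \<Longrightarrow> y' \<in> Y \<Longrightarrow> \<rho> y y' \<ge> 0"
  using \<kappa>_nonneg by (auto simp: \<rho>_def Y_def intro!: add_nonneg_nonneg)

lemma \<rho>_eq_0:
  assumes "y \<in> Y" "y' \<in> Y" shows "\<rho> y y' = 0 \<longleftrightarrow> y = y'"
proof -
  obtain z s w z' s' w' where e: "y = (z, s, w)" "y' = (z', s', w')" by (metis surj_pair)
  have d: "z \<in> disc" "z' \<in> disc" "w \<in> disc" "w' \<in> disc" using assms by (auto simp: e Y_def)
  have "tau (- (z * cnj z)) = 0"
    using tau_of_real[of "- (cmod z)\<^sup>2"] d(1) by (simp add: complex_norm_square abs_square_less_1 flip: of_real_power)
  then show ?thesis
    using \<kappa>_nonneg[OF d(1,2)] \<kappa>_nonneg[OF d(3,4)] \<kappa>_eq_0[OF d(1,2)] \<kappa>_eq_0[OF d(3,4)]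
    by (auto simp: \<rho>_def e add_nonneg_eq_0_iff)
qed

lemma \<rho>_cont: "continuous_on (Y \<times> Y) (\<lambda>(y, y'). \<rho> y y')"
proof -
  have k: "continuous_on (Y \<times> Y) (\<lambda>p. \<kappa> (f p) (g p))"
    if "continuous_on (Y \<times> Y) f" "continuous_on (Y \<times> Y) g" "f ` (Y \<times> Y) \<subseteq> disc" "g ` (Y \<times> Y) \<subseteq> disc"
    for f g :: "_ \<Rightarrow> complex"
  proof -
    have "(1 - (cmod (f p))\<^sup>2) * (1 - (cmod (g p))\<^sup>2) \<noteq> 0" if "p \<in> Y \<times> Y" for p
      using disc_pos[of "f p"] disc_pos[of "g p"] that \<open>f ` _ \<subseteq> _\<close> \<open>g ` _ \<subseteq> _\<close> by force
    then show ?thesis unfolding \<kappa>_def using that(1,2) by (intro continuous_intros) auto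
  qed
  have less: "cmod (- (fst (fst p) * cnj (fst (snd p)))) < 1" if "p \<in> Y \<times> Y" for p
    using that mult_strict_mono'[of "cmod (fst (fst p))" 1 "cmod (fst (snd p))" 1] by (auto simp: norm_mult Y_def)
  show ?thesis
    unfolding \<rho>_def case_prod_unfold using less
    by (intro continuous_on_add k continuous_on_rabs continuous_on_diff continuous_on_tau continuous_on_minus
        continuous_on_mult continuous_on_cnj continuous_on_fst continuous_on_snd continuous_on_id)
      (auto simp: Y_def)
qed

lemma compact_in_Y:
  assumes "compact C" "C \<subseteq> Y"
  obtains r M where "0 \<le> r" "r < 1" "0 \<le> M" "\<And>z s w. (z, s, w) \<in> C \<Longrightarrow> cmod z \<le> r \<and> \<bar>s\<bar> \<le> M \<and> cmod w \<le> r"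
proof (cases "C = {}")
  case True
  then show ?thesis using that[of 0 0] by simp
next
  case False
  have c: "continuous_on C (\<lambda>y. max (cmod (fst y)) (cmod (snd (snd y))))"
    "continuous_on C (\<lambda>y. \<bar>fst (snd y)\<bar>)" by (intro continuous_intros)+
  obtain y where y: "y \<in> C" "\<And>u. u \<in> C \<Longrightarrow> max (cmod (fst u)) (cmod (snd (snd u))) \<le> max (cmod (fst y)) (cmod (snd (snd y)))"
    using continuous_attains_sup[OF assms(1) False c(1)] by blast
  obtain v where v: "v \<in> C" "\<And>u. u \<in> C \<Longrightarrow> \<bar>fst (snd u)\<bar> \<le> \<bar>fst (snd v)\<bar>"
    using continuous_attains_sup[OF assms(1) False c(2)] by blast
  show ?thesis
  proof (rule that)
    show "0 \<le> max (cmod (fst y)) (cmod (snd (snd y)))" by (simp add: le_max_iff_disj)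
    show "max (cmod (fst y)) (cmod (snd (snd y))) < 1" using y(1) assms(2) by (auto simp: Y_def)
    show "cmod z \<le> max (cmod (fst y)) (cmod (snd (snd y))) \<and> \<bar>s\<bar> \<le> \<bar>fst (snd v)\<bar> \<and>
      cmod w \<le> max (cmod (fst y)) (cmod (snd (snd y)))" if "(z, s, w) \<in> C" for z s w
      using y(2)[OF that] v(2)[OF that] by simp
  qed simp
qed

definition box :: "real \<Rightarrow> real \<Rightarrow> (complex \<times> real \<times> complex) set" where
  "box r M = cball 0 r \<times> {-M..M} \<times> cball 0 r"

lemma compact_box: "compact (box r M)" and box_Y: "r < 1 \<Longrightarrow> box r M \<subseteq> Y"
  by (auto simp: box_def Y_def intro!: compact_Times)

lemma \<rho>_bounded:
  assumes "compact C" "C \<subseteq> Y"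
  shows "\<exists>C'. compact C' \<and> C' \<subseteq> Y \<and> (\<forall>y\<in>C. \<forall>y'\<in>Y. \<rho> y y' < 1 \<longrightarrow> y' \<in> C')"
proof -
  obtain r M where r: "0 \<le> r" "r < 1" "0 \<le> M"
    "\<And>z s w. (z, s, w) \<in> C \<Longrightarrow> cmod z \<le> r \<and> \<bar>s\<bar> \<le> M \<and> cmod w \<le> r"
    using compact_in_Y[OF assms] by metis
  let ?R = "1 - (1 - r)\<^sup>2 / 4"
  have inB: "y' \<in> box ?R (M + 1 + pi / 2)" if y: "y \<in> C" "y' \<in> Y" "\<rho> y y' < 1" for y y'
  proof -
    obtain z s w z' s' w' where e: "y = (z, s, w)" "y' = (z', s', w')" by (metis surj_pair)
    have b: "cmod z \<le> r" "\<bar>s\<bar> \<le> M" "cmod w \<le> r" using r(4) y e by auto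
    have d: "z \<in> disc" "w \<in> disc" "z' \<in> disc" "w' \<in> disc"
      using b r(2) y(2) by (auto simp: e Y_def)
    have "\<kappa> z z' < 1" "\<kappa> w w' < 1" "\<bar>s - s' - tau (- (z * cnj z'))\<bar> < 1"
      using y(3) \<kappa>_nonneg[OF d(1,3)] \<kappa>_nonneg[OF d(2,4)] by (simp_all add: \<rho>_def e)
    moreover have "cmod (- (z * cnj z')) < 1"
      using d mult_strict_mono'[of "cmod z" 1 "cmod z'" 1] by (simp add: norm_mult)
    then have "\<bar>tau (- (z * cnj z'))\<bar> < pi / 2" by (rule tau_bound)
    ultimately have "\<bar>s'\<bar> \<le> M + 1 + pi / 2" "cmod z' \<le> ?R" "cmod w' \<le> ?R"
      using b \<kappa>_bounded[OF b(1) r(2) d(3)] \<kappa>_bounded[OF b(3) r(2) d(4)] by (linarith, blast, blast)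
    then show ?thesis by (auto simp: e box_def abs_le_iff)
  qed
  have "?R < 1" using r by simp
  show ?thesis
    by (intro exI[of _ "box ?R (M + 1 + pi / 2)"] conjI ballI impI compact_box box_Y[OF \<open>?R < 1\<close>] inB)
qed

text \<open>\<open>one_minus_mob_norm\<close> bounds \<open>J q z\<close> by
  \<open>1 / sqrt (1 - r\<^sup>2)\<close>, and \<open>J q z\<close> has size at least
  \<open>(1 - r) * cmod (snd q)\<close> since \<open>fst q\<close> is the larger entry. This reduces
  properness to the finiteness of sets of bounded matrices.\<close>

lemma snd_bounded:
  assumes q: "qnorm 1 q = 1" and r: "r < 1" and z: "cmod z \<le> r" "cmod (mob q z) \<le> r"
  shows "cmod (snd q) \<le> 1 / ((1 - r) * sqrt (1 - r\<^sup>2))"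
proof -
  have r0: "0 \<le> r" using z norm_ge_zero[of z] by linarith
  have zd: "z \<in> disc" using z r by simp
  have r2: "1 - r\<^sup>2 > 0" using r r0 by (simp add: abs_square_less_1)
  have "(cmod (mob q z))\<^sup>2 \<le> r\<^sup>2" using z by (intro power_mono) auto
  then have "1 - r\<^sup>2 \<le> (1 - (cmod z)\<^sup>2) / (cmod (J q z))\<^sup>2" using one_minus_mob_norm[OF q zd] by simp
  also have "\<dots> \<le> 1 / (cmod (J q z))\<^sup>2" by (intro divide_right_mono) auto
  finally have "(1 - r\<^sup>2) * (cmod (J q z))\<^sup>2 \<le> 1" using J_nz[OF q zd] by (simp add: field_simps)
  then have "sqrt ((1 - r\<^sup>2) * (cmod (J q z))\<^sup>2) \<le> 1" by simp
  then have J: "sqrt (1 - r\<^sup>2) * cmod (J q z) \<le> 1" by (simp add: real_sqrt_mult)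
  have "cmod (snd q) \<le> cmod (fst q)"
    using ratio_less[OF q] fst_nz[OF q] by (simp add: norm_divide divide_less_eq)
  moreover have "cmod (snd q * cnj z) \<le> cmod (snd q) * r" using z by (simp add: norm_mult mult_left_mono)
  moreover have "cmod (fst q) - cmod (snd q * cnj z) \<le> cmod (J q z)"
    unfolding J_def using norm_diff_ineq[of "fst q" "snd q * cnj z"] by simp
  ultimately have "cmod (snd q) * (1 - r) \<le> cmod (J q z)" by (simp add: algebra_simps)
  then have "sqrt (1 - r\<^sup>2) * (cmod (snd q) * (1 - r)) \<le> sqrt (1 - r\<^sup>2) * cmod (J q z)"
    using r2 by (intro mult_left_mono) auto
  then have "sqrt (1 - r\<^sup>2) * (cmod (snd q) * (1 - r)) \<le> 1" using J by (rule order_trans)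
  moreover have "(1 - r) * sqrt (1 - r\<^sup>2) > 0" using r r2 by simp
  ultimately show ?thesis by (simp add: pos_le_divide_eq mult_ac)
qed

lemma finite_polar: "a \<noteq> 0 \<Longrightarrow> finite {\<theta>. polar a \<theta> \<and> \<bar>\<theta>\<bar> \<le> M}"
proof (cases "{\<theta>. polar a \<theta> \<and> \<bar>\<theta>\<bar> \<le> M} = {}")
  case False
  assume a: "a \<noteq> 0"
  obtain \<theta>0 where t0: "polar a \<theta>0" "\<bar>\<theta>0\<bar> \<le> M" using False by blast
  define m where "m = \<lceil>M\<rceil>"
  have "{\<theta>. polar a \<theta> \<and> \<bar>\<theta>\<bar> \<le> M} \<subseteq> (\<lambda>n :: int. \<theta>0 + n * 2 * pi) ` {-m..m}"
  proof
    fix \<theta> assume t: "\<theta> \<in> {\<theta>. polar a \<theta> \<and> \<bar>\<theta>\<bar> \<le> M}"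
    then have "of_real (cmod a) * cis \<theta> = of_real (cmod a) * cis \<theta>0"
      using t0 unfolding polar_def by (metis (mono_tags, lifting) mem_Collect_eq)
    then have "cis (\<theta> - \<theta>0) = 1" using a by (simp flip: cis_divide)
    then have "cos (\<theta> - \<theta>0) = 1" by (simp add: complex_eq_iff)
    then obtain n :: int where n: "\<theta> - \<theta>0 = n * 2 * pi" by (auto simp: cos_one_2pi_int)
    moreover have "\<bar>\<theta> - \<theta>0\<bar> \<le> M * 2" using t t0 by auto
    ultimately have "\<bar>real_of_int n\<bar> * (2 * pi) \<le> M * 2" by (simp add: abs_mult)
    moreover have "\<bar>real_of_int n\<bar> * 2 \<le> \<bar>real_of_int n\<bar> * (2 * pi)" using pi_gt3 by (intro mult_left_mono) auto
    ultimately have "\<bar>real_of_int n\<bar> \<le> M" by linarith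
    then have "n \<in> {-m..m}" unfolding m_def by (simp add: abs_le_iff) linarith
    then show "\<theta> \<in> (\<lambda>n :: int. \<theta>0 + n * 2 * pi) ` {-m..m}" using n by (intro image_eqI[of _ _ n]) auto
  qed
  then show ?thesis using finite_subset by blast
qed (simp only: finite.emptyI)

text \<open>At a fixed point \<open>J q z\<close> has modulus 1, and the vanishing of
  \<open>inc\<close> makes its argument zero, so \<open>J q z = 1\<close>; this is how the line
  coordinate detects rotations. Two linear equations then force \<open>q\<close> to be the
  identity.\<close>

lemma fixed_point_trivial:
  assumes q: "qnorm 1 q = 1" "polar (fst q) \<theta>" and z: "z \<in> disc" and fixed: "mob q z = z" "inc \<theta> q z = 0"
  shows "q = qone" "\<theta> = 0"
proof -
  have "polar (J q z) 0" using polar_inc[OF q, of z] fixed by simp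
  then have Jc: "J q z = of_real (cmod (J q z))" by (simp add: polar_def)
  have "(cmod (J q z))\<^sup>2 = 1"
  proof -
    have "(1 - (cmod z)\<^sup>2) * (cmod (J q z))\<^sup>2 = (1 - (cmod z)\<^sup>2) * 1"
      using one_minus_mob_norm[OF q(1) z] J_nz[OF q(1) z] unfolding fixed
      by (metis mult.right_neutral nonzero_eq_divide_eq norm_eq_zero power_not_zero)
    then show ?thesis using disc_pos[OF z] by (metis less_irrefl mult_cancel_left)
  qed
  then have J: "J q z = 1" using Jc by (metis norm_ge_zero of_real_1 power2_eq_1_iff abs_of_nonneg abs_minus_cancel abs_one)
  then have 1: "fst q * z + snd q = z" "fst q + snd q * cnj z = 1" using fixed by (simp_all add: mob_def J_def)
  have "snd q * (1 - z * cnj z) = (fst q * z + snd q) - z * (fst q + snd q * cnj z)" by (simp add: algebra_simps)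
  then have "snd q * (1 - z * cnj z) = 0" using 1 by simp
  moreover have "1 - z * cnj z \<noteq> 0"
    using disc_pos[OF z] complex_norm_square[of z] by (metis eq_iff_diff_eq_0 less_irrefl of_real_1 of_real_eq_iff of_real_power)
  ultimately have "snd q = 0" by simp
  then show "q = qone" using 1 by (simp add: qone_def prod_eq_iff)
  then show "\<theta> = 0" using fixed by simp
qed

section \<open>From a perfect lattice to the manifold\<close>

text \<open>\<open>discrete\<close> bounds one entry at the noncompact place and yields finitely
  many triples of matrices. \<open>shift\<close> lies over -1, so it fixes the disc pointwise and
  translates the line by \<open>pi\<close>. \<open>K_free\<close> is stated through matrices, as
  \<open>K\<close> may contain elements that differ from the identity only in their angle.\<close>

locale disc_lattice =
  fixes L K :: "lifted_elt set" and r :: real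
  assumes L: "subgroup L lifted"
    and perfect: "derived (lifted\<lparr>carrier := L\<rparr>) L = L"
    and K: "K \<lhd> lifted\<lparr>carrier := L\<rparr>" "finite (rcosets\<^bsub>lifted\<lparr>carrier := L\<rparr>\<^esub> K)"
    and r: "0 \<le> r" "r < 1"
    and bounded: "z \<in> disc \<Longrightarrow> \<exists>g\<in>L. cmod (mob (snd g 1) z) \<le> r"
    and discrete: "finite {snd g | g. g \<in> L \<and> cmod (snd (snd g 1)) \<le> B}"
    and shift: "\<exists>t\<in>L. fst t = pi \<and> snd t 1 = (-1, 0)"
    and K_free: "k \<in> K \<Longrightarrow> z \<in> disc \<Longrightarrow> mob (snd k 1) z = z \<Longrightarrow> snd k 1 = qone"
begin

sublocale amb: group lifted by (rule group_lifted)

abbreviation LG where "LG \<equiv> lifted\<lparr>carrier := L\<rparr>"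

sublocale LG: group LG by (rule amb.subgroup_imp_group[OF L])

lemma L_sub: "g \<in> L \<Longrightarrow> g \<in> carrier lifted"
  using L subgroup.subset by blast

lemma L_mult: "g \<in> L \<Longrightarrow> h \<in> L \<Longrightarrow> g \<otimes>\<^bsub>lifted\<^esub> h \<in> L" and L_one: "\<one>\<^bsub>lifted\<^esub> \<in> L"
  and L_inv: "g \<in> L \<Longrightarrow> inv\<^bsub>lifted\<^esub> g \<in> L"
  using L by (auto simp: subgroup.m_closed subgroup.one_closed subgroup.m_inv_closed)

lemma inv_LG: "g \<in> L \<Longrightarrow> inv\<^bsub>LG\<^esub> g = inv\<^bsub>lifted\<^esub> g"
  using amb.m_inv_consistent[OF L] by simp

definition act1 :: "lifted_elt \<Rightarrow> complex \<times> real \<times> complex \<Rightarrow> complex \<times> real \<times> complex" where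
  "act1 g = act (g, \<one>\<^bsub>lifted\<^esub>)"

lemma act1: "act1 g (z, s, w) = (mob (snd g 1) z, s + inc (fst g) (snd g 1) z, w)"
  by (simp add: act1_def act_def lifted_simps)

lemma act1_closed: "g \<in> L \<Longrightarrow> y \<in> Y \<Longrightarrow> act1 g y \<in> Y"
  unfolding act1_def using L_sub L_one by (intro act_closed) auto

lemma act1_mult: "g \<in> L \<Longrightarrow> h \<in> L \<Longrightarrow> y \<in> Y \<Longrightarrow> act1 (g \<otimes>\<^bsub>lifted\<^esub> h) y = act1 g (act1 h y)"
  unfolding act1_def using act_mult[of "(g, \<one>\<^bsub>lifted\<^esub>)" "(h, \<one>\<^bsub>lifted\<^esub>)" y] L_sub by simp

lemma act1_inv: "g \<in> L \<Longrightarrow> y \<in> Y \<Longrightarrow> act1 (inv\<^bsub>lifted\<^esub> g) (act1 g y) = y"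
  using act1_mult[of "inv\<^bsub>lifted\<^esub> g" g y] L_inv L_sub act_one by (simp add: act1_def)

lemma shift_nat: "\<exists>l\<in>L. \<forall>z\<in>disc. \<forall>s. \<forall>w\<in>disc. act1 l (z, s, w) = (z, s + real n * pi, w)"
proof (induction n)
  case 0
  show ?case by (intro bexI[OF _ L_one]) (simp add: act1 lifted_simps)
next
  case (Suc n)
  then obtain l where l: "l \<in> L" "\<And>z s w. z \<in> disc \<Longrightarrow> w \<in> disc \<Longrightarrow> act1 l (z, s, w) = (z, s + real n * pi, w)"
    by blast
  obtain t where t: "t \<in> L" "fst t = pi" "snd t 1 = (-1, 0)" using shift by blast
  have "act1 (t \<otimes>\<^bsub>lifted\<^esub> l) (z, s, w) = (z, s + real (Suc n) * pi, w)" if "z \<in> disc" "w \<in> disc" for z s w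
  proof -
    have "act1 (t \<otimes>\<^bsub>lifted\<^esub> l) (z, s, w) = act1 t (act1 l (z, s, w))"
      using that by (intro act1_mult t l) (auto simp: Y_def)
    also have "\<dots> = (z, s + real (Suc n) * pi, w)"
      using t l that by (simp add: act1 mob_def J_def inc_def algebra_simps)
    finally show ?thesis .
  qed
  then show ?case using L_mult[OF t(1) l(1)] by blast
qed

text \<open>Powers of \<open>shift\<close> and their inverses move the line coordinate by multiples
  of \<open>pi\<close>, uniformly in the disc coordinates.\<close>

lemma shift_real:
  obtains l t where "l \<in> L" "\<bar>t\<bar> \<le> pi" "\<And>z w. z \<in> disc \<Longrightarrow> w \<in> disc \<Longrightarrow> act1 l (z, s, w) = (z, t, w)"
proof -
  define n where "n = nat \<lfloor>\<bar>s\<bar> / pi\<rfloor>"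
  have "real n \<le> \<bar>s\<bar> / pi" "\<bar>s\<bar> / pi < real n + 1"
    unfolding n_def by (simp_all add: floor_less_cancel)
  then have n: "real n * pi \<le> \<bar>s\<bar>" "\<bar>s\<bar> < real n * pi + pi" by (simp_all add: field_simps)
  obtain l where l: "l \<in> L" "\<And>z s w. z \<in> disc \<Longrightarrow> w \<in> disc \<Longrightarrow> act1 l (z, s, w) = (z, s + real n * pi, w)"
    using shift_nat by blast
  show thesis
  proof (cases "s \<ge> 0")
    case True
    have "act1 (inv\<^bsub>lifted\<^esub> l) (z, s, w) = (z, s - real n * pi, w)" if "z \<in> disc" "w \<in> disc" for z w
      using act1_inv[OF l(1), of "(z, s - real n * pi, w)"] l(2)[OF that, of "s - real n * pi"] that
      by (simp add: Y_def)
    then show thesis using that[of "inv\<^bsub>lifted\<^esub> l" "s - real n * pi"] L_inv[OF l(1)] n True by simp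
  next
    case False
    then show thesis using that[of l "s + real n * pi"] l n by simp
  qed
qed

lemma L_cocompact:
  assumes "z \<in> disc" "cmod w \<le> r"
  obtains l where "l \<in> L" "act1 l (z, s, w) \<in> box r pi"
proof -
  obtain g where g: "g \<in> L" "cmod (mob (snd g 1) z) \<le> r" using bounded assms by blast
  have d: "mob (snd g 1) z \<in> disc" "w \<in> disc" using assms g(2) r(2) by auto
  obtain l t where l: "l \<in> L" "\<bar>t\<bar> \<le> pi" "\<And>z' w'. z' \<in> disc \<Longrightarrow> w' \<in> disc \<Longrightarrow>
      act1 l (z', s + inc (fst g) (snd g 1) z, w') = (z', t, w')"
    using shift_real[of "s + inc (fst g) (snd g 1) z"] by metis
  have "act1 (l \<otimes>\<^bsub>lifted\<^esub> g) (z, s, w) = act1 l (act1 g (z, s, w))"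
    using assms d by (intro act1_mult l g) (auto simp: Y_def)
  also have "\<dots> = (mob (snd g 1) z, t, w)" using l(3)[OF d] by (simp add: act1)
  also have "\<dots> \<in> box r pi" using g(2) l(2) assms by (auto simp: box_def abs_le_iff)
  finally show thesis by (rule that[OF L_mult[OF l(1) g(1)]])
qed

theorem perfect_manifold:
  "\<exists>X :: (nat \<Rightarrow> real) topology. topspace X \<noteq> {} \<and> closed_manifold 5 X \<and> aspherical X \<and>
    (\<forall>x \<in> topspace X. perfect_group (fundamental_group X x))"
proof -
  obtain H where H: "subgroup H (LG \<times>\<times> LG)" "derived (LG \<times>\<times> LG) H = H"
    "\<And>a b. (a, b) \<in> H \<Longrightarrow> inv\<^bsub>LG\<^esub> a \<otimes>\<^bsub>LG\<^esub> b \<in> K"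
    "\<And>a. a \<in> carrier LG \<Longrightarrow> (a, a) \<in> H"
    "finite (rcosets\<^bsub>LG\<^esub> {k \<in> carrier LG. (k, \<one>\<^bsub>LG\<^esub>) \<in> H})" "{k \<in> carrier LG. (k, \<one>\<^bsub>LG\<^esub>) \<in> H} \<lhd> LG"
    using LG.perfect_in_fibre_square[OF _ K] perfect by auto
  interpret LL: group "LG \<times>\<times> LG" by (rule DirProd_group[OF LG.is_group LG.is_group])
  define GH where "GH = (LG \<times>\<times> LG)\<lparr>carrier := H\<rparr>"
  have GH: "carrier GH = H" "\<one>\<^bsub>GH\<^esub> = \<one>\<^bsub>lifted \<times>\<times> lifted\<^esub>"
    "g \<otimes>\<^bsub>GH\<^esub> h = g \<otimes>\<^bsub>lifted \<times>\<times> lifted\<^esub> h" for g h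
    by (simp_all add: GH_def mult_DirProd')
  have HL: "fst g \<in> L" "snd g \<in> L" if "g \<in> H" for g
    using subgroup.subset[OF H(1)] that by (auto simp: mem_Times_iff)
  have H_car: "g \<in> carrier (lifted \<times>\<times> lifted)" if "g \<in> H" for g
    using HL[OF that] L_sub by (simp add: mem_Times_iff)
  have H_mult: "g \<otimes>\<^bsub>lifted \<times>\<times> lifted\<^esub> h \<in> H" if "g \<in> H" "h \<in> H" for g h
    using subgroup.m_closed[OF H(1) that] by (simp add: mult_DirProd')
  define N where "N = {k \<in> L. (k, \<one>\<^bsub>lifted\<^esub>) \<in> H}"
  have N: "N \<lhd> LG" "finite (rcosets\<^bsub>LG\<^esub> N)" using H(5,6) by (simp_all add: N_def)
  interpret N: normal N LG by (rule N(1))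
  \<comment> \<open>Finitely many coset representatives of \<open>N\<close>, the part of
    \<open>L\<close> that can move the first two coordinates while the last one is kept
    fixed.\<close>
  define F where "F = (\<lambda>C. SOME x. x \<in> C) ` (rcosets\<^bsub>LG\<^esub> N)"
  have finF: "finite F" using N(2) by (simp add: F_def)
  have factor: "\<exists>f\<in>F \<inter> L. \<exists>n\<in>N. l = f \<otimes>\<^bsub>lifted\<^esub> n" if l: "l \<in> L" for l
  proof -
    define f where "f = (SOME x. x \<in> N #>\<^bsub>LG\<^esub> l)"
    have lc: "l \<in> carrier LG" using l by simp
    have "f \<in> N #>\<^bsub>LG\<^esub> l"
      unfolding f_def using LG.rcos_self[OF lc N.subgroup_axioms] by (rule someI)
    then obtain m where m: "m \<in> N" "f = m \<otimes>\<^bsub>LG\<^esub> l" by (auto simp: r_coset_def)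
    have mc: "m \<in> carrier LG" using m N.mem_carrier by blast
    have fc: "f \<in> carrier LG" using m mc lc LG.m_closed by metis
    define n where "n = inv\<^bsub>LG\<^esub> f \<otimes>\<^bsub>LG\<^esub> inv\<^bsub>LG\<^esub> m \<otimes>\<^bsub>LG\<^esub> f"
    have nN: "n \<in> N" unfolding n_def using N.inv_op_closed1[OF fc, of "inv\<^bsub>LG\<^esub> m"] m by simp
    have "f \<otimes>\<^bsub>LG\<^esub> n = inv\<^bsub>LG\<^esub> m \<otimes>\<^bsub>LG\<^esub> f"
      unfolding n_def using mc fc by (simp only: LG.group_normalize LG.inv_closed LG.m_closed)
    also have "\<dots> = l" unfolding m(2) using mc lc by (simp only: LG.inv_cancel_left)
    finally have eq: "l = f \<otimes>\<^bsub>lifted\<^esub> n" by simp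
    have "f \<in> F" unfolding F_def f_def using LG.rcosetsI[OF N.subset lc] by blast
    moreover have "f \<in> L" using fc by simp
    ultimately show ?thesis using nN eq by blast
  qed
  interpret PA: proper_action GH act Y \<rho>
  proof (intro proper_action.intro proper_action_axioms.intro continuous_action.intro
      continuous_action_axioms.intro)
    show "group GH" unfolding GH_def by (rule LL.subgroup_imp_group[OF H(1)])
  next
    fix g y assume "g \<in> carrier GH" "y \<in> Y"
    then show "act g y \<in> Y" using act_closed H_car GH by simp
  next
    fix g h y assume "g \<in> carrier GH" "h \<in> carrier GH" "y \<in> Y"
    then show "act (g \<otimes>\<^bsub>GH\<^esub> h) y = act g (act h y)" using act_mult H_car GH by simp
  next
    fix y show "act \<one>\<^bsub>GH\<^esub> y = y" using act_one GH(2) by simp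
  next
    fix g assume "g \<in> carrier GH"
    then show "continuous_on Y (act g)" using act_cont H_car GH by simp
  next
    show "open Y" "convex Y" "Y \<noteq> {}" "continuous_on (Y \<times> Y) (\<lambda>(y, y'). \<rho> y y')"
      by (rule open_Y convex_Y Y_nonempty \<rho>_cont)+
  next
    fix g y y' assume "g \<in> carrier GH" "y \<in> Y" "y' \<in> Y"
    then show "\<rho> (act g y) (act g y') = \<rho> y y'" using \<rho>_inv H_car GH by simp
  next
    fix y y' assume "y \<in> Y" "y' \<in> Y"
    then show "0 \<le> \<rho> y y'" "\<rho> y y' = 0 \<longleftrightarrow> y = y'" by (rule \<rho>_nonneg, intro \<rho>_eq_0)
  next
    fix C :: "(complex \<times> real \<times> complex) set" assume C: "compact C" "C \<subseteq> Y"
    show "\<exists>C'. compact C' \<and> C' \<subseteq> Y \<and> (\<forall>y\<in>C. \<forall>y'\<in>Y. \<rho> y y' < 1 \<longrightarrow> y' \<in> C')"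
      by (rule \<rho>_bounded[OF C])
    obtain R M where R: "0 \<le> R" "R < 1" "0 \<le> M"
      "\<And>z s w. (z, s, w) \<in> C \<Longrightarrow> cmod z \<le> R \<and> \<bar>s\<bar> \<le> M \<and> cmod w \<le> R"
      using compact_in_Y[OF C] by metis
    define B where "B = 1 / ((1 - R) * sqrt (1 - R\<^sup>2))"
    define \<Q> where "\<Q> = {snd g | g. g \<in> L \<and> cmod (snd (snd g 1)) \<le> B}"
    \<comment> \<open>Data that determine the induced map. \<open>act\<close> reads the second
      component through its matrix, so the angle there gets the default value \<open>0\<close>. The
      bound \<open>2 * M + pi / 2\<close> comes from two real coordinates and one value of
      \<open>tau\<close>.\<close>
    define S where "S = (SIGMA Q:\<Q>. {\<theta>. polar (fst (Q 1)) \<theta> \<and> \<bar>\<theta>\<bar> \<le> 2 * M + pi / 2}) \<times> \<Q>"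
    have "finite \<Q>" unfolding \<Q>_def by (rule discrete)
    moreover have "fst (Q 1) \<noteq> 0" if "Q \<in> \<Q>" for Q
      using that fst_nz lifted_elt(1) L_sub unfolding \<Q>_def by blast
    ultimately have "finite S" unfolding S_def by (intro finite_cartesian_product finite_SigmaI finite_polar) auto
    moreover have "(\<lambda>g. restrict (act g) Y) ` {g \<in> carrier GH. act g ` C \<inter> C \<noteq> {}}
        \<subseteq> (\<lambda>((Q, \<theta>), R). restrict (act ((\<theta>, Q), (0, R))) Y) ` S"
    proof
      fix f assume "f \<in> (\<lambda>g. restrict (act g) Y) ` {g \<in> carrier GH. act g ` C \<inter> C \<noteq> {}}"
      then obtain g u where g: "g \<in> H" "f = restrict (act g) Y" "u \<in> C" "act g u \<in> C" using GH(1) by blast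
      obtain \<theta> Q \<eta> T where e: "g = ((\<theta>, Q), (\<eta>, T))" by (metis surj_pair)
      obtain z s w where u: "u = (z, s, w)" by (metis surj_pair)
      have gL: "(\<theta>, Q) \<in> L" "(\<eta>, T) \<in> L" using HL[OF g(1)] e by auto
      note n = lifted_elt[OF L_sub[OF gL(1)]] lifted_elt(1)[OF L_sub[OF gL(2)]]
      have a: "act g u = (mob (Q 1) z, s + inc \<theta> (Q 1) z, mob (T 1) w)" by (simp add: e u act_def)
      have b: "cmod z \<le> R" "\<bar>s\<bar> \<le> M" "cmod w \<le> R" "cmod (mob (Q 1) z) \<le> R"
        "\<bar>s + inc \<theta> (Q 1) z\<bar> \<le> M" "cmod (mob (T 1) w) \<le> R"
        using R(4)[of z s w] R(4)[of "mob (Q 1) z" "s + inc \<theta> (Q 1) z" "mob (T 1) w"] g(3,4) a u by auto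
      have "cmod (snd (Q 1)) \<le> B" "cmod (snd (T 1)) \<le> B"
        unfolding B_def using snd_bounded[of "Q 1" R z] snd_bounded[of "T 1" R w] n b R(2) by auto
      then have QT: "Q \<in> \<Q>" "T \<in> \<Q>" unfolding \<Q>_def using gL by force+
      have "z \<in> disc" using b(1) R(2) by simp
      then have "\<bar>tau (snd (Q 1) / fst (Q 1) * cnj z)\<bar> < pi / 2"
        using n by (intro tau_bound ratio_mult_less) auto
      then have "\<bar>\<theta>\<bar> \<le> 2 * M + pi / 2" using b(2,5) unfolding inc_def by linarith
      then have "((Q, \<theta>), T) \<in> S" using QT n by (simp add: S_def)
      moreover have "f = (\<lambda>((Q, \<theta>), R). restrict (act ((\<theta>, Q), (0, R))) Y) ((Q, \<theta>), T)"
        by (simp add: g(2) e act_def fun_eq_iff restrict_def)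
      ultimately show "f \<in> (\<lambda>((Q, \<theta>), R). restrict (act ((\<theta>, Q), (0, R))) Y) ` S" by (rule rev_image_eqI)
    qed
    ultimately show "finite ((\<lambda>g. restrict (act g) Y) ` {g \<in> carrier GH. act g ` C \<inter> C \<noteq> {}})"
      by (rule finite_surj)
  next
    define C where "C = (\<Union>f\<in>F \<inter> L. act1 (inv\<^bsub>lifted\<^esub> f) ` box r pi)"
    have "compact (act1 (inv\<^bsub>lifted\<^esub> f) ` box r pi)" if "f \<in> L" for f
    proof (rule compact_continuous_image[OF _ compact_box])
      have "continuous_on Y (act1 (inv\<^bsub>lifted\<^esub> f))"
        unfolding act1_def using L_sub[OF L_inv[OF that]] by (intro act_cont) simp
      then show "continuous_on (box r pi) (act1 (inv\<^bsub>lifted\<^esub> f))"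
        using box_Y[OF r(2)] continuous_on_subset by blast
    qed
    then have "compact C" unfolding C_def using finF by (intro compact_UN) auto
    moreover have "C \<subseteq> Y" unfolding C_def using act1_closed[OF L_inv] box_Y[OF r(2)] by blast
    moreover have "\<exists>g\<in>carrier GH. act g y \<in> C" if y: "y \<in> Y" for y
    proof -
      obtain z s w where e: "y = (z, s, w)" by (metis surj_pair)
      have zw: "z \<in> disc" "w \<in> disc" using y by (auto simp: e Y_def)
      \<comment> \<open>A diagonal element first brings the last disc coordinate into the ball;
        elements \<open>(n, \<one>)\<close> of \<open>H\<close> then adjust the other two without
        disturbing it.\<close>
      obtain b where b: "b \<in> L" "cmod (mob (snd b 1) w) \<le> r" using bounded zw by blast
      have bb: "(b, b) \<in> H" using H(4) b by simp
      define y1 where "y1 = act (b, b) y"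
      have y1Y: "y1 \<in> Y" unfolding y1_def by (rule act_closed[OF H_car[OF bb] y])
      obtain z1 s1 w1 where e1: "y1 = (z1, s1, w1)" by (metis surj_pair)
      have z1: "z1 \<in> disc" "cmod w1 \<le> r"
        using y1Y b(2) e1 by (auto simp: y1_def e act_def Y_def)
      obtain l where l: "l \<in> L" "act1 l y1 \<in> box r pi" using L_cocompact[OF z1] e1 by metis
      obtain f n where fn: "f \<in> F \<inter> L" "n \<in> N" "l = f \<otimes>\<^bsub>lifted\<^esub> n" using factor l by blast
      have nL: "n \<in> L" "(n, \<one>\<^bsub>lifted\<^esub>) \<in> H" using fn by (auto simp: N_def)
      have "act1 n y1 = act1 (inv\<^bsub>lifted\<^esub> f) (act1 l y1)"
        using fn nL y1Y by (simp add: act1_mult act1_inv act1_closed)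
      then have "act1 n y1 \<in> C" using fn l unfolding C_def by blast
      moreover have "act ((n, \<one>\<^bsub>lifted\<^esub>) \<otimes>\<^bsub>lifted \<times>\<times> lifted\<^esub> (b, b)) y = act1 n y1"
        unfolding act1_def y1_def by (rule act_mult[OF H_car[OF nL(2)] H_car[OF bb] y])
      ultimately show ?thesis using H_mult[OF nL(2) bb] GH(1) by metis
    qed
    ultimately show "\<exists>C. compact C \<and> C \<subseteq> Y \<and> (\<forall>y\<in>Y. \<exists>g\<in>carrier GH. act g y \<in> C)" by blast
  next
    fix g y y' assume g: "g \<in> carrier GH" and y: "y \<in> Y" "act g y = y" "y' \<in> Y"
    obtain a b where e: "g = (a, b)" by (metis surj_pair)
    obtain z s w where ey: "y = (z, s, w)" by (metis surj_pair)
    have zw: "z \<in> disc" "w \<in> disc" using y by (auto simp: ey Y_def)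
    have ab: "a \<in> L" "b \<in> L" "(a, b) \<in> H" using g HL[of g] GH(1) e by auto
    have fixed: "mob (snd a 1) z = z" "inc (fst a) (snd a 1) z = 0" "mob (snd b 1) w = w"
      using y(2) by (simp_all add: e ey act_def)
    note a = fixed_point_trivial[OF lifted_elt[OF L_sub[OF ab(1)]] zw(1) fixed(1,2)]
    \<comment> \<open>The first component has trivial matrix by \<open>fixed_point_trivial\<close>,
      so \<open>b\<close> acts on the last disc exactly as \<open>k\<close>, which lies in
      \<open>K\<close>.\<close>
    define k where "k = inv\<^bsub>lifted\<^esub> a \<otimes>\<^bsub>lifted\<^esub> b"
    have k: "k \<in> K" using H(3)[OF ab(3)] inv_LG[OF ab(1)] by (simp add: k_def)
    have "b = a \<otimes>\<^bsub>lifted\<^esub> k" unfolding k_def using ab L_sub by (simp add: amb.inv_cancel_left)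
    then have "snd b 1 = qmul 1 (snd a 1) (snd k 1)" by (simp add: snd_lifted_mult)
    then have bk: "snd b 1 = snd k 1" using a by simp
    then have "snd b 1 = qone" using K_free[OF k zw(2)] fixed(3) by simp
    then show "act g y' = y'" using a by (simp add: e act_def)
  qed
  have "derived GH (carrier GH) = carrier GH"
    unfolding GH(1) unfolding GH_def using LL.derived_consistent[OF _ H(1), of H] H(2) by simp
  from PA.quotient_manifold[OF this] show ?thesis by simp
qed

end

section \<open>The (2,3,7) triangle group\<close>

text \<open>\<open>X 1\<close> and \<open>W 1\<close> are the rotations by \<open>\<pi>\<close> and \<open>2\<pi>/7\<close> in the triangle group; the indices \<open>2\<close> and \<open>3\<close>
  are their Galois conjugates, which lie in the compact group \<open>SU(2)\<close>.\<close>

definition ang :: "3 \<Rightarrow> real" where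
  "ang k = (if k = 1 then pi / 7 else if k = 2 then 3 * pi / 7 else 5 * pi / 7)"

definition rho :: "3 \<Rightarrow> real" where "rho k = 2 * cos (ang k)"

text \<open>The value for which \<open>XWq\<close> has trace
  \<open>- 2 * sc k * sin (ang k) = -1\<close>, as befits an element of order 3.\<close>

definition sc :: "3 \<Rightarrow> real" where "sc k = 1 / (2 * sin (ang k))"

definition bt :: "3 \<Rightarrow> real" where "bt k = sqrt \<bar>(sc k)\<^sup>2 - 1\<bar>"

definition Xq :: "3 \<Rightarrow> quat" where "Xq k = (\<i> * of_real (sc k), of_real (bt k))"

definition Wq :: "3 \<Rightarrow> quat" where "Wq k = (cis (ang k), 0)"

lemma three_cases: "k = 1 \<or> k = 2 \<or> k = (3 :: 3)"
  using exhaust_3 by blast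

lemma distinct_three [simp]: "(2 :: 3) \<noteq> 1" "(3 :: 3) \<noteq> 1" "(3 :: 3) \<noteq> 2" "(1 :: 3) \<noteq> 2" "(0 :: 3) \<noteq> 1" "(0 :: 3) \<noteq> 2"
  by simp_all

lemma ang_bounds: "0 < ang k" "ang k < pi"
  using pi_gt_zero by (auto simp: ang_def)

lemma sin_ang: "sin (ang k) > 0"
  using ang_bounds by (intro sin_gt_zero)

lemma seven_ang: "\<exists>m :: nat. 7 * ang k = (2 * m + 1) * pi"
proof -
  have "7 * ang k = (2 * real (if k = 1 then 0 else if k = 2 then 1 else 2) + 1) * pi"
    by (simp add: ang_def)
  then show ?thesis by blast
qed

lemma sc_pos: "sc k > 0" and sc_sin: "sc k * sin (ang k) = 1 / 2"
  using sin_ang[of k] by (simp_all add: sc_def)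

lemma sc_1: "sc 1 > 1"
proof -
  have "sin (pi / 7) < sin (pi / 6)" by (intro sin_monotone_2pi; use pi_gt_zero in linarith)
  then show ?thesis using sin_ang[of 1] by (simp add: sc_def ang_def sin_30 less_divide_eq)
qed

lemma sc_other: assumes "k \<noteq> 1" shows "sc k < 1"
proof -
  have "sin (pi / 6) < sin (ang k)"
  proof (cases "k = 2")
    case True
    have "sin (pi / 6) < sin (3 * pi / 7)" by (intro sin_monotone_2pi; use pi_gt_zero in linarith)
    then show ?thesis using True by (simp add: ang_def)
  next
    case False
    have "sin (5 * pi / 7) = sin (2 * pi / 7)"
      using sin_pi_minus[of "2 * pi / 7"] by (simp add: field_simps)
    moreover have "sin (pi / 6) < sin (2 * pi / 7)" by (intro sin_monotone_2pi; use pi_gt_zero in linarith)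
    ultimately show ?thesis using False assms by (simp add: ang_def)
  qed
  then show ?thesis using sin_ang[of k] by (simp add: sc_def sin_30 divide_less_eq)
qed

text \<open>\<open>sin (pi / 6) = 1 / 2\<close> separates \<open>sin (pi / 7)\<close> from the sines
  of the other two angles, so \<open>sc\<close> exceeds 1 for index 1 alone. This is why that place
  gives SU(1,1) and its conjugates give SU(2).\<close>

lemma bt_sq: "sig k * (bt k)\<^sup>2 = (sc k)\<^sup>2 - 1"
proof (cases "k = 1")
  case True
  then show ?thesis using sc_1 by (simp add: bt_def abs_if abs_square_less_1)
next
  case False
  have "(sc k)\<^sup>2 < 1" using sc_other[OF False] sc_pos[of k] by (simp add: abs_square_less_1)
  then show ?thesis using False by (simp add: bt_def sig_def)
qed

lemma bt_pos: "bt k > 0"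
proof -
  have "(sc k)\<^sup>2 \<noteq> 1"
    using sc_1 sc_other[of k] sc_pos[of k] by (cases "k = 1") (auto simp: power2_eq_1_iff)
  then show ?thesis by (simp add: bt_def)
qed

lemma qnorm_Xq: "qnorm (sig k) (Xq k) = 1" and qnorm_Wq: "qnorm (sig k) (Wq k) = 1"
  using bt_sq[of k] by (simp_all add: qnorm_def Xq_def Wq_def norm_mult)

text \<open>Seven times the angle is an odd multiple of \<open>pi\<close>, so the cosines of 4 and 3
  times the angle are opposite. This is a quartic in the cosine, and removing the root -1 leaves, up
  to scaling, the minimal polynomial of 2 cos (pi/7).\<close>

lemma rho_cubic: "rho k ^ 3 = (rho k)\<^sup>2 + 2 * rho k - 1"
proof -
  define c where "c = cos (ang k)"
  obtain m :: nat where m: "7 * ang k = (2 * real m + 1) * pi" using seven_ang by blast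
  have e: "4 * ang k = (2 * real m + 1) * pi - 3 * ang k" using m by simp
  have "sin (pi * (real m * 2)) = 0" "cos (pi * (real m * 2)) = 1"
    using sin_npi2[of "m * 2"] cos_npi2[of "m * 2"] by simp_all
  then have "cos (4 * ang k) = - cos (3 * ang k)"
    unfolding e by (simp add: cos_diff algebra_simps cos_add sin_add)
  moreover have "cos (3 * ang k) = 4 * c ^ 3 - 3 * c" by (simp add: cos_treble_cos c_def)
  moreover have "cos (4 * ang k) = 2 * (2 * c\<^sup>2 - 1)\<^sup>2 - 1"
    using cos_double_cos[of "2 * ang k"] cos_double_cos[of "ang k"] by (simp add: c_def)
  ultimately have "(c + 1) * (8 * c ^ 3 - 4 * c\<^sup>2 - 4 * c + 1) = 0"
    by (simp add: power2_eq_square power3_eq_cube algebra_simps)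
  moreover have "c \<noteq> -1"
    using cos_monotone_0_pi[of "ang k" pi] ang_bounds[of k] by (auto simp: c_def)
  ultimately have "8 * c ^ 3 - 4 * c\<^sup>2 - 4 * c + 1 = 0" by simp
  then show ?thesis by (simp add: rho_def c_def[symmetric] power_mult_distrib)
qed

lemma inj_rho: "inj rho"
proof (rule injI)
  fix k l :: 3 assume "rho k = rho l"
  then have "ang k = ang l" using cos_inj_pi[of "ang k" "ang l"] ang_bounds by (simp add: rho_def less_imp_le)
  then show "k = l" using three_cases[of k] three_cases[of l] by (auto simp: ang_def)
qed

lemma qmul_add: "qmul s (q + q') r = qmul s q r + qmul s q' r" "qmul s r (q + q') = qmul s r q + qmul s r q'"
  and qmul_minus: "qmul s (- q) r = - qmul s q r" "qmul s r (- q) = - qmul s r q"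
  and qmul_scale: "qmul s (c *\<^sub>R q) r = c *\<^sub>R qmul s q r" "qmul s r (c *\<^sub>R q) = c *\<^sub>R qmul s r q"
  by (simp_all add: qmul_def prod_eq_iff algebra_simps scaleR_conv_of_real)

section \<open>Multiplication table of 1, X, W, XW\<close>

definition XWq :: "3 \<Rightarrow> quat" where "XWq k = qmul (sig k) (Xq k) (Wq k)"

lemma XWq: "XWq k = (\<i> * of_real (sc k) * cis (ang k), of_real (bt k) * cis (- ang k))"
  by (simp add: XWq_def Xq_def Wq_def qmul_def cis_cnj)

lemma XX: "qmul (sig k) (Xq k) (Xq k) = - qone"
proof -
  have "complex_of_real (sig k * (bt k)\<^sup>2) = complex_of_real ((sc k)\<^sup>2 - 1)" by (simp only: bt_sq)
  then show ?thesis by (simp add: qmul_def Xq_def qone_def prod_eq_iff power2_eq_square algebra_simps)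
qed

lemma cis_sum: "cis t + cis (- t) = of_real (2 * cos t)"
  by (simp add: complex_eq_iff)

lemma WW: "qmul (sig k) (Wq k) (Wq k) = rho k *\<^sub>R Wq k - qone"
proof -
  have "of_real (rho k) * cis (ang k) = (cis (ang k) + cis (- ang k)) * cis (ang k)"
    by (simp only: cis_sum rho_def)
  also have "\<dots> = cis (ang k) * cis (ang k) + 1" by (simp add: distrib_right cis_mult)
  finally have "cis (ang k) * cis (ang k) = of_real (rho k) * cis (ang k) - 1" by simp
  then show ?thesis by (simp add: qmul_def Wq_def qone_def prod_eq_iff scaleR_conv_of_real)
qed

text \<open>Polarized Cayley-Hamilton: XW + WX = tr(X) W + tr(W) X + tr(XW) - tr(X) tr(W), with
  tr(X) = 0, tr(W) = \<open>rho k\<close> and tr(XW) = -1. Together with the squares of X and W it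
  yields the rest of the table.\<close>

lemma WX: "qmul (sig k) (Wq k) (Xq k) = - qone + rho k *\<^sub>R Xq k - XWq k"
proof -
  have "cis (ang k) * (\<i> * of_real (sc k)) = - 1 + of_real (rho k) * (\<i> * of_real (sc k)) - \<i> * of_real (sc k) * cis (ang k)"
    using sc_sin[of k] by (simp add: complex_eq_iff rho_def algebra_simps)
  moreover have "cis (ang k) * of_real (bt k) = of_real (rho k) * of_real (bt k) - of_real (bt k) * cis (- ang k)"
    by (simp add: complex_eq_iff rho_def algebra_simps)
  ultimately show ?thesis by (simp add: XWq qmul_def Wq_def Xq_def qone_def prod_eq_iff scaleR_conv_of_real)
qed

lemma XWX: "qmul (sig k) (XWq k) (Xq k) = - Xq k - rho k *\<^sub>R qone + Wq k"
  unfolding XWq_def qmul_assoc WX unfolding diff_conv_add_uminus qmul_add qmul_minus qmul_scale XX XWq_def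
  by (simp add: XX qmul_minus flip: qmul_assoc)

lemma XWW: "qmul (sig k) (XWq k) (Wq k) = rho k *\<^sub>R XWq k - Xq k"
  unfolding XWq_def qmul_assoc WW unfolding diff_conv_add_uminus qmul_add qmul_minus qmul_scale by simp

lemma X_XW: "qmul (sig k) (Xq k) (XWq k) = - Wq k"
  unfolding XWq_def qmul_assoc[symmetric] XX by (simp add: qmul_minus)

lemma W_XW: "qmul (sig k) (Wq k) (XWq k) = Xq k - Wq k"
proof -
  have "qmul (sig k) (Wq k) (XWq k) = qmul (sig k) (qmul (sig k) (Wq k) (Xq k)) (Wq k)"
    by (simp add: XWq_def qmul_assoc)
  also have "\<dots> = - Wq k + rho k *\<^sub>R XWq k - (rho k *\<^sub>R XWq k - Xq k)"
    unfolding WX unfolding diff_conv_add_uminus[of _ "XWq k"] qmul_add qmul_minus qmul_scale XWW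
    by (simp add: XWq_def)
  finally show ?thesis by simp
qed

text \<open>\<open>XWq\<close> is a root of t^2 + t + 1, as its trace -1 and determinant 1
  predict.\<close>

lemma XW_cube: "qmul (sig k) (XWq k) (qmul (sig k) (XWq k) (XWq k)) = qone"
proof -
  have "qmul (sig k) (XWq k) (XWq k) = qmul (sig k) (qmul (sig k) (XWq k) (Xq k)) (Wq k)"
    by (simp add: XWq_def qmul_assoc)
  also have "\<dots> = - XWq k - rho k *\<^sub>R Wq k + (rho k *\<^sub>R Wq k - qone)"
    unfolding XWX unfolding diff_conv_add_uminus[of _ "rho k *\<^sub>R qone"] qmul_add qmul_minus qmul_scale WW
    by (simp add: XWq_def)
  finally have sq: "qmul (sig k) (XWq k) (XWq k) = - XWq k - qone" by simp
  show ?thesis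
    unfolding sq diff_conv_add_uminus qmul_add qmul_minus sq by simp
qed

subsection \<open>The order and its coefficients\<close>

text \<open>The order spanned over \<open>\<int>[2 cos (\<pi>/7)]\<close> by \<open>1, X, W, XW\<close>, in its three embeddings at once.\<close>

inductive_set Ord :: "(3 \<Rightarrow> quat) set" where
  Ord_1: "(\<lambda>k. qone) \<in> Ord"
| Ord_X: "Xq \<in> Ord"
| Ord_W: "Wq \<in> Ord"
| Ord_XW: "XWq \<in> Ord"
| Ord_add: "o1 \<in> Ord \<Longrightarrow> o2 \<in> Ord \<Longrightarrow> (\<lambda>k. o1 k + o2 k) \<in> Ord"
| Ord_minus: "o1 \<in> Ord \<Longrightarrow> (\<lambda>k. - o1 k) \<in> Ord"
| Ord_rho: "o1 \<in> Ord \<Longrightarrow> (\<lambda>k. rho k *\<^sub>R o1 k) \<in> Ord"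

lemma Ord_diff: "o1 \<in> Ord \<Longrightarrow> o2 \<in> Ord \<Longrightarrow> (\<lambda>k. o1 k - o2 k) \<in> Ord"
  using Ord_add[OF _ Ord_minus, of o1 o2] by simp

lemmas Ord_intros = Ord.intros Ord_diff

lemma Ord_left:
  assumes "o1 \<in> Ord" shows "(\<lambda>k. qmul (sig k) (Xq k) (o1 k)) \<in> Ord" "(\<lambda>k. qmul (sig k) (Wq k) (o1 k)) \<in> Ord"
  using assms by (induction) (simp_all add: qmul_add qmul_minus qmul_scale XX WX X_XW W_XW WW Ord_intros flip: XWq_def)

lemma Ord_right:
  assumes "o1 \<in> Ord" shows "(\<lambda>k. qmul (sig k) (o1 k) (Xq k)) \<in> Ord" "(\<lambda>k. qmul (sig k) (o1 k) (Wq k)) \<in> Ord"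
  using assms by (induction) (simp_all add: qmul_add qmul_minus qmul_scale XX WX XWX XWW WW Ord_intros flip: XWq_def)

text \<open>The integer \<open>v (e, j)\<close> is the coefficient of the \<open>j\<close>-th power
  of \<open>rho\<close> at the \<open>e\<close>-th of 1, X, W, XW. The twelve integers are common to
  the three places; only \<open>rho k\<close> varies.\<close>

definition coord :: "(nat \<times> nat \<Rightarrow> int) \<Rightarrow> nat \<Rightarrow> 3 \<Rightarrow> real" where
  "coord v e k = real_of_int (v (e, 0)) + real_of_int (v (e, 1)) * rho k + real_of_int (v (e, 2)) * (rho k)\<^sup>2"

definition el :: "(nat \<times> nat \<Rightarrow> int) \<Rightarrow> 3 \<Rightarrow> quat" where
  "el v k = coord v 0 k *\<^sub>R qone + coord v 1 k *\<^sub>R Xq k + coord v 2 k *\<^sub>R Wq k + coord v 3 k *\<^sub>R XWq k"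

lemma coord_linear:
  "coord (\<lambda>i. v i + w i) e k = coord v e k + coord w e k"
  "coord (\<lambda>i. - v i) e k = - coord v e k"
  "coord (\<lambda>i. c * v i) e k = of_int c * coord v e k"
  by (simp_all add: coord_def algebra_simps)

lemma el_linear:
  "el (\<lambda>i. v i + w i) k = el v k + el w k" "el (\<lambda>i. - v i) k = - el v k"
  "el (\<lambda>i. c * v i) k = of_int c *\<^sub>R el v k"
  by (simp_all add: el_def coord_linear algebra_simps)

text \<open>Multiplication by \<open>rho\<close> on coefficients, with the cube reduced by
  \<open>rho_cubic\<close>; that polynomial is monic, so the coefficients stay integral.\<close>

definition rho_shift :: "(nat \<times> nat \<Rightarrow> int) \<Rightarrow> nat \<times> nat \<Rightarrow> int" where
  "rho_shift v = (\<lambda>(e, j). if j = 0 then - v (e, 2) else if j = 1 then v (e, 0) + 2 * v (e, 2) else v (e, 1) + v (e, 2))"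

lemma coord_rho: "coord (rho_shift v) e k = rho k * coord v e k"
proof -
  have "rho k * coord v e k = real_of_int (v (e, 0)) * rho k + real_of_int (v (e, 1)) * (rho k)\<^sup>2
      + real_of_int (v (e, 2)) * rho k ^ 3"
    by (simp add: coord_def power2_eq_square power3_eq_cube algebra_simps)
  then show ?thesis unfolding rho_cubic by (simp add: coord_def rho_shift_def algebra_simps)
qed

lemma Ord_el: "o1 \<in> Ord \<Longrightarrow> \<exists>v. o1 = el v"
proof (induction rule: Ord.induct)
  case Ord_1
  show ?case by (intro exI[of _ "\<lambda>i. if i = (0, 0) then 1 else 0"]) (simp add: el_def coord_def fun_eq_iff)
next
  case Ord_X
  show ?case by (intro exI[of _ "\<lambda>i. if i = (1, 0) then 1 else 0"]) (simp add: el_def coord_def fun_eq_iff)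
next
  case Ord_W
  show ?case by (intro exI[of _ "\<lambda>i. if i = (2, 0) then 1 else 0"]) (simp add: el_def coord_def fun_eq_iff)
next
  case Ord_XW
  show ?case by (intro exI[of _ "\<lambda>i. if i = (3, 0) then 1 else 0"]) (simp add: el_def coord_def fun_eq_iff)
next
  case (Ord_add o1 o2)
  then obtain v w where "o1 = el v" "o2 = el w" by blast
  then show ?case by (intro exI[of _ "\<lambda>i. v i + w i"]) (simp add: el_linear fun_eq_iff)
next
  case (Ord_minus o1)
  then obtain v where "o1 = el v" by blast
  then show ?case by (intro exI[of _ "\<lambda>i. - v i"]) (simp add: el_linear fun_eq_iff)
next
  case (Ord_rho o1)
  then obtain v where "o1 = el v" by blast
  then show ?case by (intro exI[of _ "rho_shift v"]) (simp add: el_def coord_rho fun_eq_iff algebra_simps)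
qed

lemma Ord_of_int: "o1 \<in> Ord \<Longrightarrow> (\<lambda>k. of_int c *\<^sub>R o1 k) \<in> Ord"
proof -
  assume o: "o1 \<in> Ord"
  have z: "(\<lambda>k. 0) \<in> Ord" using Ord_diff[OF Ord_1 Ord_1] by simp
  have n: "(\<lambda>k. of_nat n *\<^sub>R o1 k) \<in> Ord" for n
  proof (induction n)
    case (Suc n)
    then show ?case using Ord_add[OF o Suc.IH] by (simp add: scaleR_left_distrib)
  qed (use z in simp)
  show ?thesis
  proof (cases c rule: int_cases2)
    case (nonneg m)
    then show ?thesis using n[of m] by simp
  next
    case (nonpos m)
    then show ?thesis using Ord_minus[OF n[of m]] by simp
  qed
qed

lemma el_Ord: "el v \<in> Ord"
proof -
  have c: "(\<lambda>k. coord v e k *\<^sub>R o1 k) \<in> Ord" if "o1 \<in> Ord" for e o1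
  proof -
    have "(\<lambda>k. of_int (v (e, 0)) *\<^sub>R o1 k + rho k *\<^sub>R (of_int (v (e, 1)) *\<^sub>R o1 k)
        + rho k *\<^sub>R (rho k *\<^sub>R (of_int (v (e, 2)) *\<^sub>R o1 k))) \<in> Ord"
      by (intro Ord_add Ord_rho Ord_of_int that)
    then show ?thesis by (simp add: coord_def algebra_simps power2_eq_square)
  qed
  have "(\<lambda>k. coord v 0 k *\<^sub>R qone + coord v 1 k *\<^sub>R Xq k + coord v 2 k *\<^sub>R Wq k + coord v 3 k *\<^sub>R XWq k) \<in> Ord"
    by (intro Ord_add c Ord_1 Ord_X Ord_W Ord_XW)
  then show ?thesis by (simp add: el_def[abs_def])
qed

lemma cis_bound:
  assumes "norm (of_real \<beta> + of_real \<delta> * cis t) \<le> B" "sin t \<noteq> 0"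
  shows "\<bar>\<delta>\<bar> \<le> B / \<bar>sin t\<bar>" "\<bar>\<beta>\<bar> \<le> B + B / \<bar>sin t\<bar>"
proof -
  have "\<bar>Im (of_real \<beta> + of_real \<delta> * cis t)\<bar> \<le> B" using assms abs_Im_le_cmod order_trans by blast
  then show d: "\<bar>\<delta>\<bar> \<le> B / \<bar>sin t\<bar>" using assms(2) by (simp add: abs_mult field_simps)
  have "\<bar>\<beta>\<bar> = norm ((of_real \<beta> + of_real \<delta> * cis t) - of_real \<delta> * cis t)" by simp
  also have "\<dots> \<le> B + \<bar>\<delta>\<bar>"
    using norm_triangle_ineq4[of "of_real \<beta> + of_real \<delta> * cis t" "of_real \<delta> * cis t"] assms(1)
    by (simp add: norm_mult)
  finally show "\<bar>\<beta>\<bar> \<le> B + B / \<bar>sin t\<bar>" using d by linarith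
qed

text \<open>The system is triangular: the second entry involves only coordinates 1 and 3, and once
  these are bounded the first entry bounds 0 and 2. Each time 1 and a nonreal number on the unit
  circle are independent over the reals.\<close>

lemma coord_bounded:
  "\<exists>M. \<forall>v. norm (fst (el v k)) \<le> B \<longrightarrow> norm (snd (el v k)) \<le> B \<longrightarrow> (\<forall>e<4. \<bar>coord v e k\<bar> \<le> M)"
proof -
  let ?s = "sin (ang k)"
  define B1 where "B1 = B / bt k"
  define M1 where "M1 = B1 + B1 / ?s"
  define B2 where "B2 = B + sc k * (2 * M1)"
  define M2 where "M2 = B2 + B2 / ?s"
  show ?thesis
  proof (intro exI[of _ "max M1 M2"] allI impI)
    fix v and e :: nat assume v: "norm (fst (el v k)) \<le> B" "norm (snd (el v k)) \<le> B" and e: "e < 4"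
    have B0: "B \<ge> 0" using v(1) norm_ge_zero order_trans by blast
    have s: "?s > 0" by (rule sin_ang)
    have B1: "B1 \<ge> 0" using B0 bt_pos[of k] by (simp add: B1_def)
    have "snd (el v k) = of_real (bt k) * (of_real (coord v 1 k) + of_real (coord v 3 k) * cis (- ang k))"
      by (simp add: el_def qone_def Xq_def Wq_def XWq scaleR_conv_of_real algebra_simps)
    then have "bt k * norm (of_real (coord v 1 k) + of_real (coord v 3 k) * cis (- ang k)) \<le> B"
      using v(2) bt_pos[of k] by (simp add: norm_mult)
    then have "norm (of_real (coord v 1 k) + of_real (coord v 3 k) * cis (- ang k)) \<le> B1"
      using bt_pos[of k] by (simp add: B1_def field_simps)
    from cis_bound[OF this] have 13: "\<bar>coord v 3 k\<bar> \<le> M1" "\<bar>coord v 1 k\<bar> \<le> M1"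
      using s B1 by (simp_all add: M1_def)
    have "norm (of_real (coord v 0 k) + of_real (coord v 2 k) * cis (ang k))
        = norm (fst (el v k) - \<i> * of_real (sc k) * (of_real (coord v 1 k) + of_real (coord v 3 k) * cis (ang k)))"
      by (simp add: el_def qone_def Xq_def Wq_def XWq scaleR_conv_of_real algebra_simps)
    also have "\<dots> \<le> B + sc k * (2 * M1)"
    proof -
      have "norm (of_real (coord v 1 k) + of_real (coord v 3 k) * cis (ang k)) \<le> 2 * M1"
        using norm_triangle_ineq[of "of_real (coord v 1 k)" "of_real (coord v 3 k) * cis (ang k)"] 13
        by (simp add: norm_mult)
      then have "sc k * norm (of_real (coord v 1 k) + of_real (coord v 3 k) * cis (ang k)) \<le> sc k * (2 * M1)"
        using sc_pos[of k] by (intro mult_left_mono) auto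
      moreover have "norm (\<i> * of_real (sc k) * (of_real (coord v 1 k) + of_real (coord v 3 k) * cis (ang k)))
          = sc k * norm (of_real (coord v 1 k) + of_real (coord v 3 k) * cis (ang k))"
        using sc_pos[of k] by (simp add: norm_mult)
      ultimately show ?thesis
        using norm_triangle_ineq4[of "fst (el v k)" "\<i> * of_real (sc k) * (of_real (coord v 1 k) + of_real (coord v 3 k) * cis (ang k))"]
          v(1) by linarith
    qed
    finally have b2: "norm (of_real (coord v 0 k) + of_real (coord v 2 k) * cis (ang k)) \<le> B2" by (simp add: B2_def)
    have "B2 \<ge> 0" using b2 norm_ge_zero order_trans by blast
    then have 02: "\<bar>coord v 2 k\<bar> \<le> M2" "\<bar>coord v 0 k\<bar> \<le> M2"
      using cis_bound[OF b2] s by (simp_all add: M2_def)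
    have "e = 0 \<or> e = 1 \<or> e = 2 \<or> e = 3" using e by auto
    then show "\<bar>coord v e k\<bar> \<le> max M1 M2" using 13 02 by auto
  qed
qed

text \<open>The three values of \<open>rho\<close> are distinct, so a Vandermonde system recovers
  the integers; it is solved by divided differences.\<close>

lemma coefficients_bounded:
  "\<exists>M. \<forall>v e. (\<forall>k. \<bar>coord v e k\<bar> \<le> B) \<longrightarrow> (\<forall>j<3. \<bar>real_of_int (v (e, j))\<bar> \<le> M)"
proof -
  define a b c where "a = rho 1" and "b = rho 2" and "c = rho 3"
  have "rho 1 \<noteq> rho 2" "rho 1 \<noteq> rho 3" "rho 2 \<noteq> rho 3" using inj_rho by (auto dest: injD)
  then have ne: "a \<noteq> b" "a \<noteq> c" "b \<noteq> c" by (simp_all add: a_def b_def c_def)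
  define D1 D2 where "D1 = 2 * B / \<bar>a - b\<bar>" and "D2 = 2 * B / \<bar>a - c\<bar>"
  define M2 where "M2 = (D1 + D2) / \<bar>b - c\<bar>"
  define M1 where "M1 = D1 + M2 * \<bar>a + b\<bar>"
  define M0 where "M0 = B + M1 * \<bar>a\<bar> + M2 * a\<^sup>2"
  have bound: "\<bar>x\<bar> \<le> C / \<bar>d\<bar>" if "\<bar>x * d\<bar> \<le> C" "d \<noteq> 0" for x d C :: real
    using that by (simp add: abs_mult field_simps)
  show ?thesis
  proof (intro exI[of _ "max M0 (max M1 M2)"] allI impI)
    fix v e and j :: nat assume B: "\<forall>k. \<bar>coord v e k\<bar> \<le> B" and j: "j < 3"
    define x y z where "x = real_of_int (v (e, 0))" and "y = real_of_int (v (e, 1))" and "z = real_of_int (v (e, 2))"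
    have f: "\<bar>x + y * a + z * a\<^sup>2\<bar> \<le> B" "\<bar>x + y * b + z * b\<^sup>2\<bar> \<le> B" "\<bar>x + y * c + z * c\<^sup>2\<bar> \<le> B"
      using B[rule_format, of 1] B[rule_format, of 2] B[rule_format, of 3]
      by (simp_all add: coord_def x_def y_def z_def a_def b_def c_def)
    have "(y + z * (a + b)) * (a - b) = (x + y * a + z * a\<^sup>2) - (x + y * b + z * b\<^sup>2)"
      by (simp add: algebra_simps power2_eq_square)
    then have "\<bar>(y + z * (a + b)) * (a - b)\<bar> \<le> 2 * B" using f by linarith
    then have d1: "\<bar>y + z * (a + b)\<bar> \<le> D1" unfolding D1_def using ne by (intro bound) auto
    have "(y + z * (a + c)) * (a - c) = (x + y * a + z * a\<^sup>2) - (x + y * c + z * c\<^sup>2)"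
      by (simp add: algebra_simps power2_eq_square)
    then have "\<bar>(y + z * (a + c)) * (a - c)\<bar> \<le> 2 * B" using f by linarith
    then have d2: "\<bar>y + z * (a + c)\<bar> \<le> D2" unfolding D2_def using ne by (intro bound) auto
    have "z * (b - c) = (y + z * (a + b)) - (y + z * (a + c))" by (simp add: algebra_simps)
    then have "\<bar>z * (b - c)\<bar> \<le> D1 + D2" using d1 d2 by linarith
    then have z: "\<bar>z\<bar> \<le> M2" unfolding M2_def using ne by (intro bound) auto
    have "\<bar>z * (a + b)\<bar> \<le> M2 * \<bar>a + b\<bar>" unfolding abs_mult by (intro mult_right_mono z) auto
    then have y: "\<bar>y\<bar> \<le> M1" unfolding M1_def using d1 by linarith
    have "\<bar>z * a\<^sup>2\<bar> \<le> M2 * a\<^sup>2" "\<bar>y * a\<bar> \<le> M1 * \<bar>a\<bar>"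
      unfolding abs_mult by (auto intro!: mult_right_mono z y)
    then have x: "\<bar>x\<bar> \<le> M0" unfolding M0_def using f(1) by linarith
    have "j = 0 \<or> j = 1 \<or> j = 2" using j by auto
    then show "\<bar>real_of_int (v (e, j))\<bar> \<le> max M0 (max M1 M2)"
      using x y z by (auto simp: x_def y_def z_def)
  qed
qed

text \<open>This is the discreteness of the order in the product of its three completions: integers
  that are bounded are finite in number.\<close>

lemma el_bounded:
  "\<exists>M :: int. \<forall>v. (\<forall>k. norm (fst (el v k)) \<le> B \<and> norm (snd (el v k)) \<le> B) \<longrightarrow>
    (\<forall>e<4. \<forall>j<3. \<bar>v (e, j)\<bar> \<le> M)"
proof -
  obtain M1 where M1: "\<And>v k e. norm (fst (el v k)) \<le> B \<Longrightarrow> norm (snd (el v k)) \<le> B \<Longrightarrow> e < 4 \<Longrightarrow> \<bar>coord v e k\<bar> \<le> M1 k"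
    using coord_bounded[of _ B] by metis
  define C where "C = max (M1 1) (max (M1 2) (M1 3))"
  have C: "M1 k \<le> C" for k using three_cases[of k] by (auto simp: C_def)
  obtain M where M: "\<And>v e j. (\<And>k. \<bar>coord v e k\<bar> \<le> C) \<Longrightarrow> j < 3 \<Longrightarrow> \<bar>real_of_int (v (e, j))\<bar> \<le> M"
    using coefficients_bounded[of C] by metis
  show ?thesis
  proof (intro exI[of _ "\<lceil>M\<rceil>"] allI impI)
    fix v and e j :: nat
    assume "\<forall>k. norm (fst (el v k)) \<le> B \<and> norm (snd (el v k)) \<le> B" "e < 4" "j < 3"
    then have v: "\<And>k. norm (fst (el v k)) \<le> B" "\<And>k. norm (snd (el v k)) \<le> B" "e < 4" "j < 3" by auto
    have "\<bar>coord v e k\<bar> \<le> C" for k using M1[OF v(1,2,3), of k] C[of k] by linarith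
    then have "\<bar>real_of_int (v (e, j))\<bar> \<le> M" using v(4) by (rule M)
    then show "\<bar>v (e, j)\<bar> \<le> \<lceil>M\<rceil>" by linarith
  qed
qed

subsection \<open>The lifted group\<close>

definition gx :: lifted_elt where "gx = (pi / 2, Xq)"
definition gw :: lifted_elt where "gw = (pi / 7, Wq)"
definition L :: "lifted_elt set" where "L = generate lifted {gx, gw}"

interpretation lifted: group lifted by (rule group_lifted)

lemma gx_carrier: "gx \<in> carrier lifted"
  using sc_pos[of 1] by (simp add: gx_def lifted_simps qnorm_Xq polar_def) (simp add: Xq_def norm_mult)

lemma gw_carrier: "gw \<in> carrier lifted"
  using polar_cis[of "pi / 7"] by (simp add: gw_def lifted_simps qnorm_Wq) (simp add: Wq_def ang_def)

lemma subgroup_L: "subgroup L lifted"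
  unfolding L_def by (rule lifted.generate_is_subgroup) (use gx_carrier gw_carrier in auto)

lemma L_carrier: "g \<in> L \<Longrightarrow> g \<in> carrier lifted"
  using subgroup.subset[OF subgroup_L] by blast

lemma gx_L: "gx \<in> L" and gw_L: "gw \<in> L"
  unfolding L_def by (auto intro: generate.incl)

lemma L_closed: "g \<in> L \<Longrightarrow> h \<in> L \<Longrightarrow> g \<otimes>\<^bsub>lifted\<^esub> h \<in> L" "g \<in> L \<Longrightarrow> inv\<^bsub>lifted\<^esub> g \<in> L"
    "\<one>\<^bsub>lifted\<^esub> \<in> L" "g \<in> L \<Longrightarrow> g [^]\<^bsub>lifted\<^esub> (n :: nat) \<in> L"
proof -
  interpret S: subgroup L lifted by (rule subgroup_L)
  show m: "g \<in> L \<Longrightarrow> h \<in> L \<Longrightarrow> g \<otimes>\<^bsub>lifted\<^esub> h \<in> L" for g h by simp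
  show "g \<in> L \<Longrightarrow> inv\<^bsub>lifted\<^esub> g \<in> L" "\<one>\<^bsub>lifted\<^esub> \<in> L" by simp_all
  show "g \<in> L \<Longrightarrow> g [^]\<^bsub>lifted\<^esub> (n :: nat) \<in> L" by (induction n) (simp_all add: m)
qed

lemma lifted_qnorm: "g \<in> carrier lifted \<Longrightarrow> qnorm (sig k) (snd g k) = 1"
  using lifted_simps(1)[of "fst g" "snd g"] by simp

lemma snd_lifted_inv: "g \<in> carrier lifted \<Longrightarrow> snd (inv\<^bsub>lifted\<^esub> g) k = qconj (snd g k)"
proof -
  assume g: "g \<in> carrier lifted"
  have "qmul (sig k) (snd (inv\<^bsub>lifted\<^esub> g) k) (snd g k) = qone"
    using snd_lifted_mult[of "inv\<^bsub>lifted\<^esub> g" g] lifted.l_inv[OF g] by (metis lifted_simps(3) snd_conv)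
  then have "qmul (sig k) (qmul (sig k) (snd (inv\<^bsub>lifted\<^esub> g) k) (snd g k)) (qconj (snd g k)) = qconj (snd g k)"
    by simp
  then show ?thesis by (simp add: qmul_assoc qmul_conj[OF lifted_qnorm[OF g]])
qed

lemma gw_power: "gw [^]\<^bsub>lifted\<^esub> (n :: nat) = (n * pi / 7, \<lambda>k. (cis (n * ang k), 0))"
proof (induction n)
  case 0
  show ?case by (simp add: lifted_simps qone_def)
next
  case (Suc n)
  have "gw [^]\<^bsub>lifted\<^esub> Suc n = (n * pi / 7, \<lambda>k. (cis (n * ang k), 0)) \<otimes>\<^bsub>lifted\<^esub> gw" using Suc by simp
  also have "\<dots> = (Suc n * pi / 7, \<lambda>k. (cis (Suc n * ang k), 0))"
    by (simp add: gw_def lifted_simps mob_def Wq_def inc_def qmul_def cis_mult field_simps)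
  finally show ?case .
qed

lemma gw_7: "gw [^]\<^bsub>lifted\<^esub> (7 :: nat) = (pi, \<lambda>k. - qone)"
proof -
  have "cis (7 * ang k) = -1" for k
  proof -
    obtain m :: nat where "7 * ang k = (2 * real m + 1) * pi" using seven_ang by blast
    then have "7 * ang k = real m * (2 * pi) + pi" by (simp add: algebra_simps)
    then have "cis (7 * ang k) = cis (real m * (2 * pi)) * cis pi" by (simp only: cis_mult)
    also have "cis (real m * (2 * pi)) = 1" by (metis Ints_of_nat cis_multiple_2pi mult.commute)
    finally show ?thesis by simp
  qed
  then show ?thesis unfolding gw_power by (simp add: qone_def)
qed

text \<open>The correction to the angle is \<open>tau\<close> of a real number of modulus below 1,
  hence zero, so the two angles \<open>pi / 2\<close> simply add.\<close>

lemma gx_gx: "gx \<otimes>\<^bsub>lifted\<^esub> gx = (pi, \<lambda>k. - qone)"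
proof -
  have "snd (Xq 1) / fst (Xq 1) * cnj (mob (Xq 1) 0) = of_real (- ((bt 1)\<^sup>2 / (sc 1)\<^sup>2))"
    using sc_pos[of 1] by (simp add: Xq_def mob_def J_def field_simps power2_eq_square)
  moreover have "(bt 1)\<^sup>2 < (sc 1)\<^sup>2" using bt_sq[of 1] by simp
  then have "\<bar>- ((bt 1)\<^sup>2 / (sc 1)\<^sup>2)\<bar> < 1" using sc_pos[of 1] by simp
  ultimately have "tau (snd (Xq 1) / fst (Xq 1) * cnj (mob (Xq 1) 0)) = 0" using tau_of_real by metis
  then show ?thesis by (simp add: gx_def lifted_simps inc_def XX)
qed

lemma minus_one_square: "(pi, \<lambda>k. - qone) \<otimes>\<^bsub>lifted\<^esub> (pi, \<lambda>k. - qone) = (2 * pi, \<lambda>k. qone)"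
  by (simp add: lifted_simps qmul_minus mob_def J_def inc_def qone_def qmul_def)

text \<open>The angle of \<open>(xw)\<^sup>3\<close> is a multiple of \<open>2\<pi>\<close> within \<open>\<pi>\<close> of \<open>27\<pi>/14\<close>.\<close>

lemma gxw_cube: "(gx \<otimes>\<^bsub>lifted\<^esub> gw) [^]\<^bsub>lifted\<^esub> (3 :: nat) = (2 * pi, \<lambda>k. qone)"
proof -
  let ?y = "gx \<otimes>\<^bsub>lifted\<^esub> gw"
  have y: "?y = (9 * pi / 14, XWq)"
    by (simp add: gx_def gw_def lifted_simps XWq_def[abs_def] mob_def inc_def Wq_def)
  have yc: "?y \<in> carrier lifted" using gx_carrier gw_carrier by simp
  have n: "qnorm 1 (XWq 1) = 1" using lifted_qnorm[OF yc, of 1] by (simp add: y)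
  let ?u = "mob (XWq 1) 0"
  have u: "?u \<in> disc" using mob_closed[OF n] by simp
  have y2: "?y \<otimes>\<^bsub>lifted\<^esub> ?y = (9 * pi / 14 + inc (9 * pi / 14) (XWq 1) ?u, \<lambda>k. qmul (sig k) (XWq k) (XWq k))"
    by (simp add: y lifted_simps)
  have n2: "qnorm 1 (qmul 1 (XWq 1) (XWq 1)) = 1" using n by (simp add: qnorm_mult)
  define \<theta> where "\<theta> = 9 * pi / 14 + inc (9 * pi / 14 + inc (9 * pi / 14) (XWq 1) ?u) (qmul 1 (XWq 1) (XWq 1)) ?u"
  have y3: "?y \<otimes>\<^bsub>lifted\<^esub> ?y \<otimes>\<^bsub>lifted\<^esub> ?y = (\<theta>, \<lambda>k. qone)"
    unfolding y2 unfolding y by (simp add: lifted_simps qmul_assoc XW_cube \<theta>_def)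
  have "?y \<otimes>\<^bsub>lifted\<^esub> ?y \<otimes>\<^bsub>lifted\<^esub> ?y \<in> carrier lifted" using yc by simp
  then have p: "polar 1 \<theta>" unfolding y3 by (simp add: lifted_simps) (simp add: qone_def)
  have "\<bar>tau (snd (XWq 1) / fst (XWq 1) * cnj ?u)\<bar> < pi / 2"
    "\<bar>tau (snd (qmul 1 (XWq 1) (XWq 1)) / fst (qmul 1 (XWq 1) (XWq 1)) * cnj ?u)\<bar> < pi / 2"
    using ratio_mult_less n n2 u by (intro tau_bound; blast)+
  then have "\<bar>\<theta> - 2 * pi\<bar> < 2 * pi" unfolding \<theta>_def inc_def by linarith
  moreover have "polar 1 (2 * pi)" by (simp add: polar_def)
  ultimately have "\<theta> = 2 * pi" using polar_unique[OF p] by simp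
  then show ?thesis using y3 yc by (simp add: numeral_3_eq_3)
qed

abbreviation LG where "LG \<equiv> lifted\<lparr>carrier := L\<rparr>"

interpretation LG: group LG by (rule lifted.subgroup_imp_group[OF subgroup_L])

lemma pow_LG: "g [^]\<^bsub>LG\<^esub> (n :: nat) = g [^]\<^bsub>lifted\<^esub> n"
  by (simp add: nat_pow_def)

lemma perfect_L: "derived LG L = L"
proof -
  have "carrier LG = generate LG {gx, gw}"
    using lifted.generate_consistent[OF _ subgroup_L, of "{gx, gw}"] gx_L gw_L by (simp add: L_def)
  moreover have "gx [^]\<^bsub>LG\<^esub> (2 :: nat) = gw [^]\<^bsub>LG\<^esub> (7 :: nat)"
    unfolding pow_LG gw_7 using gx_carrier by (simp add: numeral_2_eq_2 gx_gx)
  moreover have "(gx \<otimes>\<^bsub>LG\<^esub> gw) [^]\<^bsub>LG\<^esub> (3 :: nat) = gx [^]\<^bsub>LG\<^esub> (4 :: nat)"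
  proof -
    have "gx [^]\<^bsub>lifted\<^esub> (4 :: nat) = gx \<otimes>\<^bsub>lifted\<^esub> gx \<otimes>\<^bsub>lifted\<^esub> (gx \<otimes>\<^bsub>lifted\<^esub> gx)"
      using gx_carrier by (simp add: eval_nat_numeral lifted.m_assoc)
    then show ?thesis unfolding pow_LG by (simp add: gxw_cube gx_gx minus_one_square)
  qed
  ultimately have "derived LG (carrier LG) = carrier LG"
    using gx_L gw_L by (intro LG.perfect_if_generated_2_3_7[of gx gw]) auto
  then show ?thesis by simp
qed

subsection \<open>Congruence subgroups\<close>

lemma qconj_Xq: "qconj (Xq k) = - Xq k" and qconj_Wq: "qconj (Wq k) = rho k *\<^sub>R qone - Wq k"
  by (simp_all add: qconj_def Xq_def Wq_def rho_def qone_def complex_eq_iff)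

text \<open>Stability of the order under the generators on either side extends to words by
  associativity. Inverses are conjugates, and conjugation sends X to -X and W to \<open>rho\<close>
  - W.\<close>

lemma L_Ord_mult:
  assumes "g \<in> L"
  shows "o1 \<in> Ord \<Longrightarrow> (\<lambda>k. qmul (sig k) (snd g k) (o1 k)) \<in> Ord \<and> (\<lambda>k. qmul (sig k) (o1 k) (snd g k)) \<in> Ord"
  using assms unfolding L_def
proof (induction arbitrary: o1 rule: generate.induct)
  case one
  then show ?case by (simp add: lifted_simps)
next
  case (incl h)
  then show ?case using Ord_left[OF incl(2)] Ord_right[OF incl(2)] by (auto simp: gx_def gw_def)
next
  case (inv h)
  then have "h \<in> carrier lifted" using gx_carrier gw_carrier by auto
  then show ?case using inv Ord_left[OF inv(2)] Ord_right[OF inv(2)]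
    by (auto simp: snd_lifted_inv gx_def gw_def qconj_Xq qconj_Wq diff_conv_add_uminus qmul_add qmul_minus qmul_scale
        simp del: add_uminus_conv_diff intro!: Ord_intros)
next
  case (eng h1 h2)
  then show ?case by (simp add: snd_lifted_mult qmul_assoc) (simp flip: qmul_assoc)
qed

lemma L_Ord: "g \<in> L \<Longrightarrow> snd g \<in> Ord"
  using L_Ord_mult[OF _ Ord_1, of g] by simp

text \<open>The principal congruence subgroup of level \<open>m\<close>. The condition concerns the
  matrices alone, so every element of \<open>L\<close> with trivial matrices belongs to it.\<close>

definition Kc :: "nat \<Rightarrow> lifted_elt set" where
  "Kc m = {g \<in> L. \<exists>o1\<in>Ord. snd g = (\<lambda>k. qone + real m *\<^sub>R o1 k)}"

lemma KcI:
  "g \<in> L \<Longrightarrow> o1 \<in> Ord \<Longrightarrow> (\<And>k. snd g k = qone + real m *\<^sub>R o1 k) \<Longrightarrow> g \<in> Kc m"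
  unfolding Kc_def by blast

lemma Kc_L: "g \<in> Kc m \<Longrightarrow> g \<in> L" by (simp add: Kc_def)

lemma Kc_conj:
  assumes g: "g \<in> Kc m" and h: "h \<in> L"
  shows "h \<otimes>\<^bsub>lifted\<^esub> g \<otimes>\<^bsub>lifted\<^esub> inv\<^bsub>lifted\<^esub> h \<in> Kc m"
proof -
  obtain o1 where o: "o1 \<in> Ord" "snd g = (\<lambda>k. qone + real m *\<^sub>R o1 k)" using g by (auto simp: Kc_def)
  have hc: "h \<in> carrier lifted" by (rule L_carrier[OF h])
  let ?o = "\<lambda>k. qmul (sig k) (qmul (sig k) (snd h k) (o1 k)) (snd (inv\<^bsub>lifted\<^esub> h) k)"
  have "(\<lambda>k. qmul (sig k) (snd h k) (o1 k)) \<in> Ord" using L_Ord_mult[OF h o(1)] by blast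
  then have "?o \<in> Ord" using L_Ord_mult[OF L_closed(2)[OF h]] by blast
  moreover have "snd (h \<otimes>\<^bsub>lifted\<^esub> g \<otimes>\<^bsub>lifted\<^esub> inv\<^bsub>lifted\<^esub> h) k = qone + real m *\<^sub>R ?o k" for k
    by (simp add: snd_lifted_mult o(2) qmul_add qmul_scale snd_lifted_inv[OF hc] qmul_conj[OF lifted_qnorm[OF hc]])
  moreover have "h \<otimes>\<^bsub>lifted\<^esub> g \<otimes>\<^bsub>lifted\<^esub> inv\<^bsub>lifted\<^esub> h \<in> L" using h Kc_L[OF g] by (intro L_closed)
  ultimately show ?thesis by (intro KcI)
qed

lemma normal_Kc: "Kc m \<lhd> LG"
  unfolding LG.normal_inv_iff
proof (intro conjI ballI)
  show "subgroup (Kc m) LG"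
  proof (rule LG.subgroupI)
    show "Kc m \<subseteq> carrier LG" using Kc_L by auto
    have "\<one>\<^bsub>lifted\<^esub> \<in> Kc m"
      unfolding Kc_def using L_closed(3) Ord_diff[OF Ord_1 Ord_1]
      by (auto simp: lifted_simps intro!: bexI[of _ "\<lambda>k. 0"])
    then show "Kc m \<noteq> {}" by blast
  next
    fix g assume g: "g \<in> Kc m"
    then obtain o1 where o: "o1 \<in> Ord" "snd g = (\<lambda>k. qone + real m *\<^sub>R o1 k)" by (auto simp: Kc_def)
    have gL: "g \<in> L" by (rule Kc_L[OF g])
    let ?i = "inv\<^bsub>lifted\<^esub> g"
    have iL: "?i \<in> L" by (rule L_closed(2)[OF gL])
    let ?o = "\<lambda>k. - qmul (sig k) (snd ?i k) (o1 k)"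
    have "?o \<in> Ord" using L_Ord_mult[OF iL o(1)] Ord_minus by blast
    moreover have "snd ?i k = qone + real m *\<^sub>R ?o k" for k
    proof -
      have "qmul (sig k) (snd ?i k) (snd g k) = qone"
        using L_carrier[OF gL] by (simp add: snd_lifted_inv qmul_conj lifted_qnorm)
      then show ?thesis by (simp add: o(2) qmul_add qmul_scale algebra_simps)
    qed
    ultimately have "?i \<in> Kc m" by (rule KcI[OF iL])
    then show "inv\<^bsub>LG\<^esub> g \<in> Kc m" using lifted.m_inv_consistent[OF subgroup_L gL] by simp
  next
    fix g h assume gh: "g \<in> Kc m" "h \<in> Kc m"
    obtain o1 where o1: "o1 \<in> Ord" "snd g = (\<lambda>k. qone + real m *\<^sub>R o1 k)" using gh by (auto simp: Kc_def)
    obtain o2 where o2: "o2 \<in> Ord" "snd h = (\<lambda>k. qone + real m *\<^sub>R o2 k)" using gh by (auto simp: Kc_def)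
    let ?o = "\<lambda>k. o1 k + qmul (sig k) (snd g k) (o2 k)"
    have "?o \<in> Ord" using L_Ord_mult[OF Kc_L[OF gh(1)] o2(1)] o1(1) by (intro Ord_add) auto
    moreover have "snd (g \<otimes>\<^bsub>lifted\<^esub> h) k = qone + real m *\<^sub>R ?o k" for k
      unfolding snd_lifted_mult o2(2) qmul_add qmul_scale by (simp add: o1(2) algebra_simps)
    ultimately have "g \<otimes>\<^bsub>lifted\<^esub> h \<in> Kc m"
      by (rule KcI[OF L_closed(1)[OF Kc_L[OF gh(1)] Kc_L[OF gh(2)]]])
    then show "g \<otimes>\<^bsub>LG\<^esub> h \<in> Kc m" by simp
  qed
  fix h g assume h: "h \<in> carrier LG" and g: "g \<in> Kc m"
  have hL: "h \<in> L" using h by simp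
  then show "h \<otimes>\<^bsub>LG\<^esub> g \<otimes>\<^bsub>LG\<^esub> inv\<^bsub>LG\<^esub> h \<in> Kc m"
    using Kc_conj[OF g hL] lifted.m_inv_consistent[OF subgroup_L hL] by simp
qed

abbreviation "idx \<equiv> {..<4 :: nat} \<times> {..<3 :: nat}"

lemma el_cong: "(\<And>i. i \<in> idx \<Longrightarrow> v i = w i) \<Longrightarrow> el v = el w"
  by (simp add: el_def coord_def fun_eq_iff)

text \<open>A coset is determined by the twelve coefficients of a representative modulo
  \<open>m\<close>: if g = h + m w with w in the order, then g h^-1 = 1 + m w h^-1.\<close>

lemma finite_index_Kc:
  assumes m: "m > 0" shows "finite (rcosets\<^bsub>LG\<^esub> (Kc m))"
proof -
  interpret K: normal "Kc m" LG by (rule normal_Kc)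
  define rep where "rep C = (SOME g. g \<in> C)" for C :: "lifted_elt set"
  define cf where "cf g = (SOME v. snd g = el v)" for g :: lifted_elt
  define res where "res C = restrict (\<lambda>i. cf (rep C) i mod int m) idx" for C
  have rep: "rep C \<in> L" "C = Kc m #>\<^bsub>LG\<^esub> rep C" if "C \<in> rcosets\<^bsub>LG\<^esub> (Kc m)" for C
  proof -
    obtain g where g: "g \<in> carrier LG" "C = Kc m #>\<^bsub>LG\<^esub> g" using \<open>C \<in> _\<close> by (auto simp: RCOSETS_def)
    have r: "rep C \<in> C" unfolding rep_def g(2) using LG.rcos_self[OF g(1) K.subgroup_axioms] by (rule someI)
    then show "C = Kc m #>\<^bsub>LG\<^esub> rep C"
      using LG.repr_independence[OF _ g(1) K.subgroup_axioms] g(2) by metis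
    show "rep C \<in> L" using r K.rcosets_carrier[OF LG.is_group \<open>C \<in> _\<close>] by auto
  qed
  have cf: "snd g = el (cf g)" if "g \<in> L" for g
    unfolding cf_def using someI_ex[OF Ord_el[OF L_Ord[OF that]]] .
  have "inj_on res (rcosets\<^bsub>LG\<^esub> (Kc m))"
  proof (rule inj_onI)
    fix C D assume CD: "C \<in> rcosets\<^bsub>LG\<^esub> (Kc m)" "D \<in> rcosets\<^bsub>LG\<^esub> (Kc m)" "res C = res D"
    let ?g = "rep C" and ?h = "rep D"
    have gh: "?g \<in> L" "?h \<in> L" using rep CD by auto
    define w where "w i = (cf ?g i - cf ?h i) div int m" for i
    have "int m * w i = cf ?g i - cf ?h i" if "i \<in> idx" for i
    proof -
      have "cf ?g i mod int m = cf ?h i mod int m" using fun_cong[OF CD(3), of i] that by (simp add: res_def)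
      then have "int m dvd cf ?g i - cf ?h i" by (simp add: mod_eq_dvd_iff)
      then show ?thesis by (simp add: w_def)
    qed
    then have "el (cf ?g) = el (\<lambda>i. cf ?h i + int m * w i)" by (intro el_cong) simp
    then have e: "snd ?g k = snd ?h k + real m *\<^sub>R el w k" for k
      using cf gh el_linear(1)[of "cf ?h" "\<lambda>i. int m * w i" k] el_linear(3)[of "int m" w k] by simp
    let ?i = "inv\<^bsub>lifted\<^esub> ?h"
    have eq: "snd (?g \<otimes>\<^bsub>lifted\<^esub> ?i) k = qone + real m *\<^sub>R qmul (sig k) (el w k) (snd ?i k)" for k
      using L_carrier[OF gh(2)]
      by (simp add: snd_lifted_mult e qmul_add qmul_scale snd_lifted_inv qmul_conj lifted_qnorm)
    have "(\<lambda>k. qmul (sig k) (el w k) (snd ?i k)) \<in> Ord"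
      using L_Ord_mult[OF L_closed(2)[OF gh(2)] el_Ord] by blast
    then have "?g \<otimes>\<^bsub>lifted\<^esub> ?i \<in> Kc m"
      by (rule KcI[OF L_closed(1)[OF gh(1) L_closed(2)[OF gh(2)]] _ eq])
    moreover have "?g = (?g \<otimes>\<^bsub>lifted\<^esub> ?i) \<otimes>\<^bsub>lifted\<^esub> ?h"
      using L_carrier gh by (simp add: lifted.m_assoc)
    ultimately have "?g \<in> Kc m #>\<^bsub>LG\<^esub> ?h" unfolding r_coset_def by auto
    then have "Kc m #>\<^bsub>LG\<^esub> ?h = Kc m #>\<^bsub>LG\<^esub> ?g"
      using LG.repr_independence[OF _ _ K.subgroup_axioms] gh by auto
    then show "C = D" using rep CD by metis
  qed
  moreover have "res ` (rcosets\<^bsub>LG\<^esub> (Kc m)) \<subseteq> PiE idx (\<lambda>_. {0..<int m})"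
  proof (rule image_subsetI)
    fix C show "res C \<in> PiE idx (\<lambda>_. {0..<int m})"
      unfolding res_def restrict_PiE_iff using m by simp
  qed
  moreover have "finite (PiE idx (\<lambda>_. {0..<int m}))" by (intro finite_PiE) auto
  ultimately show ?thesis using finite_imageD finite_subset by blast
qed

text \<open>In SU(2) all entries have modulus at most 1, and at index 1 the determinant condition
  bounds the first entry by the second. So one entry at one place controls all entries.\<close>

lemma L_norm_bounds:
  assumes g: "g \<in> L" and B: "norm (snd (snd g 1)) \<le> B"
  shows "norm (fst (snd g k)) \<le> B + 1" "norm (snd (snd g k)) \<le> B + 1"
proof -
  have B0: "B \<ge> 0" using B norm_ge_zero order_trans by blast
  have n: "qnorm (sig k) (snd g k) = 1" by (rule lifted_qnorm[OF L_carrier[OF g]])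
  have "norm (fst (snd g k)) \<le> B + 1 \<and> norm (snd (snd g k)) \<le> B + 1"
  proof (cases "k = 1")
    case True
    have "(norm (fst (snd g k)))\<^sup>2 = 1 + (norm (snd (snd g k)))\<^sup>2" using n True by (simp add: qnorm_def)
    also have "\<dots> \<le> 1 + B\<^sup>2" using B True by (simp add: power_mono)
    also have "\<dots> \<le> (B + 1)\<^sup>2" using B0 by (simp add: power2_sum)
    finally have "norm (fst (snd g k)) \<le> B + 1" by (rule power2_le_imp_le) (use B0 in simp)
    then show ?thesis using B True by simp
  next
    case False
    then have "(norm (fst (snd g k)))\<^sup>2 + (norm (snd (snd g k)))\<^sup>2 = 1" using n by (simp add: qnorm_def sig_def)
    then have "(norm (fst (snd g k)))\<^sup>2 \<le> 1" "(norm (snd (snd g k)))\<^sup>2 \<le> 1"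
      using zero_le_power2[of "norm (fst (snd g k))"] zero_le_power2[of "norm (snd (snd g k))"] by linarith+
    then show ?thesis using B0 by (simp add: abs_square_le_1)
  qed
  then show "norm (fst (snd g k)) \<le> B + 1" "norm (snd (snd g k)) \<le> B + 1" by auto
qed

lemma discrete_L: "finite {snd g | g. g \<in> L \<and> cmod (snd (snd g 1)) \<le> B}"
proof -
  obtain M where M: "\<And>v e j. (\<And>k. norm (fst (el v k)) \<le> B + 1) \<Longrightarrow> (\<And>k. norm (snd (el v k)) \<le> B + 1) \<Longrightarrow>
    e < 4 \<Longrightarrow> j < 3 \<Longrightarrow> \<bar>v (e, j)\<bar> \<le> M" using el_bounded[of "B + 1"] by metis
  have "{snd g | g. g \<in> L \<and> cmod (snd (snd g 1)) \<le> B} \<subseteq> el ` PiE idx (\<lambda>_. {-M..M})"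
  proof
    fix q assume "q \<in> {snd g | g. g \<in> L \<and> cmod (snd (snd g 1)) \<le> B}"
    then obtain g where g: "g \<in> L" "cmod (snd (snd g 1)) \<le> B" "q = snd g" by blast
    obtain v where v: "snd g = el v" using Ord_el[OF L_Ord[OF g(1)]] by blast
    have "\<bar>v (e, j)\<bar> \<le> M" if "e < 4" "j < 3" for e j
      using L_norm_bounds[OF g(1,2)] v that by (intro M) auto
    then have "restrict v idx \<in> PiE idx (\<lambda>_. {-M..M})" by (auto simp: abs_le_iff) (smt (verit))
    moreover have "q = el (restrict v idx)" unfolding g(3) v by (rule el_cong) simp
    ultimately show "q \<in> el ` PiE idx (\<lambda>_. {-M..M})" by blast
  qed
  moreover have "finite (PiE idx (\<lambda>_. {-M..M}))" by (intro finite_PiE) auto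
  ultimately show ?thesis using finite_surj by blast
qed

text \<open>The coefficients of g - 1 are multiples of \<open>m\<close>, and they vanish once they
  are bounded by some \<open>M < m\<close>. The bound \<open>B + 2\<close> leaves room for
  subtracting the identity from entries bounded by \<open>B + 1\<close>.\<close>

lemma Kc_small:
  "\<exists>m>0. \<forall>g\<in>Kc m. cmod (snd (snd g 1)) \<le> B \<longrightarrow> snd g = (\<lambda>k. qone)"
proof -
  obtain M where M: "\<And>v e j. (\<And>k. norm (fst (el v k)) \<le> B + 2) \<Longrightarrow> (\<And>k. norm (snd (el v k)) \<le> B + 2) \<Longrightarrow>
    e < 4 \<Longrightarrow> j < 3 \<Longrightarrow> \<bar>v (e, j)\<bar> \<le> M" using el_bounded[of "B + 2"] by metis
  define m where "m = nat \<bar>M\<bar> + 1"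
  have "snd g = (\<lambda>k. qone)" if g: "g \<in> Kc m" "cmod (snd (snd g 1)) \<le> B" for g
  proof -
    obtain o1 where o: "o1 \<in> Ord" "snd g = (\<lambda>k. qone + real m *\<^sub>R o1 k)" using g by (auto simp: Kc_def)
    obtain v where v: "o1 = el v" using Ord_el[OF o(1)] by blast
    let ?u = "\<lambda>i. int m * v i"
    have u: "el ?u k = snd g k - qone" for k by (simp add: el_linear o(2) v)
    have b: "norm (fst (snd g k)) \<le> B + 1" "norm (snd (snd g k)) \<le> B + 1" for k
      by (rule L_norm_bounds[OF Kc_L[OF g(1)] g(2)])+
    have "norm (fst (el ?u k)) \<le> B + 2" for k
      using b(1)[of k] norm_triangle_ineq4[of "fst (snd g k)" 1] by (simp add: u qone_def)
    moreover have "norm (snd (el ?u k)) \<le> B + 2" for k using b(2)[of k] by (simp add: u qone_def)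
    ultimately have bd: "\<bar>?u (e, j)\<bar> \<le> M" if "e < 4" "j < 3" for e j using that by (intro M) auto
    have "v i = 0" if i: "i \<in> idx" for i
    proof (rule ccontr)
      assume "v i \<noteq> 0"
      then have "int m * 1 \<le> int m * \<bar>v i\<bar>" by (intro mult_left_mono) auto
      moreover have "int m * \<bar>v i\<bar> \<le> M" using bd[of "fst i" "snd i"] i by (auto simp: abs_mult)
      ultimately show False by (simp add: m_def)
    qed
    then have "el v = el (\<lambda>_. 0)" by (intro el_cong) simp
    then show ?thesis using o(2) v by (simp add: el_def coord_def)
  qed
  moreover have "m > 0" by (simp add: m_def)
  ultimately show ?thesis by blast
qed

subsection \<open>Cocompactness\<close>

text \<open>Some rotation by a multiple of \<open>2 * pi / 7\<close> brings any direction to within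
  \<open>pi / 7\<close> of the positive imaginary axis; rounding finds it.\<close>

lemma rotate_up:
  obtains n :: nat where "Im (cis (2 * real n * pi / 7) * z) \<ge> cmod z * cos (pi / 7)"
proof -
  obtain \<phi> where z: "z = of_real (cmod z) * cis \<phi>" using rcis_cmod_Arg[of z] by (metis rcis_def)
  define k where "k = round ((pi / 2 - \<phi>) * 7 / (2 * pi))"
  have "\<bar>real_of_int k - (pi / 2 - \<phi>) * 7 / (2 * pi)\<bar> \<le> 1 / 2" unfolding k_def by (rule of_int_round_abs_le)
  then have "\<bar>real_of_int k - (pi / 2 - \<phi>) * 7 / (2 * pi)\<bar> * (2 * pi / 7) \<le> 1 / 2 * (2 * pi / 7)"
    by (intro mult_right_mono) auto
  also have "\<bar>real_of_int k - (pi / 2 - \<phi>) * 7 / (2 * pi)\<bar> * (2 * pi / 7)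
      = \<bar>(real_of_int k - (pi / 2 - \<phi>) * 7 / (2 * pi)) * (2 * pi / 7)\<bar>"
    by (simp add: abs_mult)
  also have "(real_of_int k - (pi / 2 - \<phi>) * 7 / (2 * pi)) * (2 * pi / 7) = 2 * real_of_int k * pi / 7 + \<phi> - pi / 2"
    by (simp add: field_simps)
  finally have k: "\<bar>2 * real_of_int k * pi / 7 + \<phi> - pi / 2\<bar> \<le> pi / 7" by simp
  \<comment> \<open>Reduction modulo 7 makes the exponent a natural number, for use in a power of
    \<open>gw\<close>.\<close>
  define n where "n = nat (k mod 7)"
  have "k = int n + 7 * (k div 7)" by (simp add: n_def)
  then have kn: "real_of_int k = real n + 7 * real_of_int (k div 7)" by (metis of_int_add of_int_mult of_int_numeral of_int_of_nat_eq)
  have "cis (2 * real_of_int k * pi / 7) = cis (2 * real n * pi / 7) * cis (2 * pi * real_of_int (k div 7))"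
    unfolding kn cis_mult by (rule arg_cong[of _ _ cis]) (simp add: field_simps)
  also have "cis (2 * pi * real_of_int (k div 7)) = 1" by (rule cis_multiple_2pi) simp
  finally have c: "cis (2 * real n * pi / 7) = cis (2 * real_of_int k * pi / 7)" by simp
  have "cos (pi / 7) \<le> cos \<bar>2 * real_of_int k * pi / 7 + \<phi> - pi / 2\<bar>"
    using k by (intro cos_monotone_0_pi_le) auto
  also have "\<dots> = sin (2 * real_of_int k * pi / 7 + \<phi>)" by (simp add: cos_diff)
  finally have "cmod z * cos (pi / 7) \<le> cmod z * sin (2 * real_of_int k * pi / 7 + \<phi>)"
    by (intro mult_left_mono) auto
  also have "\<dots> = Im (cis (2 * real_of_int k * pi / 7) * (of_real (cmod z) * cis \<phi>))"
    by (simp add: sin_add algebra_simps)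
  also have "\<dots> = Im (cis (2 * real n * pi / 7) * z)" using z c by simp
  finally show thesis by (rule that)
qed

lemma J_gx: "(cmod (J (Xq 1) u))\<^sup>2 = (sc 1)\<^sup>2 + (bt 1)\<^sup>2 * (cmod u)\<^sup>2 - 2 * sc 1 * bt 1 * Im u"
  unfolding cmod_power2 J_def Xq_def by (simp add: power2_eq_square algebra_simps)

text \<open>On the unit circle, at angle \<open>pi / 7\<close> from the imaginary axis, the squared
  modulus of \<open>J\<close> is \<open>V\<close>. The relation
  \<open>s * sin (pi / 7) = 1 / 2\<close> gives
  \<open>(s * c)\<^sup>2 = s\<^sup>2 - 1 / 4 > b\<^sup>2\<close>, hence \<open>V < 1\<close>. Half
  of this gap survives in a ring along the boundary.\<close>

lemma contraction_constants:
  "\<exists>r \<mu>. 0 \<le> r \<and> r < 1 \<and> 0 < \<mu> \<and> \<mu> < 1 \<and> (\<forall>u. cmod u < 1 \<longrightarrow> r \<le> cmod u \<longrightarrow>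
    cmod u * cos (pi / 7) \<le> Im u \<longrightarrow> (cmod (J (Xq 1) u))\<^sup>2 \<le> \<mu>)"
proof -
  define s b c where "s = sc 1" and "b = bt 1" and "c = cos (pi / 7)"
  have s: "s > 1" "s * sin (pi / 7) = 1 / 2" and b: "b > 0" "b\<^sup>2 = s\<^sup>2 - 1"
    using sc_1 sc_sin[of 1] bt_pos[of 1] bt_sq[of 1] by (simp_all add: s_def b_def ang_def)
  have c0: "c > 0" unfolding c_def by (rule cos_gt_zero) (use pi_gt_zero in linarith)+
  have "s\<^sup>2 * c\<^sup>2 + (s * sin (pi / 7))\<^sup>2 = s\<^sup>2 * (c\<^sup>2 + (sin (pi / 7))\<^sup>2)"
    by (simp add: power_mult_distrib algebra_simps)
  then have "(s * c)\<^sup>2 = s\<^sup>2 - 1 / 4" unfolding s(2) c_def by (simp add: power_mult_distrib power_divide)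
  then have "b\<^sup>2 < (s * c)\<^sup>2" using b by simp
  then have bsc: "b < s * c" by (rule power2_less_imp_less) (use s c0 in simp)
  define V where "V = s\<^sup>2 + b\<^sup>2 - 2 * b * (s * c)"
  have "b * b < b * (s * c)" using bsc b by simp
  moreover have "2 * b * (s * c) = 2 * (b * (s * c))" "b * b = b\<^sup>2" by (simp_all add: power2_eq_square)
  ultimately have V: "V < 1" using b(2) unfolding V_def by linarith
  have D: "4 * b * (s * c) > 0" using b s c0 by simp
  \<comment> \<open>Width of the ring: replacing 1 by \<open>1 - d\<close> costs
    \<open>2 * s * b * (d * c)\<close>, which is half of the gap \<open>1 - V\<close>.\<close>
  define d where "d = (1 - V) / (4 * b * (s * c))"
  have d: "d > 0" using V D by (simp add: d_def)
  define r where "r = max 0 (1 - d)"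
  \<comment> \<open>The entry \<open>1 / 2\<close> makes positivity of \<open>\<mu>\<close>
    immediate.\<close>
  define \<mu> where "\<mu> = max (1 / 2) ((1 + V) / 2)"
  have "(cmod (J (Xq 1) u))\<^sup>2 \<le> \<mu>" if u: "cmod u < 1" "r \<le> cmod u" "cmod u * cos (pi / 7) \<le> Im u" for u
  proof -
    have "(cmod u)\<^sup>2 \<le> 1" using u(1) by (simp add: abs_square_le_1)
    then have 1: "b\<^sup>2 * (cmod u)\<^sup>2 \<le> b\<^sup>2 * 1" by (intro mult_left_mono) auto
    have "(1 - d) * c \<le> cmod u * c" using u(2) c0 by (intro mult_right_mono) (auto simp: r_def)
    then have "(1 - d) * c \<le> Im u" using u(3)[folded c_def] by linarith
    then have "2 * s * b * ((1 - d) * c) \<le> 2 * s * b * Im u" using s b by (intro mult_left_mono) auto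
    moreover have "4 * b * (s * c) * d = 1 - V"
      using D unfolding d_def by (metis less_irrefl nonzero_mult_div_cancel_left times_divide_eq_right)
    then have "2 * s * b * (d * c) = (1 - V) / 2" by (simp add: algebra_simps)
    ultimately have "s\<^sup>2 + b\<^sup>2 * (cmod u)\<^sup>2 - 2 * s * b * Im u \<le> V + (1 - V) / 2"
    proof -
      assume i: "2 * s * b * ((1 - d) * c) \<le> 2 * s * b * Im u" and e: "2 * s * b * (d * c) = (1 - V) / 2"
      have "2 * s * b * ((1 - d) * c) = 2 * b * (s * c) - 2 * s * b * (d * c)" by (simp add: algebra_simps)
      then show ?thesis using 1 i e V_def by linarith
    qed
    then have "s\<^sup>2 + b\<^sup>2 * (cmod u)\<^sup>2 - 2 * s * b * Im u \<le> (1 + V) / 2" by (simp add: field_simps)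
    then show ?thesis unfolding J_gx s_def[symmetric] b_def[symmetric] \<mu>_def by (rule max.coboundedI2)
  qed
  moreover have "0 \<le> r" "r < 1" "0 < \<mu>" "\<mu> < 1" using d V by (auto simp: r_def \<mu>_def)
  ultimately show ?thesis by blast
qed

lemma mob_rotation: "mob (cis t, 0) z = cis (2 * t) * z"
proof -
  have "cis (2 * t) * cis (- t) = cis t" by (simp add: cis_mult)
  then have "cis t * z = cis (2 * t) * z * cis (- t)" by (metis mult.assoc mult.commute)
  then show ?thesis by (simp add: mob_def J_def cis_cnj nonzero_divide_eq_eq)
qed

text \<open>At a point outside the ball of radius \<open>r\<close>, a rotation followed by
  \<open>gx\<close> multiplies \<open>1 - (cmod z)\<^sup>2\<close> by at least
  \<open>1 / \<mu>\<close>. If the orbit avoided the ball, this quantity would eventually exceed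
  1.\<close>

lemma cocompact_L:
  "\<exists>r. 0 \<le> r \<and> r < 1 \<and> (\<forall>z\<in>disc. \<exists>g\<in>L. cmod (mob (snd g 1) z) \<le> r)"
proof -
  obtain r \<mu> where r: "0 \<le> r" "r < 1" "0 < \<mu>" "\<mu> < 1"
    and \<mu>: "\<And>u. cmod u < 1 \<Longrightarrow> r \<le> cmod u \<Longrightarrow> cmod u * cos (pi / 7) \<le> Im u \<Longrightarrow> (cmod (J (Xq 1) u))\<^sup>2 \<le> \<mu>"
    using contraction_constants by metis
  have step: "\<exists>g\<in>L. 1 - (cmod (mob (snd g 1) z))\<^sup>2 \<ge> (1 - (cmod z)\<^sup>2) / \<mu>"
    if z: "z \<in> disc" "r \<le> cmod z" for z
  proof -
    obtain n where n: "Im (cis (2 * real n * pi / 7) * z) \<ge> cmod z * cos (pi / 7)" by (rule rotate_up)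
    let ?u = "cis (2 * real n * pi / 7) * z"
    let ?h = "gw [^]\<^bsub>lifted\<^esub> n"
    have uz: "cmod ?u = cmod z" by (simp add: norm_mult)
    have h: "?h \<in> L" by (rule L_closed(4)[OF gw_L])
    have "mob (snd ?h 1) z = ?u" by (simp add: gw_power mob_rotation ang_def mult.assoc)
    then have m: "mob (snd (gx \<otimes>\<^bsub>lifted\<^esub> ?h) 1) z = mob (Xq 1) ?u"
      using mob_mult[of "Xq 1" "snd ?h 1" z] lifted_qnorm[OF L_carrier[OF h], of 1] qnorm_Xq[of 1] z
      by (simp add: snd_lifted_mult) (simp add: gx_def)
    have ud: "?u \<in> disc" using z uz by simp
    have q: "qnorm 1 (Xq 1) = 1" using qnorm_Xq[of 1] by simp
    have "(cmod (J (Xq 1) ?u))\<^sup>2 \<le> \<mu>" using \<mu>[of ?u] n z uz by simp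
    then have "(1 - (cmod z)\<^sup>2) / \<mu> \<le> (1 - (cmod ?u)\<^sup>2) / (cmod (J (Xq 1) ?u))\<^sup>2"
      unfolding uz using disc_pos[OF z(1)] J_nz[OF q ud] r(3) by (intro divide_left_mono) auto
    then show ?thesis using one_minus_mob_norm[OF q ud] m L_closed(1)[OF gx_L h] by metis
  qed
  have "\<exists>g\<in>L. cmod (mob (snd g 1) z) \<le> r" if z: "z \<in> disc" for z
  proof (rule ccontr)
    assume no: "\<not> ?thesis"
    have "\<exists>g\<in>L. 1 - (cmod (mob (snd g 1) z))\<^sup>2 \<ge> (1 - (cmod z)\<^sup>2) / \<mu> ^ n" for n
    proof (induction n)
      case 0
      show ?case by (intro bexI[OF _ L_closed(3)]) (simp add: lifted_simps)
    next
      case (Suc n)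
      then obtain g where g: "g \<in> L" "1 - (cmod (mob (snd g 1) z))\<^sup>2 \<ge> (1 - (cmod z)\<^sup>2) / \<mu> ^ n" by blast
      have gq: "qnorm 1 (snd g 1) = 1" using lifted_qnorm[OF L_carrier[OF g(1)], of 1] by simp
      let ?y = "mob (snd g 1) z"
      have y: "?y \<in> disc" "r \<le> cmod ?y" using mob_closed[OF gq z] no g(1) by (auto simp: not_le less_imp_le)
      obtain h where h: "h \<in> L" "1 - (cmod (mob (snd h 1) ?y))\<^sup>2 \<ge> (1 - (cmod ?y)\<^sup>2) / \<mu>"
        using step[OF y] by blast
      have "(1 - (cmod z)\<^sup>2) / \<mu> ^ Suc n = (1 - (cmod z)\<^sup>2) / \<mu> ^ n / \<mu>" by simp
      also have "\<dots> \<le> (1 - (cmod ?y)\<^sup>2) / \<mu>" using g(2) r(3) by (intro divide_right_mono) auto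
      also have "\<dots> \<le> 1 - (cmod (mob (snd h 1) ?y))\<^sup>2" by (rule h(2))
      also have "mob (snd h 1) ?y = mob (snd (h \<otimes>\<^bsub>lifted\<^esub> g) 1) z"
        using mob_mult[OF _ gq z, of "snd h 1"] lifted_qnorm[OF L_carrier[OF h(1)], of 1]
        by (simp add: snd_lifted_mult)
      finally show ?case using L_closed(1)[OF h(1) g(1)] by blast
    qed
    then have "(1 - (cmod z)\<^sup>2) / \<mu> ^ n \<le> 1" for n
      by (metis diff_ge_0_iff_ge diff_left_mono diff_zero dual_order.trans zero_le_power2)
    then have "1 - (cmod z)\<^sup>2 \<le> \<mu> ^ n" for n using r(3) by (simp add: divide_le_eq)
    moreover obtain n where "\<mu> ^ n < 1 - (cmod z)\<^sup>2"
      using real_arch_pow_inv[OF disc_pos[OF z] r(4)] by blast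
    ultimately show False by (meson not_le)
  qed
  then show ?thesis using r by blast
qed

theorem theorem8p1:
  shows "\<exists>X :: (nat \<Rightarrow> real) topology.
           topspace X \<noteq> {} \<and> closed_manifold 5 X \<and> aspherical X \<and>
           (\<forall>x \<in> topspace X. perfect_group (fundamental_group X x))"
proof -
  obtain r where r: "0 \<le> r" "r < 1" "\<And>z. z \<in> disc \<Longrightarrow> \<exists>g\<in>L. cmod (mob (snd g 1) z) \<le> r"
    using cocompact_L by blast
  \<comment> \<open>The bound is that of \<open>snd_bounded\<close>: it covers every element that
    moves some point of the ball of radius \<open>r\<close> to a point of that ball.\<close>
  obtain m where m: "m > 0" "\<And>g. g \<in> Kc m \<Longrightarrow>
      cmod (snd (snd g 1)) \<le> 1 / ((1 - r) * sqrt (1 - r\<^sup>2)) \<Longrightarrow> snd g = (\<lambda>k. qone)"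
    using Kc_small by metis
  interpret disc_lattice L "Kc m" r
  proof (rule disc_lattice.intro)
    show "subgroup L lifted" "derived LG L = L" "Kc m \<lhd> LG" "finite (rcosets\<^bsub>LG\<^esub> Kc m)" "0 \<le> r" "r < 1"
      by (fact subgroup_L perfect_L normal_Kc finite_index_Kc[OF m(1)] r)+
    show "\<exists>g\<in>L. cmod (mob (snd g 1) z) \<le> r" if "z \<in> disc" for z by (rule r(3)[OF that])
    show "finite {snd g | g. g \<in> L \<and> cmod (snd (snd g 1)) \<le> B}" for B by (rule discrete_L)
    show "\<exists>t\<in>L. fst t = pi \<and> snd t 1 = (- 1, 0)"
      using L_closed(4)[OF gw_L, of 7] gw_7 by (intro bexI[of _ "gw [^]\<^bsub>lifted\<^esub> (7 :: nat)"]) (simp_all add: qone_def)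
    fix k z assume k: "k \<in> Kc m" and z: "z \<in> disc" and fixed: "mob (snd k 1) z = z"
    \<comment> \<open>Since \<open>Kc m\<close> is normal, the fixed point may be moved into the
      ball of radius \<open>r\<close>, where the choice of \<open>m\<close> forces the conjugate to
      have trivial matrices.\<close>
    obtain h where h: "h \<in> L" "cmod (mob (snd h 1) z) \<le> r" using r(3)[OF z] by blast
    have c: "h \<in> carrier lifted" "k \<in> carrier lifted" using L_carrier h k Kc_L by blast+
    let ?i = "inv\<^bsub>lifted\<^esub> h"
    define k' where "k' = h \<otimes>\<^bsub>lifted\<^esub> k \<otimes>\<^bsub>lifted\<^esub> ?i"
    have k': "k' \<in> Kc m" unfolding k'_def by (rule Kc_conj[OF k h(1)])
    have n: "qnorm 1 (snd g 1) = 1" if "g \<in> carrier lifted" for g using lifted_qnorm[OF that, of 1] by simp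
    have mm: "mob (snd (f \<otimes>\<^bsub>lifted\<^esub> g) 1) u = mob (snd f 1) (mob (snd g 1) u)"
      if "f \<in> carrier lifted" "g \<in> carrier lifted" "u \<in> disc" for f g u
      using mob_mult[OF n n, OF that] by (simp add: snd_lifted_mult)
    let ?z = "mob (snd h 1) z"
    have zd: "?z \<in> disc" by (rule mob_closed[OF n[OF c(1)] z])
    have "mob (snd ?i 1) ?z = z"
      using mm[of ?i h z] c z by (simp add: lifted_simps)
    then have "mob (snd k' 1) ?z = ?z" unfolding k'_def using mm c zd z fixed by simp
    then have "snd k' = (\<lambda>k. qone)"
      using m(2)[OF k'] snd_bounded[OF n[OF L_carrier[OF Kc_L[OF k']]] r(2) h(2)] h(2) by simp
    moreover have "k = ?i \<otimes>\<^bsub>lifted\<^esub> k' \<otimes>\<^bsub>lifted\<^esub> h"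
      unfolding k'_def using c by (simp add: lifted.group_normalize)
    ultimately show "snd k 1 = qone"
      using c by (simp add: snd_lifted_mult snd_lifted_inv qmul_conj n)
  qed
  show ?thesis by (rule perfect_manifold)
qed

end
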